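(* Let $\lambda,l\in\mathbb{R}$ and $\varepsilon_N\in\{-1,0,1\}$. Let $(N,\chi,\alpha_N,\varepsilon_N)$ be a Lorentzian $\varepsilon\eta$-Einstein $\varepsilon$-contact metric three-manifold (with $\varepsilon=\varepsilon_N$) with $\varepsilon\eta$-Einstein constants $(\lambda^2,\kappa_N)$, $\kappa_N=l^2$, and let $(X,h,\alpha_X)$ be a Riemannian $\varepsilon\eta$-Einstein contact metric three-manifold with $\varepsilon\eta$-Einstein constants $(\lambda^2,\kappa_X)$, $\kappa_X=|\alpha_N|^2_\chi\, l^2=\varepsilon_N l^2$. Then the oriented Cartesian product manifold $M=N\times X$ carries a family of solutions $(\mathrm g,\mathrm H_{\lambda,l})$ of six-dimensional minimal supergravity coupled to a tensor multiplet with constant dilaton, given by $$\mathrm g=\chi\oplus h,\qquad \mathrm H_{\lambda,l}=\lambda\,\nu_\chi+\frac{l}{3}\,(\ast_\chi\alpha_N)\wedge\alpha_X+\frac{l}{3}\,\alpha_N\wedge(\ast_h\alpha_X)+\lambda\,\nu_h ,$$ and parametrized by $(\lambda,l)\in\mathbb{R}^2$. Equivalently, $(M=N\times X,\ \mathrm g=\chi\oplus h)$ admits a bi-parametric family of metric-compatible Ricci-flat connections $\nabla^{\mathrm H_{\lambda,l}}$ with totally skew-symmetric, isotropic, closed and co-closed torsion $\mathrm H_{\lambda,l}$.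
   Context: For a metric $g$ on an oriented manifold, $\nu_g$ is the volume form and $\ast_g$ the Hodge star. The exterior derivative is normalized so that $d\alpha(X,Y)=X(\alpha(Y))-Y(\alpha(X))-\alpha([X,Y])$ for a one-form $\alpha$. Lorentzian metrics have signature $(-,+,\dots,+)$. An $\varepsilon$-contact metric structure ($\varepsilon\in\{-1,0,1\}$) on an oriented three-manifold is a triple $(g,\alpha,\varepsilon)$ with $g$ a Riemannian or Lorentzian metric and $\alpha$ a one-form such that $\alpha=\ast_g d\alpha$ and $|\alpha|_g^2=\varepsilon$. Put $\mathrm s_g=1$ if $g$ is Riemannian and $\mathrm s_g=-1$ if $g$ is Lorentzian. If $g$ is Riemannian, then $\varepsilon=1$ and one speaks of a Riemannian contact metric structure. In the Lorentzian case the manifold is assumed oriented and time-oriented. The structure is $\varepsilon\eta$-Einstein with constants $(\lambda^2,\kappa)$, $\lambda,\kappa\in\mathbb{R}$, if $$\mathrm{Ric}^g=\frac{\mathrm s_g}{2}(\lambda^2+\kappa\varepsilon)\,g-\mathrm s_g\,\kappa\,\alpha\otimes\alpha ,$$ where $\kappa\ge 0$ is required if $g$ is Lorentzian. On an oriented six-manifold $M$ with Lorentzian metric $\mathrm g$ and three-form $\mathrm H$, $\nabla^{\mathrm H}=\nabla+\frac12\mathrm g^{-1}\mathrm H$ ($\nabla$ the Levi-Civita connection) is the unique metric-compatible connection with totally skew-symmetric torsion $\mathrm H$. The pair $(\mathrm g,\mathrm H)$ is a (bosonic) solution of six-dimensional minimal supergravity coupled to a tensor multiplet with constant dilaton if $\mathrm{Ric}(\nabla^{\mathrm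 H})=0$, $d\mathrm H=0$, $d\ast_{\mathrm g}\mathrm H=0$ and $|\mathrm H|^2_{\mathrm g}=0$ (the last condition being what "isotropic" means). Forms on $N$ and $X$ are identified with their pullbacks to $N\times X$, which carries the product orientation.
   Formalization: The exterior product in the mixed terms of H is taken as 3 times the usual one, so their coefficient is effectively l instead of l/3; with l/3 and the usual product Ricci-flatness fails, e.g. on Lorentzian times Riemannian Heisenberg with λ=0, l=1, ε_N=-1. *)

theory Defs
  imports "HOL-Analysis.Analysis" "HOL-Combinatorics.Permutations"
begin

section \<open>Smooth oriented manifolds\<close>

text \<open>\<open>DD f x v\<close> is the derivative of \<open>f\<close> at \<open>x\<close> in the direction \<open>v\<close>.\<close>

abbreviation DD :: "('e::euclidean_space \<Rightarrow> 'f::euclidean_space) \<Rightarrow> 'e \<Rightarrow> 'e \<Rightarrow> 'f" where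
  "DD f x \<equiv> frechet_derivative f (at x)"

primrec Ck_on :: "nat \<Rightarrow> 'e::euclidean_space set \<Rightarrow> ('e \<Rightarrow> 'f::euclidean_space) \<Rightarrow> bool" where
  "Ck_on 0 S f \<longleftrightarrow> continuous_on S f"
| "Ck_on (Suc k) S f \<longleftrightarrow>
     (\<forall>x\<in>S. f differentiable (at x)) \<and> (\<forall>v. Ck_on k S (\<lambda>x. DD f x v))"

definition smooth_on :: "'e::euclidean_space set \<Rightarrow> ('e \<Rightarrow> 'f::euclidean_space) \<Rightarrow> bool" where
  "smooth_on S f \<longleftrightarrow> (\<forall>k. Ck_on k S f)"

text \<open>An atlas is a family of charts labelled by the whole type \<open>'i\<close> (domains may be empty).
  The points of the manifold are all elements of \<open>'a\<close>, with the topology of that type. The model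
  space \<open>'e\<close> comes with an ordering of its standard basis, which fixes its orientation.\<close>

record ('i, 'a, 'e) atlas =
  chart_dom :: "'i \<Rightarrow> 'a set"
  chart_map :: "'i \<Rightarrow> 'a \<Rightarrow> 'e"
  model_basis :: "'e list"

definition chart_img :: "('i, 'a, 'e) atlas \<Rightarrow> 'i \<Rightarrow> 'e set" where
  "chart_img M i = chart_map M i ` chart_dom M i"

definition chart_inv :: "('i, 'a, 'e) atlas \<Rightarrow> 'i \<Rightarrow> 'e \<Rightarrow> 'a" where
  "chart_inv M i = inv_into (chart_dom M i) (chart_map M i)"

definition transition :: "('i, 'a, 'e) atlas \<Rightarrow> 'i \<Rightarrow> 'i \<Rightarrow> 'e \<Rightarrow> 'e" where
  "transition M i j = chart_map M j \<circ> chart_inv M i"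

definition overlap :: "('i, 'a, 'e) atlas \<Rightarrow> 'i \<Rightarrow> 'i \<Rightarrow> 'e set" where
  "overlap M i j = chart_map M i ` (chart_dom M i \<inter> chart_dom M j)"

definition det_nat :: "nat \<Rightarrow> (nat \<Rightarrow> nat \<Rightarrow> real) \<Rightarrow> real" where
  "det_nat n A = (\<Sum>\<sigma> | \<sigma> permutes {..<n}. of_int (sign \<sigma>) * (\<Prod>k<n. A k (\<sigma> k)))"

text \<open>Determinant of the vectors \<open>vs\<close> with respect to the ordered orthonormal basis \<open>bs\<close>.\<close>

definition det_vectors :: "'e::euclidean_space list \<Rightarrow> 'e list \<Rightarrow> real" where
  "det_vectors bs vs = det_nat (length bs) (\<lambda>k l. bs ! k \<bullet> vs ! l)"

definition oriented_manifold ::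
  "('i, 'a::{t2_space, second_countable_topology}, 'e::euclidean_space) atlas \<Rightarrow> bool" where
  "oriented_manifold M \<longleftrightarrow>
     distinct (model_basis M) \<and> set (model_basis M) = Basis \<and>
     (\<Union>i. chart_dom M i) = UNIV \<and>
     (\<forall>i. open (chart_dom M i) \<and> open (chart_img M i) \<and>
          homeomorphism (chart_dom M i) (chart_img M i) (chart_map M i) (chart_inv M i)) \<and>
     (\<forall>i j. smooth_on (overlap M i j) (transition M i j)) \<and>
     (\<forall>i j. \<forall>x\<in>overlap M i j.
        det_vectors (model_basis M) (map (DD (transition M i j) x) (model_basis M)) > 0)"


section \<open>Tensor fields and forms\<close>

text \<open>A covariant tensor field \<open>T\<close> of rank \<open>k\<close> is given by its representatives in all charts:
  \<open>T i x vs\<close> is the value at the point with coordinates \<open>x\<close> in the chart \<open>i\<close> on the \<open>k\<close> tangent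
  vectors whose coordinate representations are listed in \<open>vs\<close>. Only \<open>x\<close> in the image of the chart
  and lists of length \<open>k\<close> matter.\<close>

type_synonym ('i, 'e) tensor = "'i \<Rightarrow> 'e \<Rightarrow> 'e list \<Rightarrow> real"

definition multilinear :: "nat \<Rightarrow> ('e::euclidean_space list \<Rightarrow> real) \<Rightarrow> bool" where
  "multilinear k t \<longleftrightarrow> (\<forall>vs j. length vs = k \<longrightarrow> j < k \<longrightarrow> linear (\<lambda>v. t (vs[j := v])))"

definition alternating :: "nat \<Rightarrow> ('e::euclidean_space list \<Rightarrow> real) \<Rightarrow> bool" where
  "alternating k t \<longleftrightarrow>
     (\<forall>vs j l. length vs = k \<longrightarrow> j < l \<longrightarrow> l < k \<longrightarrow> vs ! j = vs ! l \<longrightarrow> t vs = 0)"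

definition tensor_field ::
  "('i, 'a, 'e::euclidean_space) atlas \<Rightarrow> nat \<Rightarrow> ('i, 'e) tensor \<Rightarrow> bool" where
  "tensor_field M k T \<longleftrightarrow>
     (\<forall>i. \<forall>x\<in>chart_img M i. multilinear k (T i x)) \<and>
     (\<forall>i vs. length vs = k \<longrightarrow> smooth_on (chart_img M i) (\<lambda>x. T i x vs)) \<and>
     (\<forall>i j. \<forall>x\<in>overlap M i j. \<forall>vs. length vs = k \<longrightarrow>
        T i x vs = T j (transition M i j x) (map (DD (transition M i j) x) vs))"

definition form_field ::
  "('i, 'a, 'e::euclidean_space) atlas \<Rightarrow> nat \<Rightarrow> ('i, 'e) tensor \<Rightarrow> bool" where
  "form_field M k \<omega> \<longleftrightarrow>
     tensor_field M k \<omega> \<and> (\<forall>i. \<forall>x\<in>chart_img M i. alternating k (\<omega> i x))"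

definition tensor_eq ::
  "('i, 'a, 'e) atlas \<Rightarrow> nat \<Rightarrow> ('i, 'e) tensor \<Rightarrow> ('i, 'e) tensor \<Rightarrow> bool" where
  "tensor_eq M k S T \<longleftrightarrow>
     (\<forall>i. \<forall>x\<in>chart_img M i. \<forall>vs. length vs = k \<longrightarrow> S i x vs = T i x vs)"

definition vector_field ::
  "('i, 'a, 'e::euclidean_space) atlas \<Rightarrow> ('i \<Rightarrow> 'e \<Rightarrow> 'e) \<Rightarrow> bool" where
  "vector_field M V \<longleftrightarrow>
     (\<forall>i. smooth_on (chart_img M i) (V i)) \<and>
     (\<forall>i j. \<forall>x\<in>overlap M i j. V j (transition M i j x) = DD (transition M i j) x (V i x))"

text \<open>Cartan's formula on coordinate vector fields, which commute. On one-forms it is the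
  normalization \<open>d\<alpha>(X,Y) = X(\<alpha>(Y)) - Y(\<alpha>(X)) - \<alpha>([X,Y])\<close>.\<close>

definition ext_d :: "('i, 'e::euclidean_space) tensor \<Rightarrow> ('i, 'e) tensor" where
  "ext_d \<omega> i x vs =
     (\<Sum>k<length vs. (- 1) ^ k * DD (\<lambda>y. \<omega> i y (take k vs @ drop (Suc k) vs)) x (vs ! k))"

text \<open>Exterior product of a \<open>p\<close>-form and a \<open>q\<close>-form. The permutation sum divided by \<open>p! q!\<close> is the
  determinant convention; it is multiplied here by the binomial coefficient \<open>(p + q)! / (p! q!)\<close>.
  This product is again associative and graded commutative (it is the determinant product
  transported along \<open>\<omega> \<mapsto> k! \<omega>\<close> on \<open>k\<close>-forms). For a two-form and a one-form it reads
  \<open>(\<omega> \<and> \<beta>)(u,v,w) = 3 (\<omega>(u,v) \<beta>(w) + \<omega>(v,w) \<beta>(u) + \<omega>(w,u) \<beta>(v))\<close>, and this is the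
  normalization for which the coefficient \<open>l/3\<close> of the mixed terms of the flux below matches the
  \<open>\<epsilon>\<eta>\<close>-Einstein constants \<open>l\<^sup>2\<close> and \<open>\<epsilon> l\<^sup>2\<close>; in the determinant convention
  the coefficient would have to be \<open>l\<close>.\<close>

definition wedge ::
  "nat \<Rightarrow> nat \<Rightarrow> ('i, 'e) tensor \<Rightarrow> ('i, 'e) tensor \<Rightarrow> ('i, 'e) tensor" where
  "wedge p q \<omega> \<eta> i x vs =
     real ((p + q) choose p) *
     ((\<Sum>\<sigma> | \<sigma> permutes {..<p + q}. of_int (sign \<sigma>) *
         \<omega> i x (map (\<lambda>k. vs ! \<sigma> k) [0..<p]) * \<eta> i x (map (\<lambda>k. vs ! \<sigma> k) [p..<p + q]))
       / (fact p * fact q))"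


section \<open>Metrics\<close>

definition symmetric_2tensor ::
  "('i, 'a, 'e::euclidean_space) atlas \<Rightarrow> ('i, 'e) tensor \<Rightarrow> bool" where
  "symmetric_2tensor M g \<longleftrightarrow>
     tensor_field M 2 g \<and> (\<forall>i. \<forall>x\<in>chart_img M i. \<forall>u v. g i x [u, v] = g i x [v, u])"

definition riemannian_metric ::
  "('i, 'a, 'e::euclidean_space) atlas \<Rightarrow> ('i, 'e) tensor \<Rightarrow> bool" where
  "riemannian_metric M g \<longleftrightarrow>
     symmetric_2tensor M g \<and> (\<forall>i. \<forall>x\<in>chart_img M i. \<forall>v. v \<noteq> 0 \<longrightarrow> g i x [v, v] > 0)"

definition lorentzian_metric ::
  "('i, 'a, 'e::euclidean_space) atlas \<Rightarrow> ('i, 'e) tensor \<Rightarrow> bool" where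
  "lorentzian_metric M g \<longleftrightarrow>
     symmetric_2tensor M g \<and>
     (\<forall>i. \<forall>x\<in>chart_img M i. \<exists>es. length es = DIM('e) \<and>
        (\<forall>j<DIM('e). \<forall>k<DIM('e).
           g i x [es ! j, es ! k] = (if j = k then (if j = 0 then - 1 else 1) else 0)))"

definition time_orientable ::
  "('i, 'a, 'e::euclidean_space) atlas \<Rightarrow> ('i, 'e) tensor \<Rightarrow> bool" where
  "time_orientable M g \<longleftrightarrow>
     (\<exists>V. vector_field M V \<and> (\<forall>i. \<forall>x\<in>chart_img M i. g i x [V i x, V i x] < 0))"

text \<open>The sign \<open>s\<^sub>g\<close> (a Riemannian metric is never Lorentzian, as manifolds are nonempty here).\<close>

definition metric_sign ::
  "('i, 'a, 'e::euclidean_space) atlas \<Rightarrow> ('i, 'e) tensor \<Rightarrow> real" where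
  "metric_sign M g = (if riemannian_metric M g then 1 else - 1)"

text \<open>The vector metrically dual to the linear functional \<open>\<phi>\<close>, for a nondegenerate \<open>b\<close>.\<close>

definition sharp :: "('e::euclidean_space list \<Rightarrow> real) \<Rightarrow> ('e \<Rightarrow> real) \<Rightarrow> 'e" where
  "sharp b \<phi> = (THE w. \<forall>v. b [w, v] = \<phi> v)"

text \<open>The coordinate one-form \<open>v \<mapsto> v \<bullet> e\<close> with its index raised: component \<open>g\<^sup>j\<^sup>e\<close> along \<open>j\<close>.
  Contracting with \<open>e\<close> in one slot and \<open>raise b e\<close> in another, summed over \<open>e \<in> Basis\<close>, is
  contraction with the inverse metric.\<close>

definition raise :: "('e::euclidean_space list \<Rightarrow> real) \<Rightarrow> 'e \<Rightarrow> 'e" where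
  "raise b e = sharp b (\<lambda>v. v \<bullet> e)"

text \<open>Inner product of \<open>k\<close>-forms induced by \<open>g\<close>.\<close>

definition form_inner ::
  "nat \<Rightarrow> ('i, 'e::euclidean_space) tensor \<Rightarrow> ('i, 'e) tensor \<Rightarrow> ('i, 'e) tensor \<Rightarrow>
    'i \<Rightarrow> 'e \<Rightarrow> real" where
  "form_inner k g \<omega> \<eta> i x =
     (\<Sum>es | set es \<subseteq> Basis \<and> length es = k. \<omega> i x es * \<eta> i x (map (raise (g i x)) es)) / fact k"

definition volume_form ::
  "('i, 'a, 'e::euclidean_space) atlas \<Rightarrow> ('i, 'e) tensor \<Rightarrow> ('i, 'e) tensor" where
  "volume_form M g i x vs =
     sqrt \<bar>det_nat (DIM('e)) (\<lambda>k l. g i x [model_basis M ! k, model_basis M ! l])\<bar>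
       * det_vectors (model_basis M) vs"

text \<open>\<open>(\<ast>\<omega>)\<^bsub>b\<dots>\<^esub> = (1/k!) \<omega>\<^bsup>a\<dots>\<^esup> \<nu>\<^bsub>a\<dots>b\<dots>\<^esub>\<close> for a \<open>k\<close>-form \<open>\<omega>\<close>.\<close>

definition hodge ::
  "('i, 'a, 'e::euclidean_space) atlas \<Rightarrow> ('i, 'e) tensor \<Rightarrow> nat \<Rightarrow> ('i, 'e) tensor \<Rightarrow>
    ('i, 'e) tensor" where
  "hodge M g k \<omega> i x vs =
     (\<Sum>es | set es \<subseteq> Basis \<and> length es = k.
        \<omega> i x (map (raise (g i x)) es) * volume_form M g i x (es @ vs)) / fact k"


section \<open>Connections and curvature\<close>

text \<open>Connections on the tangent bundle are given by their Christoffel symbols in all charts: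
  \<open>\<nabla>\<^sub>u Y = DD Y x u + \<Gamma> i x u (Y x)\<close>.\<close>

type_synonym ('i, 'e) christoffel = "'i \<Rightarrow> 'e \<Rightarrow> 'e \<Rightarrow> 'e \<Rightarrow> 'e"

definition connection ::
  "('i, 'a, 'e::euclidean_space) atlas \<Rightarrow> ('i, 'e) christoffel \<Rightarrow> bool" where
  "connection M \<Gamma> \<longleftrightarrow>
     (\<forall>i. \<forall>x\<in>chart_img M i. bilinear (\<Gamma> i x)) \<and>
     (\<forall>i u v. smooth_on (chart_img M i) (\<lambda>x. \<Gamma> i x u v)) \<and>
     (\<forall>i j. \<forall>x\<in>overlap M i j. \<forall>u v. let \<tau> = transition M i j in
        DD \<tau> x (\<Gamma> i x u v) = DD (\<lambda>y. DD \<tau> y v) x u + \<Gamma> j (\<tau> x) (DD \<tau> x u) (DD \<tau> x v))"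

definition metric_compatible ::
  "('i, 'a, 'e::euclidean_space) atlas \<Rightarrow> ('i, 'e) tensor \<Rightarrow> ('i, 'e) christoffel \<Rightarrow> bool" where
  "metric_compatible M g \<Gamma> \<longleftrightarrow>
     (\<forall>i. \<forall>x\<in>chart_img M i. \<forall>u v w.
        DD (\<lambda>y. g i y [v, w]) x u = g i x [\<Gamma> i x u v, w] + g i x [v, \<Gamma> i x u w])"

text \<open>The torsion with its last index lowered, \<open>g(T(u,v),w)\<close>.\<close>

definition torsion ::
  "('i, 'e::euclidean_space) tensor \<Rightarrow> ('i, 'e) christoffel \<Rightarrow> ('i, 'e) tensor" where
  "torsion g \<Gamma> i x vs = g i x [\<Gamma> i x (vs ! 0) (vs ! 1) - \<Gamma> i x (vs ! 1) (vs ! 0), vs ! 2]"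

definition levi_civita ::
  "('i, 'e::euclidean_space) tensor \<Rightarrow> ('i, 'e) christoffel" where
  "levi_civita g i x u v = sharp (g i x) (\<lambda>w.
     (DD (\<lambda>y. g i y [v, w]) x u + DD (\<lambda>y. g i y [u, w]) x v - DD (\<lambda>y. g i y [u, v]) x w) / 2)"

text \<open>\<open>\<nabla>\<^sup>H = \<nabla> + \<^term>\<open>1/2\<close> g\<^sup>-\<^sup>1 H\<close>.\<close>

definition nabla_H ::
  "('i, 'e::euclidean_space) tensor \<Rightarrow> ('i, 'e) tensor \<Rightarrow> ('i, 'e) christoffel" where
  "nabla_H g H i x u v =
     levi_civita g i x u v + (1 / 2) *\<^sub>R sharp (g i x) (\<lambda>w. H i x [u, v, w])"

definition curvature ::
  "('i, 'e::euclidean_space) christoffel \<Rightarrow> 'i \<Rightarrow> 'e \<Rightarrow> 'e \<Rightarrow> 'e \<Rightarrow> 'e \<Rightarrow> 'e" where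
  "curvature \<Gamma> i x u v w =
     DD (\<lambda>y. \<Gamma> i y v w) x u - DD (\<lambda>y. \<Gamma> i y u w) x v
       + \<Gamma> i x u (\<Gamma> i x v w) - \<Gamma> i x v (\<Gamma> i x u w)"

text \<open>\<open>Ric(v,w) = tr (u \<mapsto> R(u,v)w)\<close>.\<close>

definition ricci :: "('i, 'e::euclidean_space) christoffel \<Rightarrow> ('i, 'e) tensor" where
  "ricci \<Gamma> i x vs = (\<Sum>b\<in>Basis. curvature \<Gamma> i x b (vs ! 0) (vs ! 1) \<bullet> b)"


section \<open>\<open>\<epsilon>\<close>-contact metric and \<open>\<epsilon>\<eta>\<close>-Einstein structures\<close>

definition eps_contact_metric ::
  "('i, 'a::{t2_space, second_countable_topology}, 'e::euclidean_space) atlas \<Rightarrow>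
    ('i, 'e) tensor \<Rightarrow> ('i, 'e) tensor \<Rightarrow> real \<Rightarrow> bool" where
  "eps_contact_metric M g \<alpha> \<epsilon> \<longleftrightarrow>
     oriented_manifold M \<and> DIM('e) = 3 \<and>
     (riemannian_metric M g \<or> lorentzian_metric M g \<and> time_orientable M g) \<and>
     form_field M 1 \<alpha> \<and> \<epsilon> \<in> {- 1, 0, 1} \<and>
     tensor_eq M 1 \<alpha> (hodge M g 2 (ext_d \<alpha>)) \<and>
     (\<forall>i. \<forall>x\<in>chart_img M i. form_inner 1 g \<alpha> \<alpha> i x = \<epsilon>)"

text \<open>The first Einstein constant, written \<open>L\<close>, is \<open>\<lambda>\<^sup>2\<close> with \<open>\<lambda>\<close> real.\<close>

definition eps_eta_einstein ::
  "('i, 'a::{t2_space, second_countable_topology}, 'e::euclidean_space) atlas \<Rightarrow>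
    ('i, 'e) tensor \<Rightarrow> ('i, 'e) tensor \<Rightarrow> real \<Rightarrow> real \<Rightarrow> real \<Rightarrow> bool" where
  "eps_eta_einstein M g \<alpha> \<epsilon> L \<kappa> \<longleftrightarrow>
     eps_contact_metric M g \<alpha> \<epsilon> \<and> (lorentzian_metric M g \<longrightarrow> \<kappa> \<ge> 0) \<and> L \<ge> 0 \<and>
     tensor_eq M 2 (ricci (levi_civita g))
       (\<lambda>i x vs. metric_sign M g / 2 * (L + \<kappa> * \<epsilon>) * g i x vs
          - metric_sign M g * \<kappa> * (\<alpha> i x [vs ! 0] * \<alpha> i x [vs ! 1]))"


section \<open>Products\<close>

definition prod_atlas ::
  "('i, 'a, 'e::euclidean_space) atlas \<Rightarrow> ('j, 'b, 'f::euclidean_space) atlas \<Rightarrow>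
    ('i \<times> 'j, 'a \<times> 'b, 'e \<times> 'f) atlas" where
  "prod_atlas N X = \<lparr>
     chart_dom = (\<lambda>(i, j). chart_dom N i \<times> chart_dom X j),
     chart_map = (\<lambda>(i, j). map_prod (chart_map N i) (chart_map X j)),
     model_basis = map (\<lambda>e. (e, 0)) (model_basis N) @ map (\<lambda>f. (0, f)) (model_basis X) \<rparr>"

text \<open>In product charts the projections are the linear maps \<open>fst\<close> and \<open>snd\<close>.\<close>

definition pull_fst :: "('i, 'e) tensor \<Rightarrow> ('i \<times> 'j, 'e \<times> 'f) tensor" where
  "pull_fst T i x vs = T (fst i) (fst x) (map fst vs)"

definition pull_snd :: "('j, 'f) tensor \<Rightarrow> ('i \<times> 'j, 'e \<times> 'f) tensor" where
  "pull_snd T i x vs = T (snd i) (snd x) (map snd vs)"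

definition metric_sum ::
  "('i, 'e) tensor \<Rightarrow> ('j, 'f) tensor \<Rightarrow> ('i \<times> 'j, 'e \<times> 'f) tensor" where
  "metric_sum g h i x vs = pull_fst g i x vs + pull_snd h i x vs"

definition flux ::
  "('i, 'a, 'e::euclidean_space) atlas \<Rightarrow> ('i, 'e) tensor \<Rightarrow> ('i, 'e) tensor \<Rightarrow>
   ('j, 'b, 'f::euclidean_space) atlas \<Rightarrow> ('j, 'f) tensor \<Rightarrow> ('j, 'f) tensor \<Rightarrow>
   real \<Rightarrow> real \<Rightarrow> ('i \<times> 'j, 'e \<times> 'f) tensor" where
  "flux N g \<alpha> X h \<beta> lam l i x vs =
     lam * pull_fst (volume_form N g) i x vs
     + l / 3 * wedge 2 1 (pull_fst (hodge N g 1 \<alpha>)) (pull_snd \<beta>) i x vs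
     + l / 3 * wedge 1 2 (pull_fst \<alpha>) (pull_snd (hodge X h 1 \<beta>)) i x vs
     + lam * pull_snd (volume_form X h) i x vs"


section \<open>Six-dimensional supergravity\<close>

definition ricci_flat ::
  "('i, 'a, 'e::euclidean_space) atlas \<Rightarrow> ('i, 'e) christoffel \<Rightarrow> bool" where
  "ricci_flat M \<Gamma> \<longleftrightarrow> tensor_eq M 2 (ricci \<Gamma>) (\<lambda>i x vs. 0)"

definition closed_form ::
  "('i, 'a, 'e::euclidean_space) atlas \<Rightarrow> nat \<Rightarrow> ('i, 'e) tensor \<Rightarrow> bool" where
  "closed_form M k \<omega> \<longleftrightarrow> tensor_eq M (Suc k) (ext_d \<omega>) (\<lambda>i x vs. 0)"

definition coclosed_form ::
  "('i, 'a, 'e::euclidean_space) atlas \<Rightarrow> ('i, 'e) tensor \<Rightarrow> nat \<Rightarrow> ('i, 'e) tensor \<Rightarrow> bool" where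
  "coclosed_form M g k \<omega> \<longleftrightarrow> closed_form M (DIM('e) - k) (hodge M g k \<omega>)"

definition isotropic ::
  "('i, 'a, 'e::euclidean_space) atlas \<Rightarrow> ('i, 'e) tensor \<Rightarrow> nat \<Rightarrow> ('i, 'e) tensor \<Rightarrow> bool" where
  "isotropic M g k \<omega> \<longleftrightarrow> (\<forall>i. \<forall>x\<in>chart_img M i. form_inner k g \<omega> \<omega> i x = 0)"

text \<open>Bosonic solutions of minimal supergravity coupled to a tensor multiplet with constant
  dilaton.\<close>

definition sugra_solution ::
  "('i, 'a::{t2_space, second_countable_topology}, 'e::euclidean_space) atlas \<Rightarrow>
    ('i, 'e) tensor \<Rightarrow> ('i, 'e) tensor \<Rightarrow> bool" where
  "sugra_solution M g H \<longleftrightarrow>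
     oriented_manifold M \<and> DIM('e) = 6 \<and> lorentzian_metric M g \<and> form_field M 3 H \<and>
     ricci_flat M (nabla_H g H) \<and>
     closed_form M 3 H \<and> coclosed_form M g 3 H \<and> isotropic M g 3 H"

end

theory Submission
  imports Defs "Jordan_Normal_Form.Determinant"
begin

text \<open>
  Write \<open>P\<close> for the cross product of a factor, \<open>a\<close> for the vector dual to its contact form \<open>\<alpha>\<close>, and
  \<open>F = \<ast>\<alpha>\<close>. The volume form is parallel, and \<open>\<alpha> = \<ast>d\<alpha>\<close> means \<open>d\<alpha> = s F\<close> with \<open>s\<close> the sign of the
  metric. Hence \<open>F\<close> is closed, so that \<open>div a = 0\<close>, and the divergence of \<open>w \<mapsto> P a w\<close> is \<open>\<alpha>\<close> for both
  signatures. In \<open>dH\<close> and in \<open>div H\<close> the two mixed terms of the flux then cancel, in \<open>dH\<close> because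
  the two factors have opposite signs; the Hodge star of the flux is the flux with \<open>\<lambda>\<close> replaced
  by \<open>-\<lambda>\<close>, so that \<open>H\<close> is also coclosed. Writing \<open>A\<close> for \<open>H\<close> with its last index raised, one has
  \<open>Ric(\<nabla>\<^sup>H)(v,w) = Ric(v,w) + 1/2 div H (v,w) + 1/4 tr(A\<^sub>v A\<^sub>w)\<close>, and the last trace is a purely
  algebraic expression which the \<open>\<epsilon>\<eta>\<close>-Einstein conditions cancel against \<open>Ric\<close>.
\<close>

text \<open>Tensors are known only through their values on coordinate vectors in charts, without
  orthonormal frames, so every contraction pairs the standard basis with the raised basis
  \<open>raise g e\<close>. Pointwise, the volume form of a factor enters only through nonvanishing
  and the Gram identity of \<open>oriented_form3\<close>: \<nu> times \<nu> is s times a 3 x 3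
  determinant in g. This yields multilinearity, alternation, the contraction formulas and the double
  cross product, for both signatures at once through the sign s. The constants, with \<beta> for the
  contact form of X: the wedge convention turns l/3 into the coefficient l of \<open>H0\<close>. A
  quarter of tr(A_v A_w) is (\<lambda>^2 + \<epsilon> l^2)/2 (\<chi> - h) - l^2 \<alpha> \<otimes>
  \<alpha> + \<epsilon> l^2 \<beta> \<otimes> \<beta>. Terms with \<alpha> \<otimes> \<alpha>
  contract the vector dual to \<beta> with itself, giving |\<beta>|^2 = 1; those with \<beta>
  \<otimes> \<beta> contract a with itself, giving |\<alpha>|^2 = \<epsilon>. This is why \<kappa>_N
  = l^2 and \<kappa>_X = \<epsilon> l^2. The mixed \<lambda> l terms cancel between the factors
  because their signs s are opposite.\<close>

no_notation scalar_prod (infix \<open>\<bullet>\<close> 70)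

section \<open>Calculus\<close>

lemma DD_eq: "(f has_derivative f') (at x) \<Longrightarrow> DD f x = f'"
  using frechet_derivative_at by metis

lemma DD_works: "f differentiable (at x) \<Longrightarrow> (f has_derivative DD f x) (at x)"
  by (simp add: frechet_derivative_works)

lemma DD_linear: "f differentiable (at x) \<Longrightarrow> linear (DD f x)"
  by (rule linear_frechet_derivative)

text \<open>Both functions have the same derivatives at \<open>x\<close> as a predicate, so the
  choice operator inside \<open>DD\<close> returns the same value for both, even where no derivative
  exists. It allows identities that hold only on a chart image to be differentiated.\<close>

lemma DD_cong:
  assumes "open S" "x \<in> S" "\<And>y. y \<in> S \<Longrightarrow> f y = g y"
  shows "DD f x = DD g x"
proof -
  have "(f has_derivative f') (at x) \<longleftrightarrow> (g has_derivative f') (at x)" for f'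
    using assms has_derivative_transform_within_open[of f f' x UNIV S g]
      has_derivative_transform_within_open[of g f' x UNIV S f] by auto
  then show ?thesis by (simp add: frechet_derivative_def)
qed

lemma differentiable_cong_open:
  assumes "open S" "x \<in> S" "\<And>y. y \<in> S \<Longrightarrow> f y = g y"
  shows "f differentiable (at x) \<longleftrightarrow> g differentiable (at x)"
  using assms has_derivative_transform_within_open[of f _ x UNIV S g]
    has_derivative_transform_within_open[of g _ x UNIV S f]
  unfolding differentiable_def by metis

lemma DD_const [simp]: "DD (\<lambda>y. c) x = (\<lambda>v. 0)"
  by (rule DD_eq) simp

lemma DD_add:
  "f differentiable (at x) \<Longrightarrow> g differentiable (at x) \<Longrightarrow>
    DD (\<lambda>y. f y + g y) x v = DD f x v + DD g x v"
  by (subst DD_eq[OF has_derivative_add[OF DD_works DD_works]]) auto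

lemma DD_diff:
  "f differentiable (at x) \<Longrightarrow> g differentiable (at x) \<Longrightarrow>
    DD (\<lambda>y. f y - g y) x v = DD f x v - DD g x v"
  by (subst DD_eq[OF has_derivative_diff[OF DD_works DD_works]]) auto

lemma DD_linear_comp:
  assumes "linear L" "f differentiable (at x)"
  shows "DD (\<lambda>y. L (f y)) x v = L (DD f x v)"
  by (subst DD_eq[OF bounded_linear.has_derivative[OF _ DD_works]])
    (use assms in \<open>auto simp: linear_conv_bounded_linear\<close>)

lemma differentiable_linear_comp:
  fixes f :: "'e::euclidean_space \<Rightarrow> 'f::euclidean_space" and L :: "'f \<Rightarrow> 'g::euclidean_space"
  shows "linear L \<Longrightarrow> f differentiable (at x) \<Longrightarrow> (\<lambda>y. L (f y)) differentiable (at x)"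
  using bounded_linear.has_derivative[of L f "DD f x" "at x"] DD_works[of f x]
  unfolding differentiable_def linear_conv_bounded_linear by blast

lemma differentiable_comp_linear:
  assumes "linear L" "f differentiable (at (L x))"
  shows "(\<lambda>y. f (L y)) differentiable (at x)"
    and "DD (\<lambda>y. f (L y)) x v = DD f (L x) (L v)"
proof -
  have "(L has_derivative L) (at x)"
    using assms(1) by (simp add: linear_conv_bounded_linear bounded_linear_imp_has_derivative)
  then have *: "((f \<circ> L) has_derivative (DD f (L x) \<circ> L)) (at x)"
    using DD_works[OF assms(2)] by (rule diff_chain_at)
  show "(\<lambda>y. f (L y)) differentiable (at x)"
    using * unfolding differentiable_def o_def by blast
  show "DD (\<lambda>y. f (L y)) x v = DD f (L x) (L v)"
    using DD_eq[OF *] by (simp add: o_def)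
qed

lemma DD_compose:
  assumes "f differentiable (at (\<tau> x))" "\<tau> differentiable (at x)"
  shows "(\<lambda>y. f (\<tau> y)) differentiable (at x)"
    and "DD (\<lambda>y. f (\<tau> y)) x v = DD f (\<tau> x) (DD \<tau> x v)"
proof -
  have *: "((f \<circ> \<tau>) has_derivative (DD f (\<tau> x) \<circ> DD \<tau> x)) (at x)"
    using DD_works[OF assms(2)] DD_works[OF assms(1)] by (rule diff_chain_at)
  show "(\<lambda>y. f (\<tau> y)) differentiable (at x)"
    using * unfolding differentiable_def o_def by blast
  show "DD (\<lambda>y. f (\<tau> y)) x v = DD f (\<tau> x) (DD \<tau> x v)"
    using DD_eq[OF *] by (simp add: o_def)
qed

lemma DD_bilinear:
  assumes "bounded_bilinear P" "f differentiable (at x)" "g differentiable (at x)"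
  shows "(\<lambda>y. P (f y) (g y)) differentiable (at x)"
    and "DD (\<lambda>y. P (f y) (g y)) x v = P (f x) (DD g x v) + P (DD f x v) (g x)"
proof -
  note * = bounded_bilinear.FDERIV[OF assms(1) DD_works[OF assms(2)] DD_works[OF assms(3)]]
  show "(\<lambda>y. P (f y) (g y)) differentiable (at x)"
    using * unfolding differentiable_def by blast
  show "DD (\<lambda>y. P (f y) (g y)) x v = P (f x) (DD g x v) + P (DD f x v) (g x)"
    using DD_eq[OF *] by simp
qed

lemmas DD_mult = DD_bilinear(2)[OF bounded_bilinear_mult]
lemmas DD_scaleR = DD_bilinear(2)[OF bounded_bilinear_scaleR]
lemmas differentiable_scaleR_at = DD_bilinear(1)[OF bounded_bilinear_scaleR]

lemma DD_cmult:
  fixes f :: "'e::euclidean_space \<Rightarrow> real"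
  shows "f differentiable (at x) \<Longrightarrow> DD (\<lambda>y. c * f y) x v = c * DD f x v"
  by (rule DD_linear_comp) (auto intro: linearI simp: algebra_simps)

lemma DD_sum:
  assumes "finite I" "\<And>i. i \<in> I \<Longrightarrow> f i differentiable (at x)"
  shows "(\<lambda>y. \<Sum>i\<in>I. f i y) differentiable (at x)"
    and "DD (\<lambda>y. \<Sum>i\<in>I. f i y) x v = (\<Sum>i\<in>I. DD (f i) x v)"
proof -
  have *: "((\<lambda>y. \<Sum>i\<in>I. f i y) has_derivative (\<lambda>v. \<Sum>i\<in>I. DD (f i) x v)) (at x)"
    by (rule has_derivative_sum) (use assms(2) DD_works in blast)
  show "(\<lambda>y. \<Sum>i\<in>I. f i y) differentiable (at x)"
    using * unfolding differentiable_def by blast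
  show "DD (\<lambda>y. \<Sum>i\<in>I. f i y) x v = (\<Sum>i\<in>I. DD (f i) x v)"
    using DD_eq[OF *] by simp
qed

section \<open>Closure properties of \<open>Ck_on\<close> and \<open>smooth_on\<close>\<close>

lemma Ck_on_cong:
  assumes "open S" "\<And>x. x \<in> S \<Longrightarrow> f x = g x"
  shows "Ck_on k S f \<longleftrightarrow> Ck_on k S g"
  using assms(2)
proof (induction k arbitrary: f g)
  case 0
  then show ?case by (simp cong: continuous_on_cong)
next
  case (Suc k)
  have "f differentiable (at x) \<longleftrightarrow> g differentiable (at x)" if "x \<in> S" for x
    using differentiable_cong_open[OF assms(1) that] Suc.prems by blast
  moreover have "DD f x = DD g x" if "x \<in> S" for x
    using DD_cong[OF assms(1) that] Suc.prems by blast
  ultimately show ?case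
    using Suc.IH[of "\<lambda>x. DD f x _" "\<lambda>x. DD g x _"] by auto
qed

text \<open>The product rule leaves one factor undifferentiated, known at order \<open>Suc k\<close>
  but needed at order \<open>k\<close>. Only the base case has content: differentiability implies
  continuity.\<close>

lemma Ck_on_Suc: "Ck_on (Suc k) S f \<Longrightarrow> Ck_on k S f"
proof (induction k arbitrary: f)
  case 0
  then show ?case
    by (auto intro!: continuous_at_imp_continuous_on differentiable_imp_continuous_within)
next
  case (Suc k)
  then show ?case by (metis Ck_on.simps(2))
qed

lemma Ck_on_subset: "Ck_on k S f \<Longrightarrow> T \<subseteq> S \<Longrightarrow> Ck_on k T f"
  by (induction k arbitrary: f) (auto intro: continuous_on_subset)

lemma Ck_on_const: "Ck_on k S (\<lambda>x. c)"
  by (induction k arbitrary: c) auto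

lemma Ck_on_add:
  assumes "open S"
  shows "Ck_on k S f \<Longrightarrow> Ck_on k S g \<Longrightarrow> Ck_on k S (\<lambda>x. f x + g x)"
proof (induction k arbitrary: f g)
  case 0
  then show ?case by (auto intro: continuous_intros)
next
  case (Suc k)
  have "Ck_on k S (\<lambda>x. DD (\<lambda>x. f x + g x) x v) \<longleftrightarrow> Ck_on k S (\<lambda>x. DD f x v + DD g x v)" for v
    by (rule Ck_on_cong[OF assms]) (use Suc.prems in \<open>auto simp: DD_add\<close>)
  then show ?case using Suc by auto
qed

lemma Ck_on_linear:
  assumes "open S" "linear L"
  shows "Ck_on k S f \<Longrightarrow> Ck_on k S (\<lambda>x. L (f x))"
proof (induction k arbitrary: f)
  case 0
  have "continuous_on (f ` S) L"
    using assms(2) linear_continuous_on linear_conv_bounded_linear by blast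
  with 0 show ?case by (auto intro: continuous_on_compose2)
next
  case (Suc k)
  have "Ck_on k S (\<lambda>x. DD (\<lambda>x. L (f x)) x v) \<longleftrightarrow> Ck_on k S (\<lambda>x. L (DD f x v))" for v
    by (rule Ck_on_cong[OF assms(1)]) (use Suc.prems in \<open>auto simp: DD_linear_comp assms(2)\<close>)
  then show ?case using Suc by (auto simp: differentiable_linear_comp assms(2))
qed

lemma Ck_on_bilinear:
  assumes "open S" "bounded_bilinear P"
  shows "Ck_on k S f \<Longrightarrow> Ck_on k S g \<Longrightarrow> Ck_on k S (\<lambda>x. P (f x) (g x))"
proof (induction k arbitrary: f g)
  case 0
  then show ?case by (auto intro: bounded_bilinear.continuous_on[OF assms(2)])
next
  case (Suc k)
  have "Ck_on k S (\<lambda>x. DD (\<lambda>x. P (f x) (g x)) x v) \<longleftrightarrow>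
      Ck_on k S (\<lambda>x. P (f x) (DD g x v) + P (DD f x v) (g x))" for v
    by (rule Ck_on_cong[OF assms(1)]) (use Suc.prems in \<open>auto simp: DD_bilinear(2)[OF assms(2)]\<close>)
  moreover have "Ck_on k S (\<lambda>x. P (f x) (DD g x v) + P (DD f x v) (g x))" for v
    by (intro Ck_on_add[OF assms(1)] Suc.IH)
      (use Suc.prems Ck_on_Suc[of k S f] Ck_on_Suc[of k S g] in auto)
  ultimately show ?case using Suc.prems by (auto intro: DD_bilinear(1)[OF assms(2)])
qed

text \<open>A linear map is its own derivative, so the induction stays among functions composed with
  \<open>L\<close>. This case of the chain rule suffices for pulling back along the projections of a
  product.\<close>

lemma Ck_on_comp_linear:
  assumes "open S" "open T" "linear L" "L ` S \<subseteq> T"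
  shows "Ck_on k T f \<Longrightarrow> Ck_on k S (\<lambda>x. f (L x))"
proof (induction k arbitrary: f)
  case 0
  have "continuous_on S L"
    using assms(3) linear_continuous_on linear_conv_bounded_linear by blast
  with 0 assms(4) show ?case by (auto intro: continuous_on_compose2)
next
  case (Suc k)
  have "Ck_on k S (\<lambda>x. DD (\<lambda>x. f (L x)) x v) \<longleftrightarrow> Ck_on k S (\<lambda>x. DD f (L x) (L v))" for v
    by (rule Ck_on_cong[OF assms(1)])
      (use Suc.prems assms(4) in \<open>auto simp: differentiable_comp_linear(2) assms(3) image_subset_iff\<close>)
  moreover have "Ck_on k S (\<lambda>x. DD f (L x) (L v))" for v
    using Suc.prems by (intro Suc.IH[of "\<lambda>x. DD f x (L v)"]) auto
  ultimately show ?case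
    using Suc.prems assms(4) by (auto intro!: differentiable_comp_linear(1)[OF assms(3)])
qed

lemma DD_inverse:
  fixes f :: "'e::euclidean_space \<Rightarrow> real"
  assumes "f differentiable (at x)" "f x \<noteq> 0"
  shows "(\<lambda>y. inverse (f y)) differentiable (at x)"
    and "DD (\<lambda>y. inverse (f y)) x v = - (inverse (f x) * DD f x v * inverse (f x))"
proof -
  note * = Deriv.has_derivative_inverse[OF assms(2) DD_works[OF assms(1)]]
  show "(\<lambda>y. inverse (f y)) differentiable (at x)"
    using * unfolding differentiable_def by blast
  show "DD (\<lambda>y. inverse (f y)) x v = - (inverse (f x) * DD f x v * inverse (f x))"
    using DD_eq[OF *] by simp
qed

text \<open>The derivative contains the reciprocal itself, so the claim at order \<open>k\<close> is
  fed back to reach order \<open>Suc k\<close>, with \<open>f\<close> kept fixed. The square root is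
  treated in the same way.\<close>

lemma Ck_on_inverse:
  fixes f :: "'e::euclidean_space \<Rightarrow> real"
  assumes "open S" "\<And>x. x \<in> S \<Longrightarrow> f x \<noteq> 0"
  shows "Ck_on k S f \<Longrightarrow> Ck_on k S (\<lambda>x. inverse (f x))"
proof (induction k)
  case 0
  then show ?case using assms(2) by (auto intro: continuous_intros)
next
  case (Suc k)
  have I: "Ck_on k S (\<lambda>x. inverse (f x))"
    using Suc.IH Ck_on_Suc Suc.prems by blast
  have "Ck_on k S (\<lambda>x. DD (\<lambda>x. inverse (f x)) x v) \<longleftrightarrow>
      Ck_on k S (\<lambda>x. - (inverse (f x) * DD f x v * inverse (f x)))" for v
    by (rule Ck_on_cong[OF assms(1)]) (use Suc.prems assms(2) in \<open>auto simp: DD_inverse(2)\<close>)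
  moreover have "Ck_on k S (\<lambda>x. - (inverse (f x) * DD f x v * inverse (f x)))" for v
    by (intro Ck_on_linear[of S uminus] Ck_on_bilinear[OF _ bounded_bilinear_mult] I assms(1))
      (use Suc.prems in \<open>auto intro: linearI\<close>)
  ultimately show ?case
    using Suc.prems assms(2) by (auto intro: DD_inverse(1))
qed

lemma DD_sqrt:
  fixes f :: "'e::euclidean_space \<Rightarrow> real"
  assumes "f differentiable (at x)" "f x > 0"
  shows "(\<lambda>y. sqrt (f y)) differentiable (at x)"
    and "DD (\<lambda>y. sqrt (f y)) x v = DD f x v * (inverse (sqrt (f x)) / 2)"
proof -
  have "((\<lambda>y. sqrt (f y)) has_derivative (\<lambda>v. DD f x v * (inverse (sqrt (f x)) / 2))) (at x)"
    using DERIV_real_sqrt[OF assms(2)] DD_works[OF assms(1)]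
    by (auto dest!: DERIV_compose_FDERIV[where g = f])
  note * = this
  show "(\<lambda>y. sqrt (f y)) differentiable (at x)"
    using * unfolding differentiable_def by blast
  show "DD (\<lambda>y. sqrt (f y)) x v = DD f x v * (inverse (sqrt (f x)) / 2)"
    using DD_eq[OF *] by simp
qed

lemma Ck_on_sqrt:
  fixes f :: "'e::euclidean_space \<Rightarrow> real"
  assumes "open S" "\<And>x. x \<in> S \<Longrightarrow> f x > 0"
  shows "Ck_on k S f \<Longrightarrow> Ck_on k S (\<lambda>x. sqrt (f x))"
proof (induction k)
  case 0
  then show ?case by (auto intro: continuous_intros)
next
  case (Suc k)
  have I: "Ck_on k S (\<lambda>x. sqrt (f x))"
    using Suc.IH Ck_on_Suc Suc.prems by blast
  have "sqrt (f x) \<noteq> 0" if "x \<in> S" for x using assms(2)[OF that] by simp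
  then have I': "Ck_on k S (\<lambda>x. inverse (sqrt (f x)) / 2)"
    by (intro Ck_on_linear[of S "\<lambda>x. x / 2"] Ck_on_inverse assms(1) I)
      (auto intro: linearI simp: add_divide_distrib)
  have "Ck_on k S (\<lambda>x. DD (\<lambda>x. sqrt (f x)) x v) \<longleftrightarrow>
      Ck_on k S (\<lambda>x. DD f x v * (inverse (sqrt (f x)) / 2))" for v
    by (rule Ck_on_cong[OF assms(1)]) (use Suc.prems assms(2) in \<open>auto simp: DD_sqrt(2)\<close>)
  moreover have "Ck_on k S (\<lambda>x. DD f x v * (inverse (sqrt (f x)) / 2))" for v
    by (intro Ck_on_bilinear[OF _ bounded_bilinear_mult] I' assms(1))
      (use Suc.prems in auto)
  ultimately show ?case
    using Suc.prems assms(2) by (auto intro: DD_sqrt(1))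
qed

lemma smooth_on_subset: "smooth_on S f \<Longrightarrow> T \<subseteq> S \<Longrightarrow> smooth_on T f"
  unfolding smooth_on_def using Ck_on_subset by blast

lemma smooth_on_cong:
  "open S \<Longrightarrow> (\<And>x. x \<in> S \<Longrightarrow> f x = g x) \<Longrightarrow> smooth_on S f \<longleftrightarrow> smooth_on S g"
  unfolding smooth_on_def using Ck_on_cong by blast

lemma smooth_on_const: "smooth_on S (\<lambda>x. c)"
  by (simp add: smooth_on_def Ck_on_const)

lemma smooth_on_add:
  "open S \<Longrightarrow> smooth_on S f \<Longrightarrow> smooth_on S g \<Longrightarrow> smooth_on S (\<lambda>x. f x + g x)"
  by (simp add: smooth_on_def Ck_on_add)

lemma smooth_on_linear:
  "open S \<Longrightarrow> linear L \<Longrightarrow> smooth_on S f \<Longrightarrow> smooth_on S (\<lambda>x. L (f x))"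
  by (simp add: smooth_on_def Ck_on_linear)

lemma smooth_on_minus: "open S \<Longrightarrow> smooth_on S f \<Longrightarrow> smooth_on S (\<lambda>x. - f x)"
  by (rule smooth_on_linear) (auto intro: linearI)

lemma smooth_on_diff:
  "open S \<Longrightarrow> smooth_on S f \<Longrightarrow> smooth_on S g \<Longrightarrow> smooth_on S (\<lambda>x. f x - g x)"
  using smooth_on_add[of S f "\<lambda>x. - g x"] smooth_on_minus[of S g] by simp

lemma smooth_on_bilinear:
  "open S \<Longrightarrow> bounded_bilinear P \<Longrightarrow> smooth_on S f \<Longrightarrow> smooth_on S g \<Longrightarrow>
    smooth_on S (\<lambda>x. P (f x) (g x))"
  by (simp add: smooth_on_def Ck_on_bilinear)

lemmas smooth_on_mult = smooth_on_bilinear[OF _ bounded_bilinear_mult]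
lemmas smooth_on_scaleR = smooth_on_bilinear[OF _ bounded_bilinear_scaleR]

lemma smooth_on_sum:
  "open S \<Longrightarrow> (\<And>i. i \<in> I \<Longrightarrow> smooth_on S (f i)) \<Longrightarrow> smooth_on S (\<lambda>x. \<Sum>i\<in>I. f i x)"
  by (induction I rule: infinite_finite_induct) (auto simp: smooth_on_const smooth_on_add)

lemma smooth_on_inverse:
  fixes f :: "'e::euclidean_space \<Rightarrow> real"
  shows "open S \<Longrightarrow> (\<And>x. x \<in> S \<Longrightarrow> f x \<noteq> 0) \<Longrightarrow> smooth_on S f \<Longrightarrow> smooth_on S (\<lambda>x. inverse (f x))"
  by (simp add: smooth_on_def Ck_on_inverse)

lemma smooth_on_sqrt:
  fixes f :: "'e::euclidean_space \<Rightarrow> real"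
  shows "open S \<Longrightarrow> (\<And>x. x \<in> S \<Longrightarrow> f x > 0) \<Longrightarrow> smooth_on S f \<Longrightarrow> smooth_on S (\<lambda>x. sqrt (f x))"
  by (simp add: smooth_on_def Ck_on_sqrt)

lemma smooth_on_comp_linear:
  "open S \<Longrightarrow> open T \<Longrightarrow> linear L \<Longrightarrow> L ` S \<subseteq> T \<Longrightarrow> smooth_on T f \<Longrightarrow> smooth_on S (\<lambda>x. f (L x))"
  unfolding smooth_on_def using Ck_on_comp_linear by blast

lemma smooth_on_DD: "smooth_on S f \<Longrightarrow> smooth_on S (\<lambda>x. DD f x v)"
  unfolding smooth_on_def by (metis Ck_on.simps(2))

lemma smooth_on_differentiable: "smooth_on S f \<Longrightarrow> x \<in> S \<Longrightarrow> f differentiable (at x)"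
  unfolding smooth_on_def by (metis Ck_on.simps(2))

lemma smooth_on_continuous: "smooth_on S f \<Longrightarrow> continuous_on S f"
  unfolding smooth_on_def by (metis Ck_on.simps(1))

section \<open>Symmetry of second derivatives\<close>

text \<open>Two applications of the mean value theorem: in direction \<open>u\<close> to the
  difference of \<open>f\<close> along \<open>h *\<^sub>R v\<close>, then in direction
  \<open>v\<close> to the derivative along \<open>u\<close>. The intermediate point changes when
  \<open>u\<close> and \<open>v\<close> are exchanged, so its distance from \<open>x\<close> is
  recorded.\<close>

lemma mixed_difference:
  fixes f :: "'e::euclidean_space \<Rightarrow> real"
  assumes f: "smooth_on (ball x r) f" and h: "0 < h" "h * (norm u + norm v) < r"
  shows "\<exists>y. norm (y - x) \<le> h * (norm u + norm v) \<and>
    f (x + h *\<^sub>R u + h *\<^sub>R v) - f (x + h *\<^sub>R u) - f (x + h *\<^sub>R v) + f x = h * (h * DD (\<lambda>z. DD f z u) y v)"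
proof -
  have nrm: "norm (s *\<^sub>R u + t *\<^sub>R v) \<le> h * (norm u + norm v)"
    if "0 \<le> s" "s \<le> h" "0 \<le> t" "t \<le> h" for s t
  proof -
    have "norm (s *\<^sub>R u + t *\<^sub>R v) \<le> s * norm u + t * norm v"
      using norm_triangle_ineq[of "s *\<^sub>R u" "t *\<^sub>R v"] that by simp
    also have "\<dots> \<le> h * norm u + h * norm v"
      using that by (intro add_mono mult_right_mono) auto
    finally show ?thesis by (simp add: algebra_simps)
  qed
  have inb: "x + s *\<^sub>R u + t *\<^sub>R v \<in> ball x r" if "0 \<le> s" "s \<le> h" "0 \<le> t" "t \<le> h" for s t
  proof -
    have "dist x (x + s *\<^sub>R u + t *\<^sub>R v) = norm (s *\<^sub>R u + t *\<^sub>R v)"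
      by (metis add.assoc add_diff_cancel_left' dist_commute dist_norm)
    then show ?thesis using nrm[OF that] h(2) by simp
  qed
  have line: "((\<lambda>s. F (p + s *\<^sub>R w)) has_real_derivative DD F (p + s *\<^sub>R w) w) (at s)"
    if "F differentiable (at (p + s *\<^sub>R w))" for F :: "'e \<Rightarrow> real" and p w s
  proof -
    have "((\<lambda>s. p + s *\<^sub>R w) has_derivative (\<lambda>t. t *\<^sub>R w)) (at s)"
      by (auto intro!: derivative_eq_intros)
    from diff_chain_at[OF this DD_works[OF that]]
    have "((\<lambda>s. F (p + s *\<^sub>R w)) has_derivative (\<lambda>t. DD F (p + s *\<^sub>R w) (t *\<^sub>R w))) (at s)"
      by (simp add: o_def)
    moreover have "DD F (p + s *\<^sub>R w) (t *\<^sub>R w) = DD F (p + s *\<^sub>R w) w * t" for t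
      using linear_cmul[OF DD_linear[OF that], of t w] by simp
    ultimately show ?thesis by (simp add: has_field_derivative_def)
  qed
  have "\<exists>s. 0 < s \<and> s < h \<and> (f (x + h *\<^sub>R u + h *\<^sub>R v) - f (x + h *\<^sub>R u)) - (f (x + 0 *\<^sub>R u + h *\<^sub>R v) - f (x + 0 *\<^sub>R u))
      = (h - 0) * (DD f (x + s *\<^sub>R u + h *\<^sub>R v) u - DD f (x + s *\<^sub>R u) u)"
  proof (rule MVT2[OF h(1), of "\<lambda>s. f (x + s *\<^sub>R u + h *\<^sub>R v) - f (x + s *\<^sub>R u)"])
    fix s :: real assume s: "0 \<le> s" "s \<le> h"
    show "((\<lambda>s. f (x + s *\<^sub>R u + h *\<^sub>R v) - f (x + s *\<^sub>R u)) has_real_derivative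
       DD f (x + s *\<^sub>R u + h *\<^sub>R v) u - DD f (x + s *\<^sub>R u) u) (at s)"
    proof (rule DERIV_diff)
      have "f differentiable (at ((x + h *\<^sub>R v) + s *\<^sub>R u))"
        using smooth_on_differentiable[OF f inb[of s h]] s h(1) by (simp add: algebra_simps)
      from line[OF this] show "((\<lambda>s. f (x + s *\<^sub>R u + h *\<^sub>R v)) has_real_derivative
          DD f (x + s *\<^sub>R u + h *\<^sub>R v) u) (at s)"
        by (simp add: add.assoc add.commute add.left_commute)
      have "f differentiable (at (x + s *\<^sub>R u))"
        using smooth_on_differentiable[OF f inb[of s 0]] s h(1) by simp
      from line[OF this] show "((\<lambda>s. f (x + s *\<^sub>R u)) has_real_derivative
          DD f (x + s *\<^sub>R u) u) (at s)" .
    qed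
  qed
  then obtain s where s: "0 < s" "s < h" and 1: "f (x + h *\<^sub>R u + h *\<^sub>R v) - f (x + h *\<^sub>R u) - f (x + h *\<^sub>R v) + f x
      = h * (DD f (x + s *\<^sub>R u + h *\<^sub>R v) u - DD f (x + s *\<^sub>R u) u)" by auto
  have "\<exists>t. 0 < t \<and> t < h \<and> DD f (x + s *\<^sub>R u + h *\<^sub>R v) u - DD f (x + s *\<^sub>R u + 0 *\<^sub>R v) u
      = (h - 0) * DD (\<lambda>z. DD f z u) (x + s *\<^sub>R u + t *\<^sub>R v) v"
  proof (rule MVT2[OF h(1), of "\<lambda>t. DD f (x + s *\<^sub>R u + t *\<^sub>R v) u"])
    fix t :: real assume t: "0 \<le> t" "t \<le> h"
    have "(\<lambda>z. DD f z u) differentiable (at (x + s *\<^sub>R u + t *\<^sub>R v))"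
      using smooth_on_differentiable[OF smooth_on_DD[OF f] inb[of s t]] s t by simp
    from line[OF this] show "((\<lambda>t. DD f (x + s *\<^sub>R u + t *\<^sub>R v) u) has_real_derivative
       DD (\<lambda>z. DD f z u) (x + s *\<^sub>R u + t *\<^sub>R v) v) (at t)" .
  qed
  then obtain t where t: "0 < t" "t < h" and 2: "DD f (x + s *\<^sub>R u + h *\<^sub>R v) u - DD f (x + s *\<^sub>R u) u
      = h * DD (\<lambda>z. DD f z u) (x + s *\<^sub>R u + t *\<^sub>R v) v" by auto
  have "norm (x + s *\<^sub>R u + t *\<^sub>R v - x) \<le> h * (norm u + norm v)"
    using nrm[of s t] s t by (simp add: add.assoc)
  with 1 2 show ?thesis by metis
qed

text \<open>The second difference is symmetric in \<open>u\<close> and \<open>v\<close>, so the two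
  mixed derivatives agree, each at its own intermediate point near \<open>x\<close>; continuity
  transfers the equality to \<open>x\<close>.\<close>

lemma DD_symmetric_real:
  fixes f :: "'e::euclidean_space \<Rightarrow> real"
  assumes S: "open S" "x \<in> S" and f: "smooth_on S f"
  shows "DD (\<lambda>y. DD f y u) x v = DD (\<lambda>y. DD f y v) x u"
proof (rule ccontr)
  assume neq: "DD (\<lambda>y. DD f y u) x v \<noteq> DD (\<lambda>y. DD f y v) x u"
  \<comment> \<open>Half the gap: each mixed derivative moves by less than \<open>e\<close> between
    \<open>x\<close> and its intermediate point, too little for the two to become equal.\<close>
  define e where "e = \<bar>DD (\<lambda>y. DD f y u) x v - DD (\<lambda>y. DD f y v) x u\<bar> / 2"
  have e: "e > 0" using neq by (simp add: e_def)
  have c: "\<exists>d>0. \<forall>y. dist y x < d \<longrightarrow> \<bar>DD (\<lambda>y. DD f y u) y v - DD (\<lambda>y. DD f y u) x v\<bar> < e" for u v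
  proof -
    have "continuous_on S (\<lambda>y. DD (\<lambda>y. DD f y u) y v)"
      by (intro smooth_on_continuous smooth_on_DD f)
    then have "isCont (\<lambda>y. DD (\<lambda>y. DD f y u) y v) x"
      using S continuous_on_eq_continuous_at by blast
    then show ?thesis
      using e unfolding continuous_at_eps_delta dist_real_def by blast
  qed
  obtain d1 where d1: "d1 > 0" "\<And>y. dist y x < d1 \<Longrightarrow> \<bar>DD (\<lambda>y. DD f y u) y v - DD (\<lambda>y. DD f y u) x v\<bar> < e"
    using c[of u v] by blast
  obtain d2 where d2: "d2 > 0" "\<And>y. dist y x < d2 \<Longrightarrow> \<bar>DD (\<lambda>y. DD f y v) y u - DD (\<lambda>y. DD f y v) x u\<bar> < e"
    using c[of v u] by blast
  obtain d3 where d3: "d3 > 0" "ball x d3 \<subseteq> S"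
    using S open_contains_ball by blast
  define r where "r = min d1 (min d2 d3)"
  have r: "r > 0" "ball x r \<subseteq> S" using d1(1) d2(1) d3 by (auto simp: r_def)
  have fb: "smooth_on (ball x r) f" using f r(2) smooth_on_subset by blast
  \<comment> \<open>The summand 1 keeps the denominator positive when \<open>u\<close> and
    \<open>v\<close> both vanish.\<close>
  define h where "h = r / (2 * (norm u + norm v + 1))"
  have pos: "norm u + norm v + 1 > 0" using norm_ge_zero[of u] norm_ge_zero[of v] by linarith
  have h: "h > 0" "h * (norm u + norm v) < r"
  proof -
    show "h > 0" using r(1) pos by (simp add: h_def)
    have "h * (norm u + norm v) < h * (norm u + norm v + 1)" using \<open>h > 0\<close> by simp
    also have "\<dots> = r / 2" using pos by (simp add: h_def field_simps)
    also have "\<dots> < r" using r(1) by simp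
    finally show "h * (norm u + norm v) < r" .
  qed
  have h': "h * (norm v + norm u) < r" using h(2) by (simp add: add.commute)
  obtain y where y: "norm (y - x) \<le> h * (norm u + norm v)"
    "f (x + h *\<^sub>R u + h *\<^sub>R v) - f (x + h *\<^sub>R u) - f (x + h *\<^sub>R v) + f x = h * (h * DD (\<lambda>z. DD f z u) y v)"
    using mixed_difference[OF fb h] by blast
  obtain y' where y': "norm (y' - x) \<le> h * (norm v + norm u)"
    "f (x + h *\<^sub>R v + h *\<^sub>R u) - f (x + h *\<^sub>R v) - f (x + h *\<^sub>R u) + f x = h * (h * DD (\<lambda>z. DD f z v) y' u)"
    using mixed_difference[OF fb h(1) h'] by blast
  have "x + h *\<^sub>R v + h *\<^sub>R u = x + h *\<^sub>R u + h *\<^sub>R v" by (simp add: algebra_simps)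
  with y(2) y'(2) have "h * (h * DD (\<lambda>z. DD f z u) y v) = h * (h * DD (\<lambda>z. DD f z v) y' u)"
    by (simp add: algebra_simps)
  then have eq: "DD (\<lambda>z. DD f z u) y v = DD (\<lambda>z. DD f z v) y' u" using h(1) by simp
  have "\<bar>DD (\<lambda>y. DD f y u) y v - DD (\<lambda>y. DD f y u) x v\<bar> < e"
    using y(1) h(2) by (intro d1(2)) (auto simp: r_def dist_norm)
  moreover have "\<bar>DD (\<lambda>y. DD f y v) y' u - DD (\<lambda>y. DD f y v) x u\<bar> < e"
    using y'(1) h' by (intro d2(2)) (auto simp: r_def dist_norm)
  ultimately show False using eq unfolding e_def by (simp add: abs_if split: if_splits)
qed

lemma DD_symmetric:
  fixes f :: "'e::euclidean_space \<Rightarrow> 'f::euclidean_space"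
  assumes S: "open S" "x \<in> S" and f: "smooth_on S f"
  shows "DD (\<lambda>y. DD f y u) x v = DD (\<lambda>y. DD f y v) x u"
proof (rule euclidean_eqI)
  fix b :: 'f
  have L: "linear (\<lambda>z. z \<bullet> b)" by (auto intro: linearI simp: inner_add_left)
  have *: "DD (\<lambda>y. DD f y u) x v \<bullet> b = DD (\<lambda>y. DD (\<lambda>z. f z \<bullet> b) y u) x v" for u v
  proof -
    have "DD (\<lambda>y. DD (\<lambda>z. f z \<bullet> b) y u) x = DD (\<lambda>y. DD f y u \<bullet> b) x"
      by (rule DD_cong[OF S]) (use DD_linear_comp[OF L smooth_on_differentiable[OF f]] in blast)
    moreover have "DD (\<lambda>y. DD f y u \<bullet> b) x v = DD (\<lambda>y. DD f y u) x v \<bullet> b"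
      using L smooth_on_differentiable[OF smooth_on_DD[OF f] S(2)] by (rule DD_linear_comp)
    ultimately show ?thesis by simp
  qed
  show "DD (\<lambda>y. DD f y u) x v \<bullet> b = DD (\<lambda>y. DD f y v) x u \<bullet> b"
    unfolding * by (rule DD_symmetric_real[OF S]) (rule smooth_on_linear[OF S(1) L f])
qed

section \<open>Determinants\<close>

text \<open>Opens the product, transpose and block rules of the matrix library to the permutation
  sum of the definitions.\<close>

lemma det_nat_det: "det_nat n A = Determinant.det (mat n n (\<lambda>(i, j). A i j))"
  by (auto simp: det_nat_def det_def lessThan_atLeast0 permutes_in_image intro!: sum.cong prod.cong)

lemma det_nat_cong: "(\<And>i j. i < n \<Longrightarrow> j < n \<Longrightarrow> A i j = B i j) \<Longrightarrow> det_nat n A = det_nat n B"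
  by (auto simp: det_nat_det intro!: arg_cong[where f = Determinant.det] eq_matI)

lemma det_nat_transpose: "det_nat n (\<lambda>i j. A j i) = det_nat n A"
proof -
  have "mat n n (\<lambda>(i, j). A j i) = transpose_mat (mat n n (\<lambda>(i, j). A i j))"
    by (rule eq_matI) auto
  then show ?thesis unfolding det_nat_det by (simp add: det_transpose[of _ n])
qed

lemma det_nat_mult: "det_nat n (\<lambda>i j. \<Sum>k<n. A i k * B k j) = det_nat n A * det_nat n B"
proof -
  have "mat n n (\<lambda>(i, j). \<Sum>k<n. A i k * B k j) = mat n n (\<lambda>(i, j). A i j) * mat n n (\<lambda>(i, j). B i j)"
    by (rule eq_matI) (auto simp: scalar_prod_def lessThan_atLeast0)
  then show ?thesis unfolding det_nat_det by (simp add: det_mult[of _ n])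
qed

lemma det_nat_lower_left_zero:
  assumes "\<And>i j. i < m \<Longrightarrow> j < n \<Longrightarrow> A (n + i) j = 0"
  shows "det_nat (n + m) A = det_nat n A * det_nat m (\<lambda>i j. A (n + i) (n + j))"
proof -
  have "mat (n + m) (n + m) (\<lambda>(i, j). A i j) =
      four_block_mat (mat n n (\<lambda>(i, j). A i j)) (mat n m (\<lambda>(i, j). A i (n + j)))
        (0\<^sub>m m n) (mat m m (\<lambda>(i, j). A (n + i) (n + j)))"
  proof (rule eq_matI, goal_cases)
    case (1 i j)
    then show ?case using assms[of "i - n" j] by (auto simp: four_block_mat_def Let_def)
  qed (auto simp: four_block_mat_def Let_def)
  then show ?thesis
    unfolding det_nat_det by (simp add: det_four_block_mat_lower_left_zero[of _ n _ m])
qed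

lemma det_nat_upper_right_zero:
  assumes "\<And>i j. i < n \<Longrightarrow> j < m \<Longrightarrow> A i (n + j) = 0"
  shows "det_nat (n + m) A = det_nat n A * det_nat m (\<lambda>i j. A (n + i) (n + j))"
proof -
  have "det_nat (n + m) (\<lambda>i j. A j i) = det_nat n (\<lambda>i j. A j i) * det_nat m (\<lambda>i j. A (n + j) (n + i))"
    using det_nat_lower_left_zero[of m n "\<lambda>i j. A j i"] assms by blast
  then show ?thesis
    by (simp only: det_nat_transpose[of "n + m" A] det_nat_transpose[of n A]
        det_nat_transpose[of m "\<lambda>i j. A (n + i) (n + j)"])
qed

text \<open>The summand \<open>f\<close> is arbitrary because the same six terms expand the 3 x 3
  determinant and both wedge products.\<close>

lemma sum_permutes_3:
  "(\<Sum>\<sigma> | \<sigma> permutes {..<3::nat}. of_int (sign \<sigma>) * (f (\<sigma> 0) (\<sigma> 1) (\<sigma> 2) :: real)) =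
    f 0 1 2 + f 1 2 0 + f 2 0 1 - f 0 2 1 - f 1 0 2 - f 2 1 0"
proof -
  have e: "{..<3} = insert 0 (insert 1 {2::nat})" by auto
  have f123: "finite {1::nat, 2}" "0 \<notin> {1::nat, 2}" by auto
  have f23: "finite {2::nat}" "1 \<notin> {2::nat}" by auto
  show ?thesis
    unfolding e
    unfolding sum_over_permutations_insert[OF f123]
    unfolding sum_over_permutations_insert[OF f23]
    unfolding permutes_sing
    by (simp add: sign_swap_id permutation_swap_id sign_compose sign_id transpose_def)
qed

lemma det_nat_3:
  "det_nat 3 A = A 0 0 * A 1 1 * A 2 2 + A 0 1 * A 1 2 * A 2 0 + A 0 2 * A 1 0 * A 2 1
    - A 0 0 * A 1 2 * A 2 1 - A 0 1 * A 1 0 * A 2 2 - A 0 2 * A 1 1 * A 2 0"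
proof -
  have e: "{..<3} = insert 0 (insert 1 {2::nat})" by auto
  have "det_nat 3 A = (\<Sum>\<sigma> | \<sigma> permutes {..<3}. of_int (sign \<sigma>) * (A 0 (\<sigma> 0) * A 1 (\<sigma> 1) * A 2 (\<sigma> 2)))"
    unfolding det_nat_def by (rule sum.cong) (auto simp: e mult.assoc)
  then show ?thesis
    by (simp only: sum_permutes_3[of "\<lambda>i j k. A 0 i * A 1 j * A 2 k"])
qed

text \<open>Each permutation meets column \<open>j\<close> exactly once, in row \<open>k0\<close>;
  the other factors do not see the varying vector.\<close>

lemma multilinear_det_vectors:
  fixes bs :: "'e::euclidean_space list"
  shows "length bs = n \<Longrightarrow> multilinear n (det_vectors bs)"
  unfolding multilinear_def
proof (intro allI impI)
  fix vs :: "'e list" and j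
  assume bs: "length bs = n" and vs: "length vs = n" and j: "j < n"
  have *: "linear (\<lambda>v. \<Prod>k<n. bs ! k \<bullet> vs[j := v] ! \<sigma> k)" if \<sigma>: "\<sigma> permutes {..<n}" for \<sigma>
  proof -
    obtain k0 where k0: "k0 < n" "\<sigma> k0 = j"
      using permutes_image[OF \<sigma>] j by (metis imageE lessThan_iff)
    have "(\<Prod>k<n. bs ! k \<bullet> vs[j := v] ! \<sigma> k) = (bs ! k0 \<bullet> v) * (\<Prod>k\<in>{..<n} - {k0}. bs ! k \<bullet> vs ! \<sigma> k)" for v
    proof -
      have "(\<Prod>k<n. bs ! k \<bullet> vs[j := v] ! \<sigma> k) =
          (bs ! k0 \<bullet> vs[j := v] ! \<sigma> k0) * (\<Prod>k\<in>{..<n} - {k0}. bs ! k \<bullet> vs[j := v] ! \<sigma> k)"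
        using k0 by (subst prod.remove[of _ k0]) auto
      moreover have "vs[j := v] ! \<sigma> k = vs ! \<sigma> k" if "k \<in> {..<n} - {k0}" for k
        using permutes_inj[OF \<sigma>] k0(2) that by (metis Diff_iff injD insertI1 nth_list_update_neq)
      ultimately show ?thesis using k0 j vs by simp
    qed
    then show ?thesis by (auto intro!: linearI simp: inner_add_right algebra_simps)
  qed
  have "det_vectors bs (vs[j := v]) =
      (\<Sum>\<sigma> | \<sigma> permutes {..<n}. of_int (sign \<sigma>) * (\<Prod>k<n. bs ! k \<bullet> vs[j := v] ! \<sigma> k))" for v
    by (simp add: det_vectors_def det_nat_def bs)
  moreover have "linear (\<lambda>v. \<Sum>\<sigma> | \<sigma> permutes {..<n}. of_int (sign \<sigma>) * (\<Prod>k<n. bs ! k \<bullet> vs[j := v] ! \<sigma> k))"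
  proof (rule linear_compose_sum, rule ballI)
    fix \<sigma> assume "\<sigma> \<in> {\<sigma>. \<sigma> permutes {..<n}}"
    then have "linear (\<lambda>v. \<Prod>k<n. bs ! k \<bullet> vs[j := v] ! \<sigma> k)" using * by blast
    from linear_compose_scale_right[OF this, of "of_int (sign \<sigma>)"]
    show "linear (\<lambda>v. of_int (sign \<sigma>) * (\<Prod>k<n. bs ! k \<bullet> vs[j := v] ! \<sigma> k))" by simp
  qed
  ultimately show "linear (\<lambda>v. det_vectors bs (vs[j := v]))" by presburger
qed

lemma alternating_det_vectors: 
  assumes "length bs = n"
  shows "alternating n (det_vectors bs)"
  unfolding alternating_def
proof (intro allI impI)
  fix vs :: "'a list" and j l
  assume vs: "length vs = n" "j < l" "l < n" "vs ! j = vs ! l"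
  have "Determinant.det (mat n n (\<lambda>(i, j). bs ! i \<bullet> vs ! j)) = 0"
    by (rule det_identical_columns[of _ n j l]) (use vs in \<open>auto intro!: eq_vecI\<close>)
  then show "det_vectors bs vs = 0"
    by (simp add: det_vectors_def det_nat_det assms)
qed

text \<open>Under either alternative the matrix is block triangular. The ordering of the basis
  encodes the product orientation, so the same formula serves the Jacobians of product charts and
  the six-dimensional volume form.\<close>

lemma det_vectors_block:
  assumes "length us = length bs" "length vs = length cs"
    and "(\<forall>u\<in>set us. snd u = 0) \<or> (\<forall>v\<in>set vs. fst v = 0)"
  shows "det_vectors (map (\<lambda>e. (e, 0)) bs @ map (\<lambda>f. (0, f)) cs) (us @ vs) =
    det_vectors bs (map fst us) * det_vectors cs (map snd vs)"
proof -
  let ?A = "\<lambda>k l. (map (\<lambda>e. (e, 0)) bs @ map (\<lambda>f. (0, f)) cs) ! k \<bullet> (us @ vs) ! l"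
  let ?n = "length bs" and ?m = "length cs"
  have "det_nat (?n + ?m) ?A = det_nat ?n ?A * det_nat ?m (\<lambda>i j. ?A (?n + i) (?n + j))"
    using assms(3)
  proof
    assume "\<forall>u\<in>set us. snd u = 0"
    then show ?thesis
      using assms by (intro det_nat_lower_left_zero) (auto simp: nth_append inner_prod_def)
  next
    assume "\<forall>v\<in>set vs. fst v = 0"
    then show ?thesis
      using assms by (intro det_nat_upper_right_zero) (auto simp: nth_append inner_prod_def)
  qed
  moreover have "det_nat ?n ?A = det_nat ?n (\<lambda>k l. bs ! k \<bullet> map fst us ! l)"
    using assms by (intro det_nat_cong) (auto simp: nth_append inner_prod_def)
  moreover have "det_nat ?m (\<lambda>i j. ?A (?n + i) (?n + j)) = det_nat ?m (\<lambda>k l. cs ! k \<bullet> map snd vs ! l)"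
    using assms by (intro det_nat_cong) (auto simp: nth_append inner_prod_def)
  ultimately show ?thesis by (simp add: det_vectors_def)
qed

lemma basis_list_sum:
  fixes bs :: "'e::euclidean_space list"
  assumes "distinct bs" "set bs = Basis"
  shows "(\<Sum>k<length bs. f (bs ! k)) = (\<Sum>e\<in>Basis. f e)"
  using sum_list_distinct_conv_sum_set[of bs f]
    sum_list_sum_nth[of "map f bs"] assms by (simp add: lessThan_atLeast0)

lemma basis_list_length:
  fixes bs :: "'e::euclidean_space list"
  assumes "distinct bs" "set bs = Basis"
  shows "length bs = DIM('e)"
  using assms distinct_card by metis

lemma det_vectors_map:
  fixes L :: "'e::euclidean_space \<Rightarrow> 'e"
  assumes "distinct bs" "set bs = Basis" "linear L" "length vs = length bs"
  shows "det_vectors bs (map L vs) = det_vectors bs (map L bs) * det_vectors bs vs"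
proof -
  have *: "bs ! i \<bullet> L v = (\<Sum>k<length bs. (bs ! i \<bullet> L (bs ! k)) * (bs ! k \<bullet> v))" for i v
  proof -
    have "L v = (\<Sum>e\<in>Basis. (v \<bullet> e) *\<^sub>R L e)"
      using linear_sum[OF assms(3), of "\<lambda>e. (v \<bullet> e) *\<^sub>R e" Basis]
      by (simp add: euclidean_representation linear_scale[OF assms(3)])
    then have "bs ! i \<bullet> L v = (\<Sum>e\<in>Basis. (bs ! i \<bullet> L e) * (e \<bullet> v))"
      by (simp add: inner_sum_right mult.commute inner_commute)
    then show ?thesis using basis_list_sum[OF assms(1,2), of "\<lambda>e. (bs ! i \<bullet> L e) * (e \<bullet> v)"] by simp
  qed
  have "det_vectors bs (map L vs) =
      det_nat (length bs) (\<lambda>i j. \<Sum>k<length bs. (bs ! i \<bullet> map L bs ! k) * (bs ! k \<bullet> vs ! j))"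
    unfolding det_vectors_def
  proof (rule det_nat_cong)
    fix i j assume "i < length bs" "j < length bs"
    then show "bs ! i \<bullet> map L vs ! j = (\<Sum>k<length bs. (bs ! i \<bullet> map L bs ! k) * (bs ! k \<bullet> vs ! j))"
      using *[of i "vs ! j"] assms(4) by simp
  qed
  then show ?thesis
    unfolding det_nat_mult[of "length bs" "\<lambda>i k. bs ! i \<bullet> map L bs ! k"] unfolding det_vectors_def .
qed

text \<open>In coordinates the left side is the determinant of a product of three matrices, the
  middle one being that of \<open>b\<close>. It is the source of the Gram identity for volume forms
  and of their behaviour under change of charts.\<close>

lemma gram_det:
  fixes b :: "'e::euclidean_space \<Rightarrow> 'e \<Rightarrow> real"
  assumes "distinct bs" "set bs = Basis" "bilinear b" "length us = length bs" "length vs = length bs"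
  shows "det_nat (length bs) (\<lambda>i j. b (us ! i) (vs ! j)) =
    det_vectors bs us * det_nat (length bs) (\<lambda>i j. b (bs ! i) (bs ! j)) * det_vectors bs vs"
proof -
  let ?n = "length bs"
  have *: "b u v = (\<Sum>k<?n. (bs ! k \<bullet> u) * (\<Sum>l<?n. b (bs ! k) (bs ! l) * (bs ! l \<bullet> v)))" for u v
  proof -
    have "b u v = b (\<Sum>e\<in>Basis. (e \<bullet> u) *\<^sub>R e) (\<Sum>e\<in>Basis. (e \<bullet> v) *\<^sub>R e)"
      by (simp add: euclidean_representation inner_commute[of _ u] inner_commute[of _ v])
    also have "\<dots> = (\<Sum>e\<in>Basis. \<Sum>f\<in>Basis. (e \<bullet> u) * (b e f * (f \<bullet> v)))"
      using assms(3)
      by (subst bilinear_sum)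
        (auto simp: sum.cartesian_product bilinear_lmul bilinear_rmul mult_ac)
    also have "\<dots> = (\<Sum>e\<in>Basis. (e \<bullet> u) * (\<Sum>l<?n. b e (bs ! l) * (bs ! l \<bullet> v)))"
      using basis_list_sum[OF assms(1,2), of "\<lambda>f. b _ f * (f \<bullet> v)"] by (simp add: sum_distrib_left)
    finally show ?thesis
      using basis_list_sum[OF assms(1,2), of "\<lambda>e. (e \<bullet> u) * (\<Sum>l<?n. b e (bs ! l) * (bs ! l \<bullet> v))"] by simp
  qed
  have "det_nat ?n (\<lambda>i j. b (us ! i) (vs ! j)) =
     det_nat ?n (\<lambda>i j. \<Sum>k<?n. (\<lambda>i k. bs ! k \<bullet> us ! i) i k *
        (\<lambda>k j. \<Sum>l<?n. (\<lambda>k l. b (bs ! k) (bs ! l)) k l * (\<lambda>l j. bs ! l \<bullet> vs ! j) l j) k j)"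
    by (intro det_nat_cong) (rule *)
  also have "\<dots> = det_nat ?n (\<lambda>i k. bs ! k \<bullet> us ! i) *
      (det_nat ?n (\<lambda>k l. b (bs ! k) (bs ! l)) * det_nat ?n (\<lambda>l j. bs ! l \<bullet> vs ! j))"
    unfolding det_nat_mult ..
  also have "det_nat ?n (\<lambda>i k. bs ! k \<bullet> us ! i) = det_vectors bs us"
    unfolding det_vectors_def by (rule det_nat_transpose)
  finally show ?thesis by (simp add: det_vectors_def mult.assoc)
qed

lemma det_vectors_basis:
  fixes bs :: "'e::euclidean_space list"
  assumes "distinct bs" "set bs = Basis"
  shows "det_vectors bs bs = 1"
proof -
  have "bs ! i \<bullet> bs ! j = (if i = j then 1 else 0)" if "i < length bs" "j < length bs" for i j
    using that assms by (metis inner_Basis nth_eq_iff_index_eq nth_mem)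
  then have "det_vectors bs bs = Determinant.det (mat (length bs) (length bs) (\<lambda>(i, j). if i = j then 1 else 0))"
    unfolding det_vectors_def det_nat_det by (intro arg_cong[where f = Determinant.det] eq_matI) auto
  also have "mat (length bs) (length bs) (\<lambda>(i, j). if i = j then 1 else 0) = (1\<^sub>m (length bs) :: real mat)"
    by (rule eq_matI) auto
  finally show ?thesis by simp
qed

section \<open>Metric linear algebra\<close>

definition tr :: "('e::euclidean_space \<Rightarrow> 'e) \<Rightarrow> real" where
  "tr L = (\<Sum>e\<in>Basis. L e \<bullet> e)"

lemma tr_add: "tr (\<lambda>u. L u + M u) = tr L + tr M"
  by (simp add: tr_def inner_add_left sum.distrib)

lemma tr_diff: "tr (\<lambda>u. L u - M u) = tr L - tr M"
  by (simp add: tr_def inner_diff_left sum_subtractf)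

lemma tr_scaleR: "tr (\<lambda>u. c *\<^sub>R L u) = c * tr L"
  by (simp add: tr_def sum_distrib_left)

lemma tr_minus: "tr (\<lambda>u. - L u) = - tr L"
  by (simp add: tr_def sum_negf)

lemma linear_sum_basis:
  assumes "linear \<phi>"
  shows "(\<Sum>e\<in>Basis. (v \<bullet> e) *\<^sub>R \<phi> e) = \<phi> v"
  using linear_sum[OF assms, of "\<lambda>e. (v \<bullet> e) *\<^sub>R e" Basis]
  by (simp add: euclidean_representation linear_scale[OF assms])

lemma tr_rank_one: "linear \<phi> \<Longrightarrow> tr (\<lambda>u. \<phi> u *\<^sub>R x) = \<phi> x"
  using linear_sum_basis[of \<phi> x] by (simp add: tr_def mult.commute)

lemma tr_id: "tr (\<lambda>u. u :: 'e::euclidean_space) = DIM('e)"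
  by (simp add: tr_def)

lemma tr_compose:
  fixes L :: "'e::euclidean_space \<Rightarrow> 'f::euclidean_space"
  assumes "linear L" "linear M"
  shows "tr (\<lambda>u. M (L u)) = tr (\<lambda>u. L (M u))"
proof -
  have 1: "M x \<bullet> e = (\<Sum>f\<in>Basis. (x \<bullet> f) * (M f \<bullet> e))" for x e
    using linear_sum_basis[OF assms(2), of x] by (metis (no_types, lifting) inner_scaleR_left inner_sum_left sum.cong)
  have 2: "L x \<bullet> f = (\<Sum>e\<in>Basis. (x \<bullet> e) * (L e \<bullet> f))" for x f
    using linear_sum_basis[OF assms(1), of x] by (metis (no_types, lifting) inner_scaleR_left inner_sum_left sum.cong)
  have "tr (\<lambda>u. M (L u)) = (\<Sum>e\<in>Basis. \<Sum>f\<in>Basis. (L e \<bullet> f) * (M f \<bullet> e))"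
    unfolding tr_def by (intro sum.cong refl 1)
  also have "\<dots> = (\<Sum>f\<in>Basis. \<Sum>e\<in>Basis. (M f \<bullet> e) * (L e \<bullet> f))"
    by (subst sum.swap) (simp add: mult.commute)
  also have "\<dots> = tr (\<lambda>u. L (M u))"
    unfolding tr_def by (intro sum.cong refl 2[symmetric])
  finally show ?thesis .
qed

section \<open>Nondegenerate symmetric forms of any signature\<close>

locale metric_form =
  fixes g :: "'e::euclidean_space list \<Rightarrow> real"
  assumes bil: "bilinear (\<lambda>u v. g [u, v])"
    and sym: "g [u, v] = g [v, u]"
    and nondeg: "(\<And>v. g [w, v] = 0) \<Longrightarrow> w = 0"
begin

lemmas g_add_left = bilinear_ladd[OF bil]
lemmas g_add_right = bilinear_radd[OF bil]
lemmas g_scale_left = bilinear_lmul[OF bil]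
lemmas g_scale_right = bilinear_rmul[OF bil]
lemmas g_minus_left = bilinear_lneg[OF bil]
lemmas g_minus_right = bilinear_rneg[OF bil]
lemmas g_diff_left = bilinear_lsub[OF bil]
lemmas g_diff_right = bilinear_rsub[OF bil]
lemmas g_zero_left = bilinear_lzero[OF bil]
lemmas g_zero_right = bilinear_rzero[OF bil]
lemmas g_lin = g_add_left g_add_right g_scale_left g_scale_right g_minus_left g_minus_right
  g_diff_left g_diff_right g_zero_left g_zero_right

lemma lin_left: "linear (\<lambda>u. g [u, v])"
  and lin_right: "linear (\<lambda>v. g [u, v])"
  using bil by (auto simp: bilinear_def)

lemma eqI: "(\<And>v. g [w, v] = g [w', v]) \<Longrightarrow> w = w'"
  using nondeg[of "w - w'"] by (simp add: g_lin)

lemma sharp_unique: "(\<And>v. g [w, v] = \<phi> v) \<Longrightarrow> sharp g \<phi> = w"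
  unfolding sharp_def by (rule the_equality) (auto intro: eqI)

text \<open>\<open>G\<close> is the operator that represents \<open>g\<close> in the Euclidean inner
  product: injective by nondegeneracy, hence surjective in finite dimension.\<close>

lemma sharp_ex:
  assumes "linear \<phi>"
  shows "\<exists>w. \<forall>v. g [w, v] = \<phi> v"
proof -
  define G where "G w = (\<Sum>e\<in>Basis. g [w, e] *\<^sub>R e)" for w
  have lin: "linear G"
    unfolding G_def by (auto intro!: linearI simp: g_lin scaleR_left_distrib sum.distrib scaleR_sum_right)
  have G: "G w \<bullet> v = g [w, v]" for w v
    using linear_sum_basis[OF lin_right[of w], of v]
    by (simp add: G_def inner_sum_left inner_sum_right mult.commute inner_commute[of _ v])
  have "inj G"
    unfolding linear_injective_0[OF lin] using G nondeg by (metis inner_zero_left)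
  then have "surj G" using lin linear_injective_imp_surjective by blast
  then obtain w where w: "G w = (\<Sum>e\<in>Basis. \<phi> e *\<^sub>R e)" by (metis surjD)
  have "g [w, v] = \<phi> v" for v
    using G[of w v] linear_sum_basis[OF assms, of v] unfolding w
    by (simp add: inner_sum_left inner_sum_right mult.commute inner_commute[of _ v])
  then show ?thesis by blast
qed

lemma sharp_works: "linear \<phi> \<Longrightarrow> g [sharp g \<phi>, v] = \<phi> v"
  using sharp_ex sharp_unique by metis

lemma raise_works: "g [raise g e, v] = v \<bullet> e" "g [v, raise g e] = v \<bullet> e"
proof -
  have "linear (\<lambda>v. v \<bullet> e)" by (auto intro: linearI simp: inner_add_left)
  from sharp_works[OF this] show "g [raise g e, v] = v \<bullet> e"
    by (simp add: raise_def)
  then show "g [v, raise g e] = v \<bullet> e" using sym by simp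
qed

text \<open>Resolution of the identity by the dual bases \<open>e\<close> and
  \<open>raise g e\<close>; it replaces expansion in an orthonormal frame.\<close>

lemma sum_raise: "(\<Sum>e\<in>Basis. g [e, x] *\<^sub>R raise g e) = x"
proof (rule eqI)
  fix v
  have "g [\<Sum>e\<in>Basis. g [e, x] *\<^sub>R raise g e, v] = (\<Sum>e\<in>Basis. (v \<bullet> e) *\<^sub>R g [e, x])"
    by (simp add: linear_sum[OF lin_left] g_lin raise_works mult.commute)
  then show "g [\<Sum>e\<in>Basis. g [e, x] *\<^sub>R raise g e, v] = g [x, v]"
    by (simp add: linear_sum_basis[OF lin_left, simplified] sym)
qed

lemma contract_raise:
  assumes "linear \<phi>"
  shows "(\<Sum>e\<in>Basis. g [e, x] * \<phi> (raise g e)) = \<phi> x"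
    and "(\<Sum>e\<in>Basis. g [raise g e, x] * \<phi> e) = \<phi> x"
proof -
  have "(\<Sum>e\<in>Basis. g [e, x] * \<phi> (raise g e)) = \<phi> (\<Sum>e\<in>Basis. g [e, x] *\<^sub>R raise g e)"
    by (simp add: linear_sum[OF assms] linear_scale[OF assms])
  then show "(\<Sum>e\<in>Basis. g [e, x] * \<phi> (raise g e)) = \<phi> x" by (simp add: sum_raise)
  show "(\<Sum>e\<in>Basis. g [raise g e, x] * \<phi> e) = \<phi> x"
    using linear_sum_basis[OF assms, of x] by (simp add: raise_works)
qed

lemma sharp_sum:
  assumes "linear \<phi>"
  shows "sharp g \<phi> = (\<Sum>e\<in>Basis. \<phi> e *\<^sub>R raise g e)"
  using sum_raise[of "sharp g \<phi>"] by (simp add: sym[of _ "sharp g \<phi>"] sharp_works[OF assms])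

lemma sharp_sum':
  assumes "linear \<phi>"
  shows "sharp g \<phi> = (\<Sum>e\<in>Basis. \<phi> (raise g e) *\<^sub>R e)"
  using euclidean_representation[of "sharp g \<phi>"]
  by (simp add: raise_works(2)[symmetric] sharp_works[OF assms])

text \<open>The inverse metric is symmetric, which is the fact \<open>c\<close> below; hence either
  index of a contracted pair may be the raised one.\<close>

lemma contract_commute:
  assumes "bilinear T"
  shows "(\<Sum>e\<in>Basis. T e (raise g e)) = (\<Sum>e\<in>Basis. T (raise g e) e)"
proof -
  have l: "linear (\<lambda>v. T u v)" "linear (\<lambda>v. T v u)" for u
    using assms by (auto simp: bilinear_def)
  have 1: "T e x = (\<Sum>f\<in>Basis. (x \<bullet> f) *\<^sub>R T e f)" "T x e = (\<Sum>f\<in>Basis. (x \<bullet> f) *\<^sub>R T f e)" for e x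
    using linear_sum_basis[OF l(1), of x e] linear_sum_basis[OF l(2), of x e] by simp_all
  have c: "raise g e \<bullet> f = raise g f \<bullet> e" for e f
    using raise_works[of f "raise g e"] raise_works[of e "raise g f"] sym by metis
  have "(\<Sum>e\<in>Basis. T e (raise g e)) = (\<Sum>e\<in>Basis. \<Sum>f\<in>Basis. (raise g e \<bullet> f) *\<^sub>R T e f)"
    by (intro sum.cong refl 1)
  also have "\<dots> = (\<Sum>f\<in>Basis. \<Sum>e\<in>Basis. (raise g f \<bullet> e) *\<^sub>R T e f)"
    by (subst sum.swap) (simp add: c)
  also have "\<dots> = (\<Sum>e\<in>Basis. T (raise g e) e)"
    by (intro sum.cong refl 1(2)[symmetric])
  finally show ?thesis .
qed

lemma tr_raise: "tr L = (\<Sum>e\<in>Basis. g [L e, raise g e])"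
  by (simp add: tr_def raise_works)

text \<open>Moving the raised index to the other slot and then \<open>L\<close> across
  \<open>g\<close> reproduces the trace with the opposite sign.\<close>

lemma tr_skew:
  assumes "linear L" "\<And>u v. g [L u, v] = - g [u, L v]"
  shows "tr L = 0"
proof -
  have "bilinear (\<lambda>u v. g [L u, v])"
    unfolding bilinear_def using lin_right linear_compose[OF assms(1) lin_left] by (simp add: o_def)
  from contract_commute[OF this] have "tr L = (\<Sum>e\<in>Basis. g [L (raise g e), e])"
    by (simp add: tr_raise)
  also have "\<dots> = - tr L" by (simp add: assms(2) tr_raise sum_negf sym[of "raise g _"])
  finally show ?thesis by simp
qed

end

section \<open>Oriented three-dimensional geometry from the Gram identity\<close>

text \<open>The right side of \<open>gram\<close> is \<open>s\<close> times the determinant of the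
  mutual inner products, with \<open>s = 1\<close> for a Riemannian and \<open>s = - 1\<close> for a
  Lorentzian metric. Linearity and alternation of \<nu> are consequences: fixing one triple where
  \<nu> is nonzero and dividing exhibits \<nu> as a multiple of that determinant.\<close>

locale oriented_form3 = metric_form g for g :: "'e::euclidean_space list \<Rightarrow> real" +
  fixes \<nu> :: "'e list \<Rightarrow> real" and s :: real
  assumes dim3: "DIM('e) = 3" and s_square: "s * s = 1"
    and nu_nonzero: "\<exists>u v w. \<nu> [u, v, w] \<noteq> 0"
    and gram: "\<nu> [u, v, w] * \<nu> [x, y, z] =
      s * (g [u, x] * g [v, y] * g [w, z] + g [u, y] * g [v, z] * g [w, x] + g [u, z] * g [v, x] * g [w, y]
        - g [u, x] * g [v, z] * g [w, y] - g [u, y] * g [v, x] * g [w, z] - g [u, z] * g [v, y] * g [w, x])"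
begin

lemma nu_det:
  "\<exists>x y z c. \<forall>u v w. \<nu> [u, v, w] = c *
      (g [u, x] * g [v, y] * g [w, z] + g [u, y] * g [v, z] * g [w, x] + g [u, z] * g [v, x] * g [w, y]
        - g [u, x] * g [v, z] * g [w, y] - g [u, y] * g [v, x] * g [w, z] - g [u, z] * g [v, y] * g [w, x])"
proof -
  obtain x y z where n: "\<nu> [x, y, z] \<noteq> 0" using nu_nonzero by blast
  have *: "p * q = s * d \<Longrightarrow> q \<noteq> 0 \<Longrightarrow> p = s / q * d" for p q d :: real
    by (simp add: eq_divide_eq)
  show ?thesis
    by (intro exI allI) (rule *[OF gram n])
qed

lemma nu_linear: "linear (\<lambda>u. \<nu> [u, v, w])" "linear (\<lambda>u. \<nu> [v, u, w])" "linear (\<lambda>u. \<nu> [v, w, u])"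
proof -
  obtain x y z c where nu: "\<And>u v w. \<nu> [u, v, w] = c *
      (g [u, x] * g [v, y] * g [w, z] + g [u, y] * g [v, z] * g [w, x] + g [u, z] * g [v, x] * g [w, y]
        - g [u, x] * g [v, z] * g [w, y] - g [u, y] * g [v, x] * g [w, z] - g [u, z] * g [v, y] * g [w, x])"
    using nu_det by metis
  show "linear (\<lambda>u. \<nu> [u, v, w])" "linear (\<lambda>u. \<nu> [v, u, w])" "linear (\<lambda>u. \<nu> [v, w, u])"
    unfolding nu by (rule linearI; simp add: g_lin algebra_simps)+
qed

lemma nu_swap12: "\<nu> [v, u, w] = - \<nu> [u, v, w]"
  and nu_swap23: "\<nu> [u, w, v] = - \<nu> [u, v, w]"
proof -
  obtain x y z c where nu: "\<And>u v w. \<nu> [u, v, w] = c *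
      (g [u, x] * g [v, y] * g [w, z] + g [u, y] * g [v, z] * g [w, x] + g [u, z] * g [v, x] * g [w, y]
        - g [u, x] * g [v, z] * g [w, y] - g [u, y] * g [v, x] * g [w, z] - g [u, z] * g [v, y] * g [w, x])"
    using nu_det by metis
  show "\<nu> [v, u, w] = - \<nu> [u, v, w]" "\<nu> [u, w, v] = - \<nu> [u, v, w]"
    unfolding nu by (simp_all add: algebra_simps)
qed

lemma nu_cyc: "\<nu> [v, w, u] = \<nu> [u, v, w]"
  using nu_swap12 nu_swap23 by metis

lemma nu_same: "\<nu> [u, u, v] = 0" "\<nu> [u, v, v] = 0" "\<nu> [u, v, u] = 0"
  using nu_swap12[of u u v] nu_swap23[of u v v] nu_swap12[of v u u] nu_swap23[of v u u] by auto

lemmas nu_lin = linear_add[OF nu_linear(1)] linear_add[OF nu_linear(2)] linear_add[OF nu_linear(3)]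
  linear_diff[OF nu_linear(1)] linear_diff[OF nu_linear(2)] linear_diff[OF nu_linear(3)]
  linear_scale[OF nu_linear(1)] linear_scale[OF nu_linear(2)] linear_scale[OF nu_linear(3)]
  linear_neg[OF nu_linear(1)] linear_neg[OF nu_linear(2)] linear_neg[OF nu_linear(3)]
  linear_0[OF nu_linear(1)] linear_0[OF nu_linear(2)] linear_0[OF nu_linear(3)]

definition P :: "'e \<Rightarrow> 'e \<Rightarrow> 'e" where
  "P u v = sharp g (\<lambda>w. \<nu> [u, v, w])"

lemma g_P: "g [P u v, w] = \<nu> [u, v, w]" "g [w, P u v] = \<nu> [u, v, w]"
  using sharp_works[OF nu_linear(3), of u v w] sym by (auto simp: P_def)

lemma bilinear_P: "bilinear P"
  unfolding bilinear_def by (auto intro!: linearI eqI simp: g_P g_lin nu_lin)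

lemmas P_lin = bilinear_ladd[OF bilinear_P] bilinear_radd[OF bilinear_P]
  bilinear_lmul[OF bilinear_P] bilinear_rmul[OF bilinear_P]
  bilinear_lneg[OF bilinear_P] bilinear_rneg[OF bilinear_P]
  bilinear_lsub[OF bilinear_P] bilinear_rsub[OF bilinear_P]
  bilinear_lzero[OF bilinear_P] bilinear_rzero[OF bilinear_P]

lemma linear_P: "linear (P u)" "linear (\<lambda>u. P u v)"
  using bilinear_P by (auto simp: bilinear_def)

lemma P_skew: "P v u = - P u v"
  by (rule eqI) (simp add: g_P g_lin nu_swap12[of v u])

text \<open>After expansion by \<open>gram\<close> the contracted index yields either the dimension
  3 or an inner product; of each of the two surviving products 3 - 1 - 1 = 1 copy remains.\<close>

lemma contract_nu_1:
  "(\<Sum>e\<in>Basis. \<nu> [u, v, e] * \<nu> [x, y, raise g e]) = s * (g [u, x] * g [v, y] - g [u, y] * g [v, x])"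
proof -
  have c: "(\<Sum>e\<in>Basis. g [p, raise g e] * g [e, q]) = g [p, q]"
    and c': "(\<Sum>e\<in>Basis. g [e, p] * g [q, raise g e]) = g [q, p]" for p q
    using contract_raise(1)[OF lin_right[of p], of q] contract_raise(1)[OF lin_right[of q], of p]
    by (simp_all add: mult.commute)
  have d: "(\<Sum>e\<in>Basis. g [e, raise g e]) = 3"
    using dim3 by (simp add: raise_works)
  have "(\<Sum>e\<in>Basis. \<nu> [u, v, e] * \<nu> [x, y, raise g e]) =
    s * (g [u, x] * g [v, y] * (\<Sum>e\<in>Basis. g [e, raise g e])
      + g [u, y] * (\<Sum>e\<in>Basis. g [v, raise g e] * g [e, x])
      + g [v, x] * (\<Sum>e\<in>Basis. g [u, raise g e] * g [e, y])
      - g [u, x] * (\<Sum>e\<in>Basis. g [v, raise g e] * g [e, y])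
      - g [u, y] * g [v, x] * (\<Sum>e\<in>Basis. g [e, raise g e])
      - g [v, y] * (\<Sum>e\<in>Basis. g [u, raise g e] * g [e, x]))"
    unfolding gram by (simp add: sum.distrib sum_subtractf sum_distrib_left algebra_simps)
  also have "\<dots> = s * (g [u, x] * g [v, y] - g [u, y] * g [v, x])"
    unfolding c d by (simp add: algebra_simps)
  finally show ?thesis .
qed

lemma contract_nu_2:
  "(\<Sum>e\<in>Basis. \<Sum>f\<in>Basis. \<nu> [u, e, f] * \<nu> [x, raise g e, raise g f]) = 2 * s * g [u, x]"
proof -
  have "(\<Sum>e\<in>Basis. \<Sum>f\<in>Basis. \<nu> [u, e, f] * \<nu> [x, raise g e, raise g f]) =
      s * (g [u, x] * (\<Sum>e\<in>Basis. g [e, raise g e]) - (\<Sum>e\<in>Basis. g [e, x] * g [u, raise g e]))"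
    by (simp add: contract_nu_1 sum_subtractf sum_distrib_left algebra_simps)
  also have "(\<Sum>e\<in>Basis. g [e, x] * g [u, raise g e]) = g [u, x]"
    by (rule contract_raise(1)[OF lin_right])
  also have "(\<Sum>e\<in>Basis. g [e, raise g e]) = 3" using dim3 by (simp add: raise_works)
  finally show ?thesis by simp
qed

lemma contract_nu_3:
  "(\<Sum>e\<in>Basis. \<Sum>f\<in>Basis. \<Sum>k\<in>Basis. \<nu> [e, f, k] * \<nu> [raise g e, raise g f, raise g k]) = 6 * s"
  using dim3 by (simp add: contract_nu_2 raise_works sum_distrib_left[symmetric])

lemma g_PP: "g [P u v, P x y] = s * (g [u, x] * g [v, y] - g [u, y] * g [v, x])"
proof -
  have "g [P u v, P x y] = (\<Sum>e\<in>Basis. g [e, P u v] * g [P x y, raise g e])"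
    using contract_raise(1)[OF lin_right[of "P x y"], of "P u v"] sym[of "P u v" "P x y"] by metis
  then show ?thesis by (simp only: g_P contract_nu_1)
qed

text \<open>Cyclic symmetry of \<nu> turns the pairing with \<open>z\<close> into an inner product
  of two cross products, which \<open>g_PP\<close> evaluates. For \<open>s = 1\<close> this is the
  classical double cross product.\<close>

lemma P_P: "P u (P v w) = s *\<^sub>R (g [u, w] *\<^sub>R v - g [u, v] *\<^sub>R w)"
proof (rule eqI)
  fix z
  have "g [P u (P v w), z] = \<nu> [z, u, P v w]" by (simp only: g_P nu_cyc[of u "P v w" z])
  also have "\<dots> = s * (g [z, v] * g [u, w] - g [z, w] * g [u, v])"
    by (simp add: g_P(1)[symmetric] g_PP)
  finally show "g [P u (P v w), z] = g [s *\<^sub>R (g [u, w] *\<^sub>R v - g [u, v] *\<^sub>R w), z]"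
    by (simp add: g_lin sym[of z] mult.commute)
qed

text \<open>Two evaluations of the iterated product \<open>P (P a b) (P c d)\<close>.\<close>

lemma four_vectors:
  "\<nu> [b, c, d] *\<^sub>R a - \<nu> [a, c, d] *\<^sub>R b + \<nu> [a, b, d] *\<^sub>R c - \<nu> [a, b, c] *\<^sub>R d = 0"
proof -
  have "s *\<^sub>R (\<nu> [a, b, d] *\<^sub>R c - \<nu> [a, b, c] *\<^sub>R d) = - (s *\<^sub>R (\<nu> [c, d, b] *\<^sub>R a - \<nu> [c, d, a] *\<^sub>R b))"
    using P_skew[of "P a b" "P c d"] by (simp add: P_P g_P)
  then have "s *\<^sub>R (\<nu> [c, d, b] *\<^sub>R a - \<nu> [c, d, a] *\<^sub>R b + \<nu> [a, b, d] *\<^sub>R c - \<nu> [a, b, c] *\<^sub>R d) = 0"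
    by (simp add: algebra_simps)
  moreover have "s \<noteq> 0" using s_square by auto
  ultimately show ?thesis using nu_cyc[of c d b] nu_cyc[of c d a] by simp
qed

lemma four_vectors_linear:
  assumes "linear \<phi>"
  shows "\<phi> a * \<nu> [b, c, d] - \<phi> b * \<nu> [a, c, d] + \<phi> c * \<nu> [a, b, d] - \<phi> d * \<nu> [a, b, c] = (0::real)"
  using arg_cong[OF four_vectors[of b c d a], of \<phi>]
  by (simp add: linear_add[OF assms] linear_diff[OF assms] linear_scale[OF assms] linear_0[OF assms] mult.commute)

text \<open>The infinitesimal form of \<nu>(Lu, Lv, Lw) = det L \<nu>(u, v, w). By
  \<open>four_vectors\<close>, \<nu>(u, v, w) times a basis vector is a combination of u, v, w;
  applying \<open>L\<close>, taking the component along that basis vector and summing gives the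
  trace.\<close>

lemma tr_nu:
  assumes "linear L"
  shows "\<nu> [L u, v, w] + \<nu> [u, L v, w] + \<nu> [u, v, L w] = tr L * \<nu> [u, v, w]"
proof -
  have s: "(\<Sum>e\<in>Basis. (x \<bullet> e) * \<nu> [e, v, w]) = \<nu> [x, v, w]" for x v w
    using linear_sum_basis[OF nu_linear(1)] by simp
  have "\<nu> [u, v, w] *\<^sub>R e = \<nu> [e, v, w] *\<^sub>R u - \<nu> [e, u, w] *\<^sub>R v + \<nu> [e, u, v] *\<^sub>R w" for e
    using four_vectors[of u v w e] by (simp add: algebra_simps)
  from arg_cong[OF this, of L] have "\<nu> [u, v, w] *\<^sub>R L e = \<nu> [e, v, w] *\<^sub>R L u - \<nu> [e, u, w] *\<^sub>R L v + \<nu> [e, u, v] *\<^sub>R L w" for e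
    by (simp add: linear_add[OF assms] linear_diff[OF assms] linear_scale[OF assms])
  then have eq: "\<nu> [u, v, w] * (L e \<bullet> e) = (L u \<bullet> e) * \<nu> [e, v, w] - (L v \<bullet> e) * \<nu> [e, u, w] + (L w \<bullet> e) * \<nu> [e, u, v]" for e
    by (metis (no_types, lifting) inner_add_left inner_diff_left inner_scaleR_left mult.commute)
  have "\<nu> [u, v, w] * tr L = \<nu> [L u, v, w] - \<nu> [L v, u, w] + \<nu> [L w, u, v]"
    unfolding tr_def sum_distrib_left eq by (simp add: sum.distrib sum_subtractf s)
  then show ?thesis using nu_swap12[of "L v" u w] nu_cyc[of u v "L w"] by (simp add: mult.commute)
qed

lemma tr_P [simp]: "tr (P p) = 0"
  by (rule tr_skew[OF linear_P(1)]) (simp only: g_P, rule nu_swap23)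

lemma tr_P' [simp]: "tr (\<lambda>u. P u p) = 0"
  using tr_P[of p] tr_minus[of "P p"] P_skew[of _ p] by simp

text \<open>By \<open>P_P\<close> the map is s times a rank one map of trace g(p, q) minus g(p, q)
  times the identity of trace 3, hence the coefficient s (1 - 3).\<close>

lemma tr_PP: "tr (\<lambda>u. P p (P q u)) = - 2 * s * g [p, q]"
proof -
  have "tr (\<lambda>u. P p (P q u)) = s * (g [p, q] - g [p, q] * DIM('e))"
    unfolding P_P tr_scaleR tr_diff by (simp add: tr_rank_one[OF lin_right] tr_id)
  then show ?thesis using dim3 by (simp add: algebra_simps)
qed

lemma hodge_one: "linear \<alpha> \<Longrightarrow> (\<Sum>e\<in>Basis. \<alpha> (raise g e) * \<nu> [e, u, v]) = \<nu> [sharp g \<alpha>, u, v]"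
  by (subst sharp_sum') (simp_all add: linear_sum[OF nu_linear(1)] nu_lin)

lemma hodge_two:
  "(\<Sum>e\<in>Basis. \<Sum>f\<in>Basis. \<nu> [a, raise g e, raise g f] * \<nu> [e, f, v]) = 2 * s * g [a, v]"
proof -
  have "\<nu> [e, f, v] = \<nu> [v, e, f]" for e f by (rule nu_cyc)
  then show ?thesis using contract_nu_2[of v a] by (simp add: mult.commute sym)
qed

text \<open>On two-forms the square of the Hodge star is \<open>s\<close>.\<close>

lemma self_dual_two_form:
  assumes \<omega>: "bilinear \<omega>" "\<And>u v. \<omega> u v = - \<omega> v u" and \<alpha>: "linear \<alpha>"
    and eq: "\<And>v. (\<Sum>e\<in>Basis. \<Sum>f\<in>Basis. \<omega> (raise g e) (raise g f) * \<nu> [e, f, v]) / 2 = \<alpha> v"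
  shows "\<omega> u v = s * \<nu> [sharp g \<alpha>, u, v]"
proof -
  have l: "linear (\<omega> x)" "linear (\<lambda>v. \<omega> v x)" for x using \<omega>(1) by (auto simp: bilinear_def)
  have "2 * \<nu> [sharp g \<alpha>, u, v] = (\<Sum>k\<in>Basis. 2 * \<alpha> (raise g k) * \<nu> [k, u, v])"
    unfolding hodge_one[OF \<alpha>, symmetric] sum_distrib_left by (simp add: mult.assoc)
  also have "\<dots> = (\<Sum>k\<in>Basis. (\<Sum>e\<in>Basis. \<Sum>f\<in>Basis. \<omega> (raise g e) (raise g f) * \<nu> [e, f, raise g k]) * \<nu> [k, u, v])"
    by (simp add: eq[symmetric])
  also have "\<dots> = (\<Sum>e\<in>Basis. \<Sum>f\<in>Basis. \<omega> (raise g e) (raise g f) * (\<Sum>k\<in>Basis. \<nu> [u, v, k] * \<nu> [e, f, raise g k]))"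
  proof -
    have sw: "(\<Sum>k\<in>Basis. \<Sum>e\<in>Basis. \<Sum>f\<in>Basis. T k e f) = (\<Sum>e\<in>Basis. \<Sum>f\<in>Basis. \<Sum>k\<in>Basis. T k e f)"
      for T :: "'e \<Rightarrow> 'e \<Rightarrow> 'e \<Rightarrow> real"
      by (rule trans[OF sum.swap]) (rule sum.cong[OF refl], rule sum.swap)
    have "\<nu> [k, u, v] = \<nu> [u, v, k]" for k by (rule nu_cyc[symmetric])
    then show ?thesis unfolding sum_distrib_right by (subst sw) (simp add: sum_distrib_left mult_ac)
  qed
  also have "\<dots> = s * ((\<Sum>e\<in>Basis. \<Sum>f\<in>Basis. g [e, u] * (g [f, v] * \<omega> (raise g e) (raise g f)))
      - (\<Sum>e\<in>Basis. \<Sum>f\<in>Basis. g [e, v] * (g [f, u] * \<omega> (raise g e) (raise g f))))"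
    unfolding contract_nu_1
    by (simp add: sym[of u] sym[of v] right_diff_distrib sum_subtractf sum_distrib_left mult_ac)
  also have "\<dots> = s * (\<omega> u v - \<omega> v u)"
    by (simp add: sum_distrib_left[symmetric] contract_raise(1)[OF l(1)] contract_raise(1)[OF l(2)])
  also have "\<dots> = s * (2 * \<omega> u v)" using \<omega>(2)[of v u] by simp
  finally have "s * \<nu> [sharp g \<alpha>, u, v] = (s * s) * \<omega> u v" by simp
  then show ?thesis by (simp add: s_square)
qed

text \<open>In the application \<open>B\<close> is the covariant derivative of \<open>a\<close>.
  Contraction with \<nu> sees only the antisymmetric part of \<open>B\<close>, which the hypothesis
  gives as \<open>s\<close> times \<nu> contracted with \<open>a\<close>; the contraction of two
  \<nu> contributes a second \<open>s\<close>, so the signature drops out.\<close>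

lemma tr_P_curl:
  assumes "linear B" "\<And>u v. g [B u, v] - g [B v, u] = s * \<nu> [a, u, v]"
  shows "tr (\<lambda>u. P (B u) w) = g [a, w]"
proof -
  define T where "T e v = g [B e, P w v]" for e v
  have bT: "bilinear T"
    unfolding T_def bilinear_def
    by (auto intro!: linearI simp: g_lin P_lin linear_add[OF assms(1)] linear_scale[OF assms(1)])
  have exp: "T e v = (\<Sum>f\<in>Basis. g [B e, f] * \<nu> [w, v, raise g f])" for e v
    using contract_raise(1)[OF lin_right[of "P w v"], of "B e"]
    by (simp add: T_def g_P sym[of "B e"])
  have "tr (\<lambda>u. P (B u) w) = (\<Sum>e\<in>Basis. T e (raise g e))"
    by (simp add: tr_raise T_def g_P nu_cyc[of w])
  then have 1: "tr (\<lambda>u. P (B u) w) = (\<Sum>e\<in>Basis. \<Sum>f\<in>Basis. g [B e, f] * \<nu> [w, raise g e, raise g f])"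
    by (simp add: exp)
  also have "\<dots> = (\<Sum>e\<in>Basis. \<Sum>f\<in>Basis. g [B f, e] * \<nu> [w, raise g f, raise g e])"
    by (rule sum.swap)
  \<comment> \<open>Exchanging the contracted slots of \<nu> costs a sign, so twice the trace is a
    contraction of \<nu> with the antisymmetrised \<open>B\<close>.\<close>
  also have "\<dots> = - (\<Sum>e\<in>Basis. \<Sum>f\<in>Basis. g [B f, e] * \<nu> [w, raise g e, raise g f])"
  proof -
    have m: "\<nu> [w, raise g f, raise g e] = - \<nu> [w, raise g e, raise g f]" for e f by (rule nu_swap23)
    have "(\<Sum>e\<in>Basis. \<Sum>f\<in>Basis. g [B f, e] * \<nu> [w, raise g f, raise g e]) =
        (\<Sum>e\<in>Basis. \<Sum>f\<in>Basis. g [B f, e] * - \<nu> [w, raise g e, raise g f])"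
      by (rule sum.cong[OF refl], rule sum.cong[OF refl]) (subst m, rule refl)
    then show ?thesis by (simp add: sum_negf)
  qed
  finally have "2 * tr (\<lambda>u. P (B u) w) =
      (\<Sum>e\<in>Basis. \<Sum>f\<in>Basis. (g [B e, f] - g [B f, e]) * \<nu> [w, raise g e, raise g f])"
    using 1 by (simp add: left_diff_distrib sum_subtractf)
  also have "\<dots> = s * (\<Sum>e\<in>Basis. \<Sum>f\<in>Basis. \<nu> [a, e, f] * \<nu> [w, raise g e, raise g f])"
    by (simp add: assms(2) sum_distrib_left mult.assoc)
  also have "\<dots> = 2 * (s * s) * g [a, w]"
    by (simp add: contract_nu_2)
  finally show ?thesis by (simp add: s_square)
qed

end

section \<open>Metrics in a chart\<close>

lemma DD_linear_param:
  assumes "open S" "x \<in> S" "\<And>y. y \<in> S \<Longrightarrow> linear (T y)" "\<And>w. (\<lambda>y. T y w) differentiable (at x)"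
  shows "linear (\<lambda>w. DD (\<lambda>y. T y w) x u)"
proof (rule linearI)
  fix v w :: 'b and r :: real
  have "DD (\<lambda>y. T y (v + w)) x = DD (\<lambda>y. T y v + T y w) x"
    by (rule DD_cong[OF assms(1,2)]) (use assms(3) linear_add in blast)
  then show "DD (\<lambda>y. T y (v + w)) x u = DD (\<lambda>y. T y v) x u + DD (\<lambda>y. T y w) x u"
    by (simp add: DD_add[OF assms(4) assms(4)])
  have "DD (\<lambda>y. T y (r *\<^sub>R v)) x = DD (\<lambda>y. r *\<^sub>R T y v) x"
    by (rule DD_cong[OF assms(1,2)]) (use assms(3) linear_scale in blast)
  then show "DD (\<lambda>y. T y (r *\<^sub>R v)) x u = r *\<^sub>R DD (\<lambda>y. T y v) x u"
    using DD_linear_comp[OF _ assms(4), of "\<lambda>z. r *\<^sub>R z"] by (simp add: linear_scale_self)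
qed

text \<open>Product rule for a linear map and a vector that both vary with the point. Expansion of
  the vector in the basis reduces it to derivatives at fixed arguments, which is the form in which
  smoothness of tensors is given.\<close>

lemma DD_linear_apply:
  fixes T :: "'e::euclidean_space \<Rightarrow> 'f::euclidean_space \<Rightarrow> 'g::euclidean_space"
  assumes "open S" "x \<in> S" "\<And>y. y \<in> S \<Longrightarrow> linear (T y)" "\<And>w. (\<lambda>y. T y w) differentiable (at x)"
    and f: "f differentiable (at x)"
  shows "(\<lambda>y. T y (f y)) differentiable (at x)"
    and "DD (\<lambda>y. T y (f y)) x u = DD (\<lambda>y. T y (f x)) x u + T x (DD f x u)"
proof -
  have rep: "T y w = (\<Sum>e\<in>Basis. (w \<bullet> e) *\<^sub>R T y e)" if "y \<in> S" for y w
    using linear_sum_basis[OF assms(3)[OF that], of w] by simp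
  have lin: "linear (\<lambda>z. z \<bullet> e)" for e :: 'f
    by (auto intro: linearI simp: inner_add_left)
  note fe = differentiable_linear_comp[OF lin f]
  have d: "(\<lambda>y. (f y \<bullet> e) *\<^sub>R T y e) differentiable (at x)" for e
    by (rule differentiable_scaleR_at[OF fe assms(4)])
  have "(\<lambda>y. \<Sum>e\<in>Basis. (f y \<bullet> e) *\<^sub>R T y e) differentiable (at x)"
    using d by (intro DD_sum(1)) auto
  then show "(\<lambda>y. T y (f y)) differentiable (at x)"
    using differentiable_cong_open[OF assms(1,2), of "\<lambda>y. T y (f y)" "\<lambda>y. \<Sum>e\<in>Basis. (f y \<bullet> e) *\<^sub>R T y e"]
      rep by blast
  have "DD (\<lambda>y. T y (f y)) x = DD (\<lambda>y. \<Sum>e\<in>Basis. (f y \<bullet> e) *\<^sub>R T y e) x"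
    by (rule DD_cong[OF assms(1,2)]) (use rep in blast)
  then have "DD (\<lambda>y. T y (f y)) x u = (\<Sum>e\<in>Basis. DD (\<lambda>y. (f y \<bullet> e) *\<^sub>R T y e) x u)"
    using d by (simp add: DD_sum(2))
  also have "\<dots> = (\<Sum>e\<in>Basis. (f x \<bullet> e) *\<^sub>R DD (\<lambda>y. T y e) x u) + (\<Sum>e\<in>Basis. (DD f x u \<bullet> e) *\<^sub>R T x e)"
    by (simp add: DD_scaleR[OF fe assms(4)] DD_linear_comp[OF lin f] sum.distrib)
  also have "(\<Sum>e\<in>Basis. (DD f x u \<bullet> e) *\<^sub>R T x e) = T x (DD f x u)"
    by (rule linear_sum_basis[OF assms(3)[OF assms(2)]])
  also have "(\<Sum>e\<in>Basis. (f x \<bullet> e) *\<^sub>R DD (\<lambda>y. T y e) x u) = DD (\<lambda>y. T y (f x)) x u"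
    by (rule linear_sum_basis[OF DD_linear_param[OF assms(1-4)]])
  finally show "DD (\<lambda>y. T y (f y)) x u = DD (\<lambda>y. T y (f x)) x u + T x (DD f x u)" .
qed

lemma smooth_on_transform:
  "open S \<Longrightarrow> smooth_on S f \<Longrightarrow> (\<And>x. x \<in> S \<Longrightarrow> f x = g x) \<Longrightarrow> smooth_on S g"
  using smooth_on_cong by blast

lemma smooth_on_linear_apply:
  assumes "open S" "\<And>y. y \<in> S \<Longrightarrow> linear (T y)" "\<And>w. smooth_on S (\<lambda>y. T y w)" "smooth_on S f"
  shows "smooth_on S (\<lambda>y. T y (f y))"
proof -
  have "smooth_on S (\<lambda>y. f y \<bullet> e)" for e
    by (rule smooth_on_linear[OF assms(1) _ assms(4)]) (auto intro: linearI simp: inner_add_left)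
  from smooth_on_sum[OF assms(1) smooth_on_scaleR[OF assms(1) this assms(3)]]
  have "smooth_on S (\<lambda>y. \<Sum>e\<in>Basis. (f y \<bullet> e) *\<^sub>R T y e)" .
  moreover have "(\<Sum>e\<in>Basis. (f y \<bullet> e) *\<^sub>R T y e) = T y (f y)" if "y \<in> S" for y
    using linear_sum_basis[OF assms(2)[OF that], of "f y"] by simp
  ultimately show ?thesis by (rule smooth_on_transform[OF assms(1)])
qed

locale metric_chart =
  fixes g :: "('i, 'e::euclidean_space) tensor" and i :: 'i and S :: "'e set"
  assumes open_S: "open S"
    and metric: "y \<in> S \<Longrightarrow> metric_form (g i y)"
    and smooth_g: "smooth_on S (\<lambda>y. g i y [u, v])"
begin

abbreviation \<Gamma> where "\<Gamma> \<equiv> levi_civita g i"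

lemma diff_g: "x \<in> S \<Longrightarrow> (\<lambda>y. g i y [u, v]) differentiable (at x)"
  using smooth_on_differentiable[OF smooth_g] .

text \<open>Linearity in \<open>w\<close> comes first because it makes the \<open>sharp\<close> in
  the definition of \<open>levi_civita\<close> meaningful; the second claim is then its defining
  property.\<close>

lemma koszul:
  assumes x: "x \<in> S"
  shows "linear (\<lambda>w. (DD (\<lambda>y. g i y [v, w]) x u + DD (\<lambda>y. g i y [u, w]) x v - DD (\<lambda>y. g i y [u, v]) x w) / 2)"
    and "g i x [\<Gamma> x u v, w] =
      (DD (\<lambda>y. g i y [v, w]) x u + DD (\<lambda>y. g i y [u, w]) x v - DD (\<lambda>y. g i y [u, v]) x w) / 2"
proof -
  have 1: "linear (\<lambda>w. DD (\<lambda>y. g i y [v, w]) x u)" for u v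
    using metric_form.lin_right[OF metric] diff_g[OF x]
    by (intro DD_linear_param[OF open_S x]) blast+
  have 2: "linear (DD (\<lambda>y. g i y [u, v]) x)"
    by (rule DD_linear[OF diff_g[OF x]])
  show L: "linear (\<lambda>w. (DD (\<lambda>y. g i y [v, w]) x u + DD (\<lambda>y. g i y [u, w]) x v - DD (\<lambda>y. g i y [u, v]) x w) / 2)"
    by (rule linearI) (simp_all add: linear_add[OF 1] linear_scale[OF 1] linear_add[OF 2] linear_scale[OF 2]
        add_divide_distrib diff_divide_distrib algebra_simps)
  from metric_form.sharp_works[OF metric[OF x] L]
  show "g i x [\<Gamma> x u v, w] =
      (DD (\<lambda>y. g i y [v, w]) x u + DD (\<lambda>y. g i y [u, w]) x v - DD (\<lambda>y. g i y [u, v]) x w) / 2"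
    by (simp add: levi_civita_def)
qed

lemma DD_g_sym: "x \<in> S \<Longrightarrow> DD (\<lambda>y. g i y [u, v]) x = DD (\<lambda>y. g i y [v, u]) x"
  by (rule DD_cong[OF open_S]) (auto intro: metric_form.sym metric)

lemma \<Gamma>_sym: 
  assumes x: "x \<in> S"
  shows "\<Gamma> x u v = \<Gamma> x v u"
proof (rule metric_form.eqI[OF metric[OF x]])
  show "g i x [\<Gamma> x u v, w] = g i x [\<Gamma> x v u, w]" for w
    using DD_g_sym[OF x, of u v] by (simp add: koszul(2)[OF x])
qed

lemma DD_g: 
  assumes x: "x \<in> S"
  shows "DD (\<lambda>y. g i y [v, w]) x u = g i x [\<Gamma> x u v, w] + g i x [v, \<Gamma> x u w]"
  unfolding metric_form.sym[OF metric[OF x], of v] koszul(2)[OF x]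
    DD_g_sym[OF x, of w v] DD_g_sym[OF x, of w u] DD_g_sym[OF x, of v u]
  by (simp add: field_simps)

lemma bilinear_\<Gamma>:
  assumes x: "x \<in> S"
  shows "bilinear (\<Gamma> x)"
proof -
  interpret metric_form "g i x" by (rule metric[OF x])
  have 1: "linear (\<lambda>v. DD (\<lambda>y. g i y [v, w]) x u)" for u w
    using metric_form.lin_left[OF metric] diff_g[OF x]
    by (intro DD_linear_param[OF open_S x]) blast+
  have 2: "linear (DD (\<lambda>y. g i y [u, v]) x)" for u v
    by (rule DD_linear[OF diff_g[OF x]])
  have "linear (\<Gamma> x u)" for u
    by (rule linearI; rule eqI)
      (simp_all add: g_lin koszul(2)[OF x] linear_add[OF 1] linear_scale[OF 1] linear_add[OF 2] linear_scale[OF 2]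
        DD_g_sym[OF x, of u] algebra_simps add_divide_distrib diff_divide_distrib)
  then show ?thesis
    unfolding bilinear_def using \<Gamma>_sym[OF x] by presburger
qed

text \<open>Smoothness of the inverse metric enters as a hypothesis. In dimension three
  \<open>smooth_raise\<close> supplies it by Cramer's rule; on the product everything is reduced to
  the factors through \<open>sharp_gM\<close>.\<close>

lemma smooth_sharp:
  assumes r: "\<And>e. e \<in> Basis \<Longrightarrow> smooth_on S (\<lambda>y. raise (g i y) e)"
    and "\<And>y. y \<in> S \<Longrightarrow> linear (\<phi> y)" "\<And>v. smooth_on S (\<lambda>y. \<phi> y v)"
  shows "smooth_on S (\<lambda>y. sharp (g i y) (\<phi> y))"
proof -
  have "smooth_on S (\<lambda>y. \<Sum>e\<in>Basis. \<phi> y e *\<^sub>R raise (g i y) e)"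
    by (intro smooth_on_sum open_S smooth_on_scaleR assms)
  moreover have "(\<Sum>e\<in>Basis. \<phi> y e *\<^sub>R raise (g i y) e) = sharp (g i y) (\<phi> y)" if "y \<in> S" for y
    using metric_form.sharp_sum[OF metric[OF that] assms(2)[OF that]] by simp
  ultimately show ?thesis by (rule smooth_on_transform[OF open_S])
qed

text \<open>Raising an index commutes with \<nabla>, because the metric is parallel: the right side
  is (\<nabla>_u \<phi>)(v). The proof differentiates the defining equation of
  \<open>sharp\<close>.\<close>

lemma DD_sharp:
  assumes x: "x \<in> S" and "\<And>y. y \<in> S \<Longrightarrow> linear (\<phi> y)" "(\<lambda>y. sharp (g i y) (\<phi> y)) differentiable (at x)"
  shows "g i x [DD (\<lambda>y. sharp (g i y) (\<phi> y)) x u + \<Gamma> x u (sharp (g i x) (\<phi> x)), v] =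
    DD (\<lambda>y. \<phi> y v) x u - \<phi> x (\<Gamma> x u v)"
proof -
  interpret metric_form "g i x" by (rule metric[OF x])
  have "DD (\<lambda>y. \<phi> y v) x = DD (\<lambda>y. g i y [sharp (g i y) (\<phi> y), v]) x"
    by (rule DD_cong[OF open_S x]) (use metric_form.sharp_works[OF metric assms(2)] in simp)
  then have "DD (\<lambda>y. \<phi> y v) x u = DD (\<lambda>y. g i y [sharp (g i y) (\<phi> y), v]) x u" by simp
  also have "\<dots> = DD (\<lambda>y. g i y [sharp (g i x) (\<phi> x), v]) x u + g i x [DD (\<lambda>y. sharp (g i y) (\<phi> y)) x u, v]"
    using metric_form.lin_left[OF metric] diff_g[OF x] assms(3)
    by (intro DD_linear_apply(2)[OF open_S x, where T = "\<lambda>y p. g i y [p, v]"]) blast+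
  finally show ?thesis
    by (simp add: DD_g[OF x] g_lin sharp_works[OF assms(2)[OF x]])
qed

end

section \<open>A contact form in one chart\<close>

text \<open>\<open>alpha_hodge\<close> is \<alpha> = \<ast>d\<alpha> written out in the chart: the
  difference of derivatives is d\<alpha> on raised basis vectors and the division by 2 is the 1/2!
  of the Hodge star.\<close>

locale chart3 = metric_chart g i S
  for g :: "('i, 'e::euclidean_space) tensor" and i :: 'i and S :: "'e set" +
  fixes \<nu> :: "('i, 'e) tensor" and s :: real and \<alpha> :: "('i, 'e) tensor"
  assumes form3: "y \<in> S \<Longrightarrow> oriented_form3 (g i y) (\<nu> i y) s"
    and smooth_nu: "smooth_on S (\<lambda>y. \<nu> i y [u, v, w])"
    and linear_alpha: "y \<in> S \<Longrightarrow> linear (\<lambda>v. \<alpha> i y [v])"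
    and smooth_alpha: "smooth_on S (\<lambda>y. \<alpha> i y [v])"
    and alpha_hodge: "y \<in> S \<Longrightarrow>
      (\<Sum>e\<in>Basis. \<Sum>f\<in>Basis. (DD (\<lambda>z. \<alpha> i z [raise (g i y) f]) y (raise (g i y) e)
          - DD (\<lambda>z. \<alpha> i z [raise (g i y) e]) y (raise (g i y) f)) * \<nu> i y [e, f, v]) / 2 = \<alpha> i y [v]"
begin

text \<open>Cramer's rule. With the standard basis written as e, a, b, the functions
  \<open>c1\<close>, \<open>c2\<close>, \<open>c3\<close> are the cofactors of the row of
  \<open>e\<close> in the matrix of the metric, and \<open>d\<close> is its determinant.\<close>

lemma smooth_raise:
  assumes e: "e \<in> Basis"
  shows "smooth_on S (\<lambda>y. raise (g i y) e)"
proof -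
  show ?thesis
  proof (cases "S = {}")
    \<comment> \<open>A chart image may be empty; the dimension is known here only through a point
      of \<open>S\<close>, by \<open>form3\<close>.\<close>
    case True
    have "Ck_on k {} f" for k and f :: "'e \<Rightarrow> 'e" by (induction k arbitrary: f) auto
    then show ?thesis by (simp add: True smooth_on_def)
  next
    case False
    then obtain y0 where y0: "y0 \<in> S" by blast
    have "card (Basis - {e}) = 2"
      using oriented_form3.dim3[OF form3[OF y0]] e by simp
    then obtain a b where ab: "Basis - {e} = {a, b}" "a \<noteq> b" by (auto simp: card_2_iff)
    have B: "Basis = {e, a, b}" "a \<in> Basis" "b \<in> Basis" "e \<noteq> a" "e \<noteq> b" using e ab by auto
    define c1 where "c1 y = g i y [a, a] * g i y [b, b] - g i y [a, b] * g i y [a, b]" for y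
    define c2 where "c2 y = g i y [e, b] * g i y [a, b] - g i y [e, a] * g i y [b, b]" for y
    define c3 where "c3 y = g i y [e, a] * g i y [a, b] - g i y [e, b] * g i y [a, a]" for y
    define d where "d y = g i y [e, e] * c1 y + g i y [e, a] * c2 y + g i y [e, b] * c3 y" for y
    have d: "d y \<noteq> 0" if "y \<in> S" for y
    proof -
      interpret oriented_form3 "g i y" "\<nu> i y" s by (rule form3[OF that])
      \<comment> \<open>The basis paired with the raised basis gives the identity matrix, so this
        product is \<open>s\<close> and \<nu>(e, a, b) is nonzero; its square is \<open>s\<close>
        times \<open>d\<close>.\<close>
      have "\<nu> i y [e, a, b] * \<nu> i y [raise (g i y) e, raise (g i y) a, raise (g i y) b] = s"
        unfolding gram using B e ab(2) by (auto simp: raise_works inner_Basis)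
      then have "\<nu> i y [e, a, b] * \<nu> i y [e, a, b] \<noteq> 0" using s_square by auto
      moreover have "\<nu> i y [e, a, b] * \<nu> i y [e, a, b] = s * d y"
        unfolding gram d_def c1_def c2_def c3_def sym[of b e] sym[of b a] sym[of a e] by (simp add: algebra_simps)
      ultimately show ?thesis by auto
    qed
    define r where "r y = inverse (d y) *\<^sub>R (c1 y *\<^sub>R e + c2 y *\<^sub>R a + c3 y *\<^sub>R b)" for y
    have "raise (g i y) e = r y" if y: "y \<in> S" for y
      unfolding raise_def
    proof (rule metric_form.sharp_unique[OF metric[OF y]])
      fix v
      interpret metric_form "g i y" by (rule metric[OF y])
      have "g i y [r y, e] = 1"
        using d[OF y] unfolding r_def g_lin sym[of a e] sym[of b e] by (simp add: d_def algebra_simps field_simps)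
      moreover have "g i y [r y, a] = 0"
        unfolding r_def g_lin sym[of b a] c1_def c2_def c3_def by (simp add: algebra_simps)
      moreover have "g i y [r y, b] = 0"
        unfolding r_def g_lin c1_def c2_def c3_def by (simp add: algebra_simps)
      moreover have "(\<Sum>f\<in>Basis. (v \<bullet> f) *\<^sub>R g i y [r y, f]) = g i y [r y, v]"
        by (rule linear_sum_basis[OF lin_right])
      ultimately show "g i y [r y, v] = v \<bullet> e"
        using B(4,5) ab(2) unfolding B(1) by simp
    qed
    moreover have "smooth_on S c1" "smooth_on S c2" "smooth_on S c3"
      unfolding c1_def c2_def c3_def by (intro open_S smooth_on_diff smooth_on_mult smooth_g)+
    then have "smooth_on S r"
      unfolding r_def d_def using d[unfolded d_def]
      by (intro open_S smooth_on_scaleR smooth_on_inverse smooth_on_add smooth_on_mult smooth_g smooth_on_const)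
    ultimately show ?thesis using smooth_on_cong[OF open_S, of "\<lambda>y. raise (g i y) e" r] by simp
  qed
qed

abbreviation cross where "cross y \<equiv> oriented_form3.P (g i y) (\<nu> i y)"

definition a where "a y = sharp (g i y) (\<lambda>v. \<alpha> i y [v])"

text \<open>The covariant derivative of \<open>a\<close> in the direction \<open>u\<close>; its
  trace is the divergence of \<open>a\<close>.\<close>

definition B where "B x u = DD a x u + \<Gamma> x u (a x)"

definition F where "F y v w = \<nu> i y [a y, v, w]"

lemma smooth_\<Gamma>: "smooth_on S (\<lambda>y. \<Gamma> y u v)"
  unfolding levi_civita_def
proof (rule smooth_sharp[OF smooth_raise])
  show "smooth_on S (\<lambda>y. (DD (\<lambda>y. g i y [v, w]) y u + DD (\<lambda>y. g i y [u, w]) y v - DD (\<lambda>y. g i y [u, v]) y w) / 2)" for w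
    by (intro smooth_on_linear[of S "\<lambda>x. x / 2"] smooth_on_diff smooth_on_add smooth_on_DD smooth_g open_S)
      (auto intro: linearI simp: add_divide_distrib)
qed (use koszul(1) in auto)

lemma smooth_a: "smooth_on S a"
  unfolding a_def by (rule smooth_sharp[OF smooth_raise]) (auto simp: linear_alpha smooth_alpha)

lemma smooth_P: "smooth_on S (\<lambda>y. cross y u v)"
proof -
  have "smooth_on S (\<lambda>y. sharp (g i y) (\<lambda>w. \<nu> i y [u, v, w]))"
    by (rule smooth_sharp[OF smooth_raise]) (auto simp: smooth_nu oriented_form3.nu_linear[OF form3])
  then show ?thesis
    using smooth_on_cong[OF open_S, of "\<lambda>y. cross y u v"] oriented_form3.P_def[OF form3] by simp
qed

lemma smooth_Pa: "smooth_on S (\<lambda>y. cross y (a y) w)"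
  by (rule smooth_on_linear_apply[OF open_S _ smooth_P smooth_a]) (rule oriented_form3.linear_P(2)[OF form3])

lemma smooth_F: "smooth_on S (\<lambda>y. F y u v)"
  unfolding F_def
  by (rule smooth_on_linear_apply[OF open_S _ smooth_nu smooth_a]) (rule oriented_form3.nu_linear(1)[OF form3])

lemmas diff_a = smooth_on_differentiable[OF smooth_a]
lemmas diff_P = smooth_on_differentiable[OF smooth_P]
lemmas diff_Pa = smooth_on_differentiable[OF smooth_Pa]
lemmas diff_F = smooth_on_differentiable[OF smooth_F]
lemmas diff_nu = smooth_on_differentiable[OF smooth_nu]
lemmas diff_alpha = smooth_on_differentiable[OF smooth_alpha]
lemmas diff_\<Gamma> = smooth_on_differentiable[OF smooth_\<Gamma>]

lemma g_a: "y \<in> S \<Longrightarrow> g i y [a y, v] = \<alpha> i y [v]"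
  unfolding a_def by (rule metric_form.sharp_works[OF metric linear_alpha])

lemma g_B: "x \<in> S \<Longrightarrow> g i x [B x u, v] = DD (\<lambda>y. \<alpha> i y [v]) x u - \<alpha> i x [\<Gamma> x u v]"
  using DD_sharp[of x "\<lambda>y v. \<alpha> i y [v]" u v] diff_a[of x] linear_alpha
  unfolding B_def a_def by simp

lemma linear_B: "x \<in> S \<Longrightarrow> linear (B x)"
  using DD_linear[OF diff_a, of x] bilinear_\<Gamma>[of x]
  unfolding B_def bilinear_def by (intro linear_compose_add) auto

text \<open>Differentiating the Gram identity shows that the volume form is parallel: the derivatives
  of its two factors cancel, and one of them may be kept nonzero.\<close>

lemma DD_nu:
  assumes x: "x \<in> S"
  shows "DD (\<lambda>y. \<nu> i y [v, w, z]) x u =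
    \<nu> i x [\<Gamma> x u v, w, z] + \<nu> i x [v, \<Gamma> x u w, z] + \<nu> i x [v, w, \<Gamma> x u z]"
proof -
  interpret oriented_form3 "g i x" "\<nu> i x" s by (rule form3[OF x])
  define K where "K v w z = DD (\<lambda>y. \<nu> i y [v, w, z]) x u
      - (\<nu> i x [\<Gamma> x u v, w, z] + \<nu> i x [v, \<Gamma> x u w, z] + \<nu> i x [v, w, \<Gamma> x u z])" for v w z
  have K: "K v w z * \<nu> i x [p, q, r] + \<nu> i x [v, w, z] * K p q r = 0" for v w z p q r
  proof -
    have hd: "((\<lambda>y. g i y [v, w]) has_derivative (\<lambda>u. g i x [\<Gamma> x u v, w] + g i x [v, \<Gamma> x u w])) (at x)" for v w
    proof -
      have "DD (\<lambda>y. g i y [v, w]) x = (\<lambda>u. g i x [\<Gamma> x u v, w] + g i x [v, \<Gamma> x u w])"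
        by (rule ext) (rule DD_g[OF x])
      then show ?thesis using DD_works[OF diff_g[OF x, of v w]] by simp
    qed
    have "DD (\<lambda>y. \<nu> i y [v, w, z] * \<nu> i y [p, q, r]) x = DD (\<lambda>y. s * (g i y [v, p] * g i y [w, q] * g i y [z, r]
        + g i y [v, q] * g i y [w, r] * g i y [z, p] + g i y [v, r] * g i y [w, p] * g i y [z, q]
        - g i y [v, p] * g i y [w, r] * g i y [z, q] - g i y [v, q] * g i y [w, p] * g i y [z, r]
        - g i y [v, r] * g i y [w, q] * g i y [z, p])) x" (is "?l = ?r")
      by (rule DD_cong[OF open_S x]) (rule oriented_form3.gram[OF form3])
    moreover have "?l u = DD (\<lambda>y. \<nu> i y [v, w, z]) x u * \<nu> i x [p, q, r] + \<nu> i x [v, w, z] * DD (\<lambda>y. \<nu> i y [p, q, r]) x u"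
      by (simp add: DD_mult[OF diff_nu[OF x] diff_nu[OF x]])
    moreover have "?r u = (\<nu> i x [\<Gamma> x u v, w, z] + \<nu> i x [v, \<Gamma> x u w, z] + \<nu> i x [v, w, \<Gamma> x u z]) * \<nu> i x [p, q, r]
        + \<nu> i x [v, w, z] * (\<nu> i x [\<Gamma> x u p, q, r] + \<nu> i x [p, \<Gamma> x u q, r] + \<nu> i x [p, q, \<Gamma> x u r])"
      by (subst DD_eq, (rule derivative_eq_intros hd refl)+)
        (simp only: distrib_left distrib_right gram, simp add: algebra_simps)
    ultimately show ?thesis unfolding K_def by (simp add: algebra_simps)
  qed
  obtain p q r where n: "\<nu> i x [p, q, r] \<noteq> 0" using nu_nonzero by blast
  have "K p q r = 0" using K[of p q r p q r] n by simp
  with K[of v w z p q r] n have "K v w z = 0" by simp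
  then show ?thesis by (simp add: K_def)
qed

text \<open>The cross product is parallel: it is the volume form with its last index raised, and
  raising commutes with \<nabla> by \<open>DD_sharp\<close>.\<close>

lemma DD_P:
  assumes x: "x \<in> S"
  shows "DD (\<lambda>y. cross y v w) x u = cross x (\<Gamma> x u v) w + cross x v (\<Gamma> x u w) - \<Gamma> x u (cross x v w)"
proof -
  interpret oriented_form3 "g i x" "\<nu> i x" s by (rule form3[OF x])
  \<comment> \<open>The defining equation of \<open>cross\<close> is available only at points of
    \<open>S\<close>, so the derivative is taken of the bare \<open>sharp\<close> expression, to
    which \<open>DD_sharp\<close> applies.\<close>
  define Q where "Q y = sharp (g i y) (\<lambda>z. \<nu> i y [v, w, z])" for y
  have Q: "cross y v w = Q y" if "y \<in> S" for y
    using oriented_form3.P_def[OF form3[OF that]] by (simp add: Q_def)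
  have D: "DD (\<lambda>y. cross y v w) x = DD Q x"
    by (rule DD_cong[OF open_S x Q])
  have diff: "Q differentiable (at x)"
    using diff_P[OF x] differentiable_cong_open[OF open_S x, of "\<lambda>y. cross y v w" Q] Q by blast
  have "DD Q x u + \<Gamma> x u (Q x) = cross x (\<Gamma> x u v) w + cross x v (\<Gamma> x u w)"
  proof (rule eqI)
    fix z
    have "g i x [DD Q x u + \<Gamma> x u (Q x), z] = DD (\<lambda>y. \<nu> i y [v, w, z]) x u - \<nu> i x [v, w, \<Gamma> x u z]"
      using DD_sharp[OF x, of "\<lambda>y z. \<nu> i y [v, w, z]" u z] oriented_form3.nu_linear[OF form3] diff
      unfolding Q_def by blast
    then show "g i x [DD Q x u + \<Gamma> x u (Q x), z] = g i x [cross x (\<Gamma> x u v) w + cross x v (\<Gamma> x u w), z]"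
      by (simp add: DD_nu[OF x] g_lin g_P)
  qed
  then show ?thesis unfolding D Q[OF x] by (simp add: algebra_simps)
qed

lemma DD_Pa:
  assumes x: "x \<in> S"
  shows "DD (\<lambda>y. cross y (a y) w) x u = cross x (B x u) w + cross x (a x) (\<Gamma> x u w) - \<Gamma> x u (cross x (a x) w)"
proof -
  interpret oriented_form3 "g i x" "\<nu> i x" s by (rule form3[OF x])
  have "DD (\<lambda>y. cross y (a y) w) x u = DD (\<lambda>y. cross y (a x) w) x u + cross x (DD a x u) w"
    using oriented_form3.linear_P(2)[OF form3] diff_P[OF x] diff_a[OF x]
    by (intro DD_linear_apply(2)[OF open_S x, where T = "\<lambda>y p. cross y p w"]) blast+
  then show ?thesis by (simp add: DD_P[OF x] B_def P_lin)
qed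

lemma DD_F:
  assumes x: "x \<in> S"
  shows "DD (\<lambda>y. F y v w) x u = \<nu> i x [B x u, v, w] + F x (\<Gamma> x u v) w + F x v (\<Gamma> x u w)"
proof -
  interpret oriented_form3 "g i x" "\<nu> i x" s by (rule form3[OF x])
  have "DD (\<lambda>y. F y v w) x u = DD (\<lambda>y. \<nu> i y [a x, v, w]) x u + \<nu> i x [DD a x u, v, w]"
    unfolding F_def using oriented_form3.nu_linear(1)[OF form3] diff_nu[OF x] diff_a[OF x]
    by (intro DD_linear_apply(2)[OF open_S x, where T = "\<lambda>y p. \<nu> i y [p, v, w]"]) blast+
  then show ?thesis by (simp add: DD_nu[OF x] B_def F_def nu_lin)
qed

text \<open>The Hodge star in \<alpha> = \<ast>d\<alpha> is inverted by
  \<open>self_dual_two_form\<close>.\<close>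

lemma d_alpha:
  assumes x: "x \<in> S"
  shows "DD (\<lambda>y. \<alpha> i y [v]) x u - DD (\<lambda>y. \<alpha> i y [u]) x v = s * F x u v"
proof -
  interpret oriented_form3 "g i x" "\<nu> i x" s by (rule form3[OF x])
  define \<omega> where "\<omega> u v = DD (\<lambda>y. \<alpha> i y [v]) x u - DD (\<lambda>y. \<alpha> i y [u]) x v" for u v
  have l: "linear (\<lambda>v. DD (\<lambda>y. \<alpha> i y [v]) x u)" for u
    using linear_alpha diff_alpha[OF x] by (intro DD_linear_param[OF open_S x]) blast+
  have l': "linear (DD (\<lambda>y. \<alpha> i y [v]) x)" for v
    by (rule DD_linear[OF diff_alpha[OF x]])
  have "bilinear \<omega>"
    unfolding bilinear_def \<omega>_def using l l' by (auto intro!: linear_compose_sub)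
  then have "\<omega> u v = s * \<nu> i x [sharp (g i x) (\<lambda>v. \<alpha> i x [v]), u, v]"
    by (rule self_dual_two_form[OF _ _ linear_alpha[OF x]])
      (use alpha_hodge[OF x] in \<open>auto simp: \<omega>_def\<close>)
  then show ?thesis by (simp add: \<omega>_def F_def a_def)
qed

text \<open>Since s^2 = 1, F is s d\<alpha> on all of \<open>S\<close>, and the claim becomes the
  symmetry of second derivatives.\<close>

lemma d_F:
  assumes x: "x \<in> S"
  shows "DD (\<lambda>y. F y v w) x u - DD (\<lambda>y. F y u w) x v + DD (\<lambda>y. F y u v) x w = 0"
proof -
  have ss: "s * s = 1" by (rule oriented_form3.s_square[OF form3[OF x]])
  define h where "h u v w = DD (\<lambda>y. DD (\<lambda>z. \<alpha> i z [w]) y v) x u" for u v w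
  have F: "F y u v = s * (DD (\<lambda>z. \<alpha> i z [v]) y u - DD (\<lambda>z. \<alpha> i z [u]) y v)" if "y \<in> S" for y u v
    unfolding d_alpha[OF that] using ss by (simp add: mult.assoc[symmetric])
  have dd: "(\<lambda>y. DD (\<lambda>z. \<alpha> i z [v]) y u) differentiable (at x)" for u v
    by (rule smooth_on_differentiable[OF smooth_on_DD[OF smooth_alpha] x])
  have "DD (\<lambda>y. F y v w) x = DD (\<lambda>y. s * (DD (\<lambda>z. \<alpha> i z [w]) y v - DD (\<lambda>z. \<alpha> i z [v]) y w)) x" for v w
    by (rule DD_cong[OF open_S x F])
  then have e: "DD (\<lambda>y. F y v w) x u = s * (h u v w - h u w v)" for u v w
    using dd by (simp add: DD_cmult DD_diff h_def)
  have hs: "h u v w = h v u w" for u v w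
    unfolding h_def by (rule DD_symmetric[OF open_S x smooth_alpha])
  show ?thesis
    unfolding e by (simp add: hs[of u v w] hs[of u w v] hs[of v w u] algebra_simps)
qed

text \<open>dF is (div a) \<nu>: the symmetry of \<Gamma> removes the Christoffel terms from the
  alternating sum, and by \<open>tr_nu\<close> the three insertions of \<open>B\<close> into \<nu>
  add up to its trace.\<close>

lemma tr_B:
  assumes x: "x \<in> S"
  shows "tr (B x) = 0"
proof -
  interpret oriented_form3 "g i x" "\<nu> i x" s by (rule form3[OF x])
  obtain u v w where n: "\<nu> i x [u, v, w] \<noteq> 0" using nu_nonzero by blast
  have sk: "F x p q = - F x q p" for p q unfolding F_def by (rule nu_swap23)
  have "\<nu> i x [B x u, v, w] - \<nu> i x [B x v, u, w] + \<nu> i x [B x w, u, v] = 0"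
    using d_F[OF x, of v w u] sk[of "\<Gamma> x w u" v] sk[of u "\<Gamma> x w v"] sk[of u "\<Gamma> x v w"] sk[of "\<Gamma> x u v" w]
      \<Gamma>_sym[OF x, of u v] \<Gamma>_sym[OF x, of w v] \<Gamma>_sym[OF x, of w u]
      sk[of v "\<Gamma> x u w"] by (simp add: DD_F[OF x])
  then have "tr (B x) * \<nu> i x [u, v, w] = 0"
    unfolding tr_nu[OF linear_B[OF x], symmetric]
    using nu_swap12[of "B x v" u w] nu_cyc[of u v "B x w"] by simp
  then show ?thesis using n by simp
qed

lemma tr_PB:
  assumes x: "x \<in> S"
  shows "tr (\<lambda>u. cross x (B x u) w) = \<alpha> i x [w]"
proof -
  interpret oriented_form3 "g i x" "\<nu> i x" s by (rule form3[OF x])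
  have "g i x [B x u, v] - g i x [B x v, u] = s * \<nu> i x [a x, u, v]" for u v
    using d_alpha[OF x, of v u] \<Gamma>_sym[OF x, of u v] by (simp add: g_B[OF x] F_def)
  then have "tr (\<lambda>u. cross x (B x u) w) = g i x [a x, w]"
    by (rule tr_P_curl[OF linear_B[OF x]])
  then show ?thesis by (simp add: g_a[OF x])
qed

text \<open>By \<open>DD_nu\<close> and \<open>tr_nu\<close> each derivative is tr(\<Gamma>_u) times
  \<nu>. The alternating sum over four vectors of a linear functional times \<nu> vanishes in
  dimension three.\<close>

lemma d_nu:
  assumes x: "x \<in> S"
  shows "DD (\<lambda>y. \<nu> i y [v, w, z]) x u - DD (\<lambda>y. \<nu> i y [u, w, z]) x v
    + DD (\<lambda>y. \<nu> i y [u, v, z]) x w - DD (\<lambda>y. \<nu> i y [u, v, w]) x z = 0"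
proof -
  interpret oriented_form3 "g i x" "\<nu> i x" s by (rule form3[OF x])
  have lu: "linear (\<Gamma> x u)" for u using bilinear_\<Gamma>[OF x] by (auto simp: bilinear_def)
  have l: "linear (\<lambda>u. tr (\<Gamma> x u))"
    unfolding tr_def
    by (rule linearI) (simp_all add: bilinear_ladd[OF bilinear_\<Gamma>[OF x]] bilinear_lmul[OF bilinear_\<Gamma>[OF x]]
        inner_add_left sum.distrib sum_distrib_left)
  have "DD (\<lambda>y. \<nu> i y [v, w, z]) x u = tr (\<Gamma> x u) * \<nu> i x [v, w, z]" for u v w z
    by (simp add: DD_nu[OF x] tr_nu[OF lu])
  then show ?thesis using four_vectors_linear[OF l, of u v w z] by simp
qed

end

section \<open>Connections with skew torsion on a product\<close>

lemma sum_Basis_prod: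
  "(\<Sum>b\<in>(Basis :: ('e::euclidean_space \<times> 'f::euclidean_space) set). f b) =
    (\<Sum>e\<in>Basis. f (e, 0)) + (\<Sum>e\<in>Basis. f (0, e))"
proof -
  have "(\<Sum>b\<in>(Basis :: ('e \<times> 'f) set). f b) =
      (\<Sum>b\<in>(\<lambda>u. (u, 0)) ` Basis. f b) + (\<Sum>b\<in>(\<lambda>v. (0, v)) ` Basis. f b)"
    unfolding Basis_prod_def by (rule sum.union_disjoint) auto
  then show ?thesis by (simp add: sum.reindex inj_on_def)
qed

lemma tr_prod:
  "tr (L :: 'e::euclidean_space \<times> 'f::euclidean_space \<Rightarrow> _) =
    tr (\<lambda>u. fst (L (u, 0))) + tr (\<lambda>u. snd (L (0, u)))"
  by (simp add: tr_def sum_Basis_prod inner_prod_def)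

lemma ricci_tr: "ricci C i x [v, w] = tr (\<lambda>u. curvature C i x u v w)"
  by (simp add: ricci_def tr_def)

lemma DD_partial:
  assumes "f differentiable (at (x, y))"
  shows "DD f (x, y) (u, 0) = DD (\<lambda>z. f (z, y)) x u"
    and "DD f (x, y) (0, w) = DD (\<lambda>z. f (x, z)) y w"
proof -
  have h1: "((\<lambda>z. (z, y)) has_derivative (\<lambda>u. (u, 0))) (at x)"
    and h2: "((\<lambda>z. (x, z)) has_derivative (\<lambda>u. (0, u))) (at y)"
    by (auto intro!: derivative_eq_intros)
  have 1: "(\<lambda>z. (z, y)) differentiable (at x)" "DD (\<lambda>z. (z, y)) x = (\<lambda>u. (u, 0))"
    using h1 DD_eq[OF h1] unfolding differentiable_def by blast+
  have 2: "(\<lambda>z. (x, z)) differentiable (at y)" "DD (\<lambda>z. (x, z)) y = (\<lambda>u. (0, u))"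
    using h2 DD_eq[OF h2] unfolding differentiable_def by blast+
  show "DD f (x, y) (u, 0) = DD (\<lambda>z. f (z, y)) x u"
    using DD_compose(2)[OF assms 1(1), of u] 1(2) by simp
  show "DD f (x, y) (0, w) = DD (\<lambda>z. f (x, z)) y w"
    using DD_compose(2)[OF assms 2(1), of w] 2(2) by simp
qed

lemma DD_map_prod:
  assumes "f differentiable (at (fst p))" "f' differentiable (at (snd p))"
  shows "DD (\<lambda>p. (f (fst p), f' (snd p))) p = (\<lambda>v. (DD f (fst p) (fst v), DD f' (snd p) (snd v)))"
proof (rule DD_eq)
  have "(f \<circ> fst has_derivative (DD f (fst p) \<circ> fst)) (at p)"
    using has_derivative_fst[OF has_derivative_ident] DD_works[OF assms(1)] by (rule diff_chain_at)
  moreover have "(f' \<circ> snd has_derivative (DD f' (snd p) \<circ> snd)) (at p)"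
    using has_derivative_snd[OF has_derivative_ident] DD_works[OF assms(2)] by (rule diff_chain_at)
  ultimately show "((\<lambda>p. (f (fst p), f' (snd p))) has_derivative (\<lambda>v. (DD f (fst p) (fst v), DD f' (snd p) (snd v)))) (at p)"
    by (auto simp: o_def intro: has_derivative_Pair)
qed

text \<open>The curvature splits into that of \<open>G\<close>, terms linear in the covariant
  derivative of \<open>A\<close>, and terms quadratic in \<open>A\<close>. The map sending u to A(u,
  w) is traceless, which disposes of half of the linear and half of the quadratic terms; the
  divergence and tr(A_v A_w) remain.\<close>

lemma ricci_skew_torsion:
  assumes S: "open S" "x \<in> S"
    and C: "\<And>y u v. y \<in> S \<Longrightarrow> C i y u v = G i y u v + (1 / 2) *\<^sub>R A y u v"
    and dG: "\<And>u v. (\<lambda>y. G i y u v) differentiable (at x)"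
    and dA: "\<And>u v. (\<lambda>y. A y u v) differentiable (at x)"
    and bG: "bilinear (G i x)" and sG: "\<And>u v. G i x u v = G i x v u"
    and bA: "bilinear (A x)" and sA: "\<And>u v. A x u v = - A x v u"
    and tA: "\<And>y w. y \<in> S \<Longrightarrow> tr (\<lambda>u. A y u w) = 0"
  shows "ricci C i x [v, w] = ricci G i x [v, w]
    + (1 / 2) * tr (\<lambda>u. DD (\<lambda>y. A y v w) x u + G i x u (A x v w) - A x (G i x u v) w - A x v (G i x u w))
    + (1 / 4) * tr (\<lambda>u. A x v (A x w u))"
proof -
  note bl = bilinear_ladd[OF bG] bilinear_radd[OF bG] bilinear_lmul[OF bG] bilinear_rmul[OF bG]
    bilinear_ladd[OF bA] bilinear_radd[OF bA] bilinear_lmul[OF bA] bilinear_rmul[OF bA]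
  have lA: "linear (A x u)" and lG: "linear (G i x u)" for u
    using bA bG by (auto simp: bilinear_def)
  have DC: "DD (\<lambda>y. C i y v w) x u = DD (\<lambda>y. G i y v w) x u + (1 / 2) *\<^sub>R DD (\<lambda>y. A y v w) x u" for u v w
  proof -
    have "DD (\<lambda>y. C i y v w) x = DD (\<lambda>y. G i y v w + (1 / 2) *\<^sub>R A y v w) x"
      by (rule DD_cong[OF S C])
    then show ?thesis
      using DD_add[OF dG differentiable_linear_comp[OF linear_scale_self dA], of v w "1 / 2" v w u]
        DD_linear_comp[OF linear_scale_self dA, of "1 / 2" v w u] by simp
  qed
  \<comment> \<open>\<open>?D u\<close> is (\<nabla>_u A)(v, w) and \<open>?E u\<close> is
    -(\<nabla>_v A)(u, w). Both receive the term A(G(u, v), w), with opposite signs; it makes them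
    covariant and cancels in the sum.\<close>
  let ?D = "\<lambda>u. DD (\<lambda>y. A y v w) x u + G i x u (A x v w) - A x (G i x u v) w - A x v (G i x u w)"
  let ?E = "\<lambda>u. A x u (G i x v w) - DD (\<lambda>y. A y u w) x v - G i x v (A x u w) + A x (G i x u v) w"
  let ?Q = "\<lambda>u. A x u (A x v w) - A x v (A x u w)"
  have "curvature C i x u v w = curvature G i x u v w + (1 / 2) *\<^sub>R ?D u + (1 / 2) *\<^sub>R ?E u + (1 / 4) *\<^sub>R ?Q u" for u
    unfolding curvature_def DC C[OF S(2)] bl by (simp add: algebra_simps)
  then have "ricci C i x [v, w] = ricci G i x [v, w] + (1 / 2) * tr ?D + (1 / 2) * tr ?E + (1 / 4) * tr ?Q"
    unfolding ricci_tr by (simp add: tr_add tr_scaleR)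
  moreover have "tr ?E = 0"
  proof -
    have "tr (\<lambda>u. DD (\<lambda>y. A y u w) x v) = 0"
    proof -
      have "tr (\<lambda>u. DD (\<lambda>y. A y u w) x v) = (\<Sum>e\<in>Basis. DD (\<lambda>y. A y e w \<bullet> e) x v)"
        unfolding tr_def by (subst DD_linear_comp[OF _ dA]) (auto intro: linearI simp: inner_add_left)
      also have "\<dots> = DD (\<lambda>y. \<Sum>e\<in>Basis. A y e w \<bullet> e) x v"
        by (subst DD_sum(2)) (auto intro!: differentiable_linear_comp[OF _ dA] linearI simp: inner_add_left)
      also have "DD (\<lambda>y. \<Sum>e\<in>Basis. A y e w \<bullet> e) x = DD (\<lambda>y. 0 :: real) x"
        by (rule DD_cong[OF S]) (use tA in \<open>simp add: tr_def\<close>)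
      finally show ?thesis by simp
    qed
    \<comment> \<open>Cyclicity of the trace for G_v and A_w, with the skew-symmetry of
      \<open>A\<close> applied before and after.\<close>
    moreover have "tr (\<lambda>u. G i x v (A x u w)) = tr (\<lambda>u. A x (G i x u v) w)"
    proof -
      have "tr (\<lambda>u. G i x v (A x u w)) = - tr (\<lambda>u. G i x v (A x w u))"
        unfolding tr_minus[symmetric] using sA linear_neg[OF lG] by metis
      also have "tr (\<lambda>u. G i x v (A x w u)) = tr (\<lambda>u. A x w (G i x v u))"
        by (rule tr_compose[OF lA lG])
      also have "- \<dots> = tr (\<lambda>u. A x (G i x u v) w)"
        unfolding tr_minus[symmetric] using sA sG by metis
      finally show ?thesis .
    qed
    ultimately show ?thesis using tA[OF S(2)] by (simp add: tr_add tr_diff)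
  qed
  moreover have "tr ?Q = tr (\<lambda>u. A x v (A x w u))"
  proof -
    have "A x v (A x u w) = - A x v (A x w u)" for u
      using sA linear_neg[OF lA] by metis
    then show ?thesis using tA[OF S(2)] by (simp add: tr_diff tr_add)
  qed
  ultimately show ?thesis by simp
qed

context chart3
begin

text \<open>The component tangent to this factor of the torsion of a product; \<open>bv\<close>, \<open>bw\<close> and \<open>k\<close> stand
  for the values of the forms of the other factor.\<close>

definition tor :: "real \<Rightarrow> 'e \<Rightarrow> 'e \<Rightarrow> 'e \<Rightarrow> real \<Rightarrow> real \<Rightarrow> real \<Rightarrow> 'e" where
  "tor c x v w bv bw k = c *\<^sub>R cross x v w + bv *\<^sub>R cross x (a x) w - bw *\<^sub>R cross x (a x) v + k *\<^sub>R a x"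

lemma tr_tor: "x \<in> S \<Longrightarrow> tr (\<lambda>u. tor c x u w 0 bw 0) = 0"
  using oriented_form3.tr_P[OF form3] oriented_form3.tr_P'[OF form3]
  by (simp add: tor_def tr_diff tr_scaleR)

text \<open>The parameters \<open>bv\<close>, \<open>bw\<close>, \<open>k\<close> are constant along
  this factor, and an argument replaced by a Christoffel term has no component in the other factor,
  hence the zeros. As the cross product is parallel, only derivatives of \<open>a\<close> survive:
  \<open>tr_PB\<close> gives the right side and \<open>tr_B\<close> removes the \<open>k\<close>
  term.\<close>

lemma div_tor:
  assumes x: "x \<in> S"
  shows "tr (\<lambda>u. DD (\<lambda>y. tor c y v w bv bw k) x u + \<Gamma> x u (tor c x v w bv bw k)
      - tor c x (\<Gamma> x u v) w 0 bw 0 - tor c x v (\<Gamma> x u w) bv 0 0) = bv * \<alpha> i x [w] - bw * \<alpha> i x [v]"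
proof -
  interpret oriented_form3 "g i x" "\<nu> i x" s by (rule form3[OF x])
  note lin = bilinear_radd[OF bilinear_\<Gamma>[OF x]] bilinear_rmul[OF bilinear_\<Gamma>[OF x]] bilinear_rsub[OF bilinear_\<Gamma>[OF x]]
  have hd: "((\<lambda>y. tor c y v w bv bw k) has_derivative (\<lambda>u. c *\<^sub>R DD (\<lambda>y. cross y v w) x u
      + bv *\<^sub>R DD (\<lambda>y. cross y (a y) w) x u - bw *\<^sub>R DD (\<lambda>y. cross y (a y) v) x u + k *\<^sub>R DD a x u)) (at x)"
    unfolding tor_def
    by (intro has_derivative_add has_derivative_diff has_derivative_scaleR_right DD_works diff_P diff_Pa diff_a x)
  have "DD (\<lambda>y. tor c y v w bv bw k) x u + \<Gamma> x u (tor c x v w bv bw k)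
      - tor c x (\<Gamma> x u v) w 0 bw 0 - tor c x v (\<Gamma> x u w) bv 0 0
      = bv *\<^sub>R cross x (B x u) w - bw *\<^sub>R cross x (B x u) v + k *\<^sub>R B x u" for u
    unfolding DD_eq[OF hd] unfolding tor_def lin DD_P[OF x] DD_Pa[OF x]
    by (simp add: B_def algebra_simps)
  then show ?thesis by (simp add: tr_add tr_diff tr_scaleR tr_B[OF x] tr_PB[OF x])
qed

lemma F_cross: "x \<in> S \<Longrightarrow> F x w (cross x (a x) v) =
    s * (g i x [a x, a x] * g i x [v, w] - \<alpha> i x [v] * \<alpha> i x [w])"
proof -
  assume x: "x \<in> S"
  interpret oriented_form3 "g i x" "\<nu> i x" s by (rule form3[OF x])
  have "F x w (cross x (a x) v) = g i x [cross x (a x) w, cross x (a x) v]"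
    by (simp only: F_def g_P(1))
  also have "\<dots> = s * (g i x [a x, a x] * g i x [w, v] - g i x [a x, v] * g i x [w, a x])"
    by (rule g_PP)
  finally show "F x w (cross x (a x) v) =
      s * (g i x [a x, a x] * g i x [v, w] - \<alpha> i x [v] * \<alpha> i x [w])"
    using g_a[OF x, of v] g_a[OF x, of w] sym[of w v] sym[of w "a x"] by simp
qed

text \<open>With \<open>?q v bv\<close> for c v + bv a, the terms of \<open>tor\<close> acting on
  its second argument form one cross product. The composite is then a double cross product, traced
  by \<open>tr_PP\<close>, plus two rank one maps with functionals F(w, _) and \<alpha>, which
  represent the passage through the other factor.\<close>

lemma tr_tor_tor:
  assumes x: "x \<in> S"
  shows "tr (\<lambda>u. tor c x v (tor c x w u bw 0 0) bv (m * F x w u) (k * \<alpha> i x [u])) =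
    - 2 * s * (c * c * g i x [v, w] + c * bw * \<alpha> i x [v] + c * bv * \<alpha> i x [w] + bv * bw * g i x [a x, a x])
    - m * s * (g i x [a x, a x] * g i x [v, w] - \<alpha> i x [v] * \<alpha> i x [w]) + k * g i x [a x, a x]"
proof -
  interpret oriented_form3 "g i x" "\<nu> i x" s by (rule form3[OF x])
  let ?q = "\<lambda>v b. c *\<^sub>R v + b *\<^sub>R a x"
  have t: "tor c x v p bv b k = cross x (?q v bv) p - b *\<^sub>R cross x (a x) v + k *\<^sub>R a x" for v p bv b k
    by (simp add: tor_def P_lin)
  have lF: "linear (F x w)"
    unfolding F_def by (rule nu_linear(3))
  have "tr (\<lambda>u. tor c x v (tor c x w u bw 0 0) bv (m * F x w u) (k * \<alpha> i x [u])) =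
      tr (\<lambda>u. cross x (?q v bv) (cross x (?q w bw) u)) - m * tr (\<lambda>u. F x w u *\<^sub>R cross x (a x) v)
      + k * tr (\<lambda>u. \<alpha> i x [u] *\<^sub>R a x)"
    unfolding t by (simp add: tr_add tr_diff tr_scaleR[symmetric])
  also have "\<dots> = - 2 * s * g i x [?q v bv, ?q w bw] - m * F x w (cross x (a x) v) + k * g i x [a x, a x]"
    by (simp only: tr_PP tr_rank_one[OF lF] tr_rank_one[OF linear_alpha[OF x]] g_a[OF x])
  also have "g i x [?q v bv, ?q w bw] =
      c * c * g i x [v, w] + c * bw * \<alpha> i x [v] + c * bv * \<alpha> i x [w] + bv * bw * g i x [a x, a x]"
    using g_a[OF x, of v] g_a[OF x, of w] sym[of v "a x"] unfolding g_lin by (simp add: algebra_simps)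
  finally show ?thesis by (simp add: F_cross[OF x])
qed

lemma F_skew: "x \<in> S \<Longrightarrow> F x v u = - F x u v"
  unfolding F_def by (rule oriented_form3.nu_swap23[OF form3])

lemma linear_F: "x \<in> S \<Longrightarrow> linear (F x v)" "x \<in> S \<Longrightarrow> linear (\<lambda>v. F x v w)"
  unfolding F_def using oriented_form3.nu_linear[OF form3] by blast+

lemma F_a: "x \<in> S \<Longrightarrow> F x v (a x) = 0"
  unfolding F_def by (rule oriented_form3.nu_same[OF form3])

lemma alpha_cross_a: "x \<in> S \<Longrightarrow> \<alpha> i x [cross x (a x) v] = 0"
  unfolding g_a[symmetric] oriented_form3.g_P[OF form3] by (rule oriented_form3.nu_same[OF form3])

end

section \<open>Metric, connection and torsion on a pair of charts\<close>

locale chart_pair = N: chart3 g i S \<nu> "- 1" \<alpha> + X: chart3 h j T \<mu> 1 \<beta>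
  for g :: "('i, 'e::euclidean_space) tensor" and i S \<nu> \<alpha>
    and h :: "('j, 'f::euclidean_space) tensor" and j T \<mu> \<beta>
begin

text \<open>With \<open>c = d = \<lambda>\<close> this is the flux, with \<open>c = d = -\<lambda>\<close> its Hodge dual.\<close>

definition H0 :: "real \<Rightarrow> real \<Rightarrow> real \<Rightarrow> 'e \<times> 'f \<Rightarrow> 'e \<times> 'f \<Rightarrow> 'e \<times> 'f \<Rightarrow> 'e \<times> 'f \<Rightarrow> real" where
  "H0 c l d p u v w = c * \<nu> i (fst p) [fst u, fst v, fst w]
    + l * (N.F (fst p) (fst u) (fst v) * \<beta> j (snd p) [snd w] + N.F (fst p) (fst v) (fst w) * \<beta> j (snd p) [snd u]
      + N.F (fst p) (fst w) (fst u) * \<beta> j (snd p) [snd v])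
    + l * (\<alpha> i (fst p) [fst u] * X.F (snd p) (snd v) (snd w) + \<alpha> i (fst p) [fst v] * X.F (snd p) (snd w) (snd u)
      + \<alpha> i (fst p) [fst w] * X.F (snd p) (snd u) (snd v))
    + d * \<mu> j (snd p) [snd u, snd v, snd w]"

abbreviation gM where "gM \<equiv> metric_sum g h"

lemma gM_eq: "gM (i, j) p [u, v] = g i (fst p) [fst u, fst v] + h j (snd p) [snd u, snd v]"
  by (simp add: metric_sum_def pull_fst_def pull_snd_def)

lemma open_ST: "open (S \<times> T)"
  by (rule open_Times[OF N.open_S X.open_S])

lemma metric_form_gM:
  assumes "p \<in> S \<times> T"
  shows "metric_form (gM (i, j) p)"
proof -
  interpret a: metric_form "g i (fst p)" using N.metric assms by auto
  interpret b: metric_form "h j (snd p)" using X.metric assms by auto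
  show ?thesis
  proof
    show "bilinear (\<lambda>u v. gM (i, j) p [u, v])"
      unfolding bilinear_def gM_eq by (auto intro!: linearI simp: a.g_lin b.g_lin algebra_simps)
    show "gM (i, j) p [u, v] = gM (i, j) p [v, u]" for u v
      unfolding gM_eq using a.sym b.sym by metis
    fix w assume w: "\<And>v. gM (i, j) p [w, v] = 0"
    have "fst w = 0" using w[of "(_, 0)"] by (intro a.nondeg) (simp add: gM_eq b.g_lin)
    moreover have "snd w = 0" using w[of "(0, _)"] by (intro b.nondeg) (simp add: gM_eq a.g_lin)
    ultimately show "w = 0" by (simp add: prod_eq_iff)
  qed
qed

lemma smooth_fst: "smooth_on S f \<Longrightarrow> smooth_on (S \<times> T) (\<lambda>p. f (fst p))"
  by (rule smooth_on_comp_linear[OF open_ST N.open_S linear_fst]) auto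

lemma smooth_snd: "smooth_on T f \<Longrightarrow> smooth_on (S \<times> T) (\<lambda>p. f (snd p))"
  by (rule smooth_on_comp_linear[OF open_ST X.open_S linear_snd]) auto

sublocale M: metric_chart gM "(i, j)" "S \<times> T"
proof (rule metric_chart.intro)
  show "smooth_on (S \<times> T) (\<lambda>p. gM (i, j) p [u, v])" for u v
    unfolding gM_eq by (intro smooth_on_add open_ST smooth_fst smooth_snd N.smooth_g X.smooth_g)
qed (use open_ST metric_form_gM in auto)

lemma sharp_gM:
  assumes "p \<in> S \<times> T" "linear \<phi>"
  shows "sharp (gM (i, j) p) \<phi> =
    (sharp (g i (fst p)) (\<lambda>v. \<phi> (v, 0)), sharp (h j (snd p)) (\<lambda>w. \<phi> (0, w)))"
proof -
  interpret a: metric_form "g i (fst p)" using N.metric assms by auto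
  interpret b: metric_form "h j (snd p)" using X.metric assms by auto
  have l: "linear (\<lambda>v. \<phi> (v, 0))" "linear (\<lambda>w. \<phi> (0, w))"
    using linear_add[OF assms(2), symmetric] linear_scale[OF assms(2), symmetric]
    by (auto intro!: linearI)
  show ?thesis
  proof (rule metric_form.sharp_unique[OF metric_form_gM[OF assms(1)]])
    fix v
    have "\<phi> v = \<phi> (fst v, 0) + \<phi> (0, snd v)"
      using linear_add[OF assms(2), of "(fst v, 0)" "(0, snd v)"] by simp
    then show "gM (i, j) p [(sharp (g i (fst p)) (\<lambda>v. \<phi> (v, 0)), sharp (h j (snd p)) (\<lambda>w. \<phi> (0, w))), v] = \<phi> v"
      by (simp only: gM_eq fst_conv snd_conv a.sharp_works[OF l(1)] b.sharp_works[OF l(2)])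
  qed
qed

lemma DD_gM:
  assumes "p \<in> S \<times> T"
  shows "DD (\<lambda>p. gM (i, j) p [u, v]) p z =
    DD (\<lambda>x. g i x [fst u, fst v]) (fst p) (fst z) + DD (\<lambda>y. h j y [snd u, snd v]) (snd p) (snd z)"
proof -
  have d: "(\<lambda>x. g i x [fst u, fst v]) differentiable (at (fst p))"
    "(\<lambda>y. h j y [snd u, snd v]) differentiable (at (snd p))"
    using N.diff_g X.diff_g assms by auto
  note 1 = differentiable_comp_linear[OF linear_fst d(1)] and 2 = differentiable_comp_linear[OF linear_snd d(2)]
  show ?thesis unfolding gM_eq DD_add[OF 1(1) 2(1)] 1(2) 2(2) ..
qed

lemma levi_civita_gM:
  assumes p: "p \<in> S \<times> T"
  shows "M.\<Gamma> p u v = (N.\<Gamma> (fst p) (fst u) (fst v), X.\<Gamma> (snd p) (snd u) (snd v))"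
proof (rule metric_form.eqI[OF metric_form_gM[OF p]])
  fix w
  have x: "fst p \<in> S" "snd p \<in> T" using p by auto
  show "gM (i, j) p [M.\<Gamma> p u v, w] = gM (i, j) p [(N.\<Gamma> (fst p) (fst u) (fst v), X.\<Gamma> (snd p) (snd u) (snd v)), w]"
    unfolding M.koszul(2)[OF p] DD_gM[OF p]
    by (simp add: gM_eq N.koszul(2)[OF x(1)] X.koszul(2)[OF x(2)] field_simps)
qed

lemma curvature_gM:
  assumes p: "p \<in> S \<times> T"
  shows "curvature (levi_civita gM) (i, j) p u v w =
    (curvature (levi_civita g) i (fst p) (fst u) (fst v) (fst w), curvature (levi_civita h) j (snd p) (snd u) (snd v) (snd w))"
proof -
  have x: "fst p \<in> S" "snd p \<in> T" using p by auto
  have D: "DD (\<lambda>q. M.\<Gamma> q v w) p u = (DD (\<lambda>x. N.\<Gamma> x (fst v) (fst w)) (fst p) (fst u),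
      DD (\<lambda>y. X.\<Gamma> y (snd v) (snd w)) (snd p) (snd u))" for u v w
  proof -
    have e: "DD (\<lambda>q. M.\<Gamma> q v w) p = DD (\<lambda>q. (N.\<Gamma> (fst q) (fst v) (fst w), X.\<Gamma> (snd q) (snd v) (snd w))) p"
      by (rule DD_cong[OF open_ST p levi_civita_gM])
    show ?thesis unfolding e DD_map_prod[OF N.diff_\<Gamma>[OF x(1)] X.diff_\<Gamma>[OF x(2)]] ..
  qed
  show ?thesis unfolding curvature_def D levi_civita_gM[OF p] by simp
qed

lemma ricci_gM:
  assumes p: "p \<in> S \<times> T"
  shows "ricci (levi_civita gM) (i, j) p [v, w] =
    ricci (levi_civita g) i (fst p) [fst v, fst w] + ricci (levi_civita h) j (snd p) [snd v, snd w]"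
  unfolding ricci_tr tr_prod curvature_gM[OF p] by simp

text \<open>Each component is the \<open>tor\<close> of one factor, fed with the values of the forms
  of the other; \<open>sharp_H0\<close> identifies the pair with the raised flux. One coefficient
  \<open>c\<close> serves both volume forms.\<close>

definition A :: "real \<Rightarrow> real \<Rightarrow> 'e \<times> 'f \<Rightarrow> 'e \<times> 'f \<Rightarrow> 'e \<times> 'f \<Rightarrow> 'e \<times> 'f" where
  "A c l p v w =
    (N.tor c (fst p) (fst v) (fst w) (l * \<beta> j (snd p) [snd v]) (l * \<beta> j (snd p) [snd w]) (l * X.F (snd p) (snd v) (snd w)),
     X.tor c (snd p) (snd v) (snd w) (l * \<alpha> i (fst p) [fst v]) (l * \<alpha> i (fst p) [fst w]) (l * N.F (fst p) (fst v) (fst w)))"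

lemma H0_linear:
  assumes p: "p \<in> S \<times> T"
  shows "linear (H0 c l d p u v)" "linear (\<lambda>v. H0 c l d p u v w)" "linear (\<lambda>u. H0 c l d p u v w)"
proof -
  have x: "fst p \<in> S" "snd p \<in> T" using p by auto
  interpret a: oriented_form3 "g i (fst p)" "\<nu> i (fst p)" "- 1" by (rule N.form3[OF x(1)])
  interpret b: oriented_form3 "h j (snd p)" "\<mu> j (snd p)" 1 by (rule X.form3[OF x(2)])
  note l = a.nu_lin b.nu_lin linear_add[OF N.linear_alpha[OF x(1)]] linear_scale[OF N.linear_alpha[OF x(1)]]
    linear_add[OF X.linear_alpha[OF x(2)]] linear_scale[OF X.linear_alpha[OF x(2)]]
    linear_add[OF N.linear_F(1)[OF x(1)]] linear_scale[OF N.linear_F(1)[OF x(1)]]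
    linear_add[OF N.linear_F(2)[OF x(1)]] linear_scale[OF N.linear_F(2)[OF x(1)]]
    linear_add[OF X.linear_F(1)[OF x(2)]] linear_scale[OF X.linear_F(1)[OF x(2)]]
    linear_add[OF X.linear_F(2)[OF x(2)]] linear_scale[OF X.linear_F(2)[OF x(2)]]
  show "linear (H0 c l d p u v)" "linear (\<lambda>v. H0 c l d p u v w)" "linear (\<lambda>u. H0 c l d p u v w)"
    unfolding H0_def by (rule linearI; simp only: fst_add snd_add fst_scaleR snd_scaleR l real_scaleR_def; simp add: algebra_simps)+
qed

lemma sharp_H0:
  assumes p: "p \<in> S \<times> T"
  shows "sharp (gM (i, j) p) (H0 c l c p v w) = A c l p v w"
proof -
  have x: "fst p \<in> S" "snd p \<in> T" using p by auto
  interpret a: oriented_form3 "g i (fst p)" "\<nu> i (fst p)" "- 1" by (rule N.form3[OF x(1)])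
  interpret b: oriented_form3 "h j (snd p)" "\<mu> j (snd p)" 1 by (rule X.form3[OF x(2)])
  have z: "\<alpha> i (fst p) [0] = 0" "\<beta> j (snd p) [0] = 0"
    using linear_0[OF N.linear_alpha[OF x(1)]] linear_0[OF X.linear_alpha[OF x(2)]] by auto
  have "sharp (g i (fst p)) (\<lambda>z. H0 c l c p v w (z, 0)) = fst (A c l p v w)"
  proof (rule a.sharp_unique)
    fix u
    show "g i (fst p) [fst (A c l p v w), u] = H0 c l c p v w (u, 0)"
      using N.F_skew[OF x(1), of "fst v" u]
      by (simp add: A_def N.tor_def H0_def a.g_lin a.g_P N.g_a[OF x(1)] N.F_def X.F_def z b.nu_lin algebra_simps)
  qed
  moreover have "sharp (h j (snd p)) (\<lambda>z. H0 c l c p v w (0, z)) = snd (A c l p v w)"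
  proof (rule b.sharp_unique)
    fix u
    show "h j (snd p) [snd (A c l p v w), u] = H0 c l c p v w (0, u)"
      using X.F_skew[OF x(2), of "snd v" u]
      by (simp add: A_def X.tor_def H0_def b.g_lin b.g_P X.g_a[OF x(2)] N.F_def X.F_def z a.nu_lin algebra_simps)
  qed
  ultimately show ?thesis by (simp add: sharp_gM[OF p H0_linear(1)[OF p]])
qed

end

lemma smooth_on_Pair:
  assumes "open S" "smooth_on S f" "smooth_on S g"
  shows "smooth_on S (\<lambda>x. (f x, g x))"
proof -
  have "linear (\<lambda>u. (u, 0 :: 'c))" "linear (\<lambda>u. (0 :: 'b, u))"
    by (auto intro: linearI)
  then have "smooth_on S (\<lambda>x. (f x, 0) + (0, g x))"
    by (intro smooth_on_add assms(1) smooth_on_linear[OF assms(1) _ assms(2)] smooth_on_linear[OF assms(1) _ assms(3)])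
  then show ?thesis by simp
qed

lemma sum_lists_0: "(\<Sum>es | set es \<subseteq> B \<and> length es = 0. f es) = f []"
proof -
  have "{es. set es \<subseteq> B \<and> length es = 0} = {[]}" by auto
  then show ?thesis by simp
qed

lemma sum_lists_Suc:
  assumes "finite B"
  shows "(\<Sum>es | set es \<subseteq> B \<and> length es = Suc k. f es) =
    (\<Sum>e\<in>B. \<Sum>es | set es \<subseteq> B \<and> length es = k. f (e # es))"
proof -
  have "{es. set es \<subseteq> B \<and> length es = Suc k} = (\<lambda>(e, es). e # es) ` (B \<times> {es. set es \<subseteq> B \<and> length es = k})"
    by (auto simp: length_Suc_conv)
  then have "(\<Sum>es | set es \<subseteq> B \<and> length es = Suc k. f es) =
      (\<Sum>(e, es)\<in>B \<times> {es. set es \<subseteq> B \<and> length es = k}. f (e # es))"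
    by (simp add: sum.reindex inj_on_def case_prod_unfold)
  then show ?thesis
    by (simp add: sum.cartesian_product)
qed

lemma sum_lists_1: "finite B \<Longrightarrow> (\<Sum>es | set es \<subseteq> B \<and> length es = 1. f es) = (\<Sum>a\<in>B. f [a])"
  and sum_lists_2: "finite B \<Longrightarrow> (\<Sum>es | set es \<subseteq> B \<and> length es = 2. f es) = (\<Sum>a\<in>B. \<Sum>b\<in>B. f [a, b])"
  and sum_lists_3: "finite B \<Longrightarrow>
    (\<Sum>es | set es \<subseteq> B \<and> length es = 3. f es) = (\<Sum>a\<in>B. \<Sum>b\<in>B. \<Sum>c\<in>B. f [a, b, c])"
  by (simp_all only: One_nat_def numeral_2_eq_2 numeral_3_eq_3 sum_lists_Suc sum_lists_0)

text \<open>Polarisation: with the sum of the two entries in both slots the value is 0 and expands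
  into four values, two of which vanish.\<close>

lemma alternating_swap:
  assumes "multilinear n t" "alternating n t" "length vs = n" "a < b" "b < n"
  shows "t (vs[a := vs ! b, b := vs ! a]) = - t vs"
proof -
  have z: "t (vs[a := x, b := x]) = 0" for x
  proof -
    have "vs[a := x, b := x] ! a = vs[a := x, b := x] ! b" using assms(3-5) by simp
    then show ?thesis using assms(2-5) unfolding alternating_def by (metis length_list_update)
  qed
  have l1: "linear (\<lambda>v. t (us[a := v]))" and l2: "linear (\<lambda>v. t (us[b := v]))" if "length us = n" for us
    using assms(1,4,5) that unfolding multilinear_def by auto
  let ?x = "vs ! a" and ?y = "vs ! b"
  have "t (vs[a := ?x + ?y, b := ?x + ?y]) = t (vs[a := ?x + ?y, b := ?x]) + t (vs[a := ?x + ?y, b := ?y])"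
    by (rule linear_add[OF l2]) (simp add: assms(3))
  moreover have "t (vs[a := ?x + ?y, b := w]) = t (vs[a := ?x, b := w]) + t (vs[a := ?y, b := w])" for w
  proof -
    have "vs[a := q, b := w] = vs[b := w, a := q]" for q
      using assms(4) by (simp add: list_update_swap)
    then show ?thesis using linear_add[OF l1[of "vs[b := w]"], of ?x ?y] assms(3) by (simp only: length_list_update simp_thms)
  qed
  ultimately have "t (vs[a := ?y, b := ?x]) + t (vs[a := ?x, b := ?y]) = 0"
    by (simp only: z)
  then show ?thesis by simp
qed

context chart_pair
begin

text \<open>Trilinearity passes from \<open>H0\<close> to \<open>A\<close> through the nondegenerate
  metric, since g(A(v, w), u) = H0(v, w, u).\<close>

lemma A_lin:
  assumes p: "p \<in> S \<times> T"
  shows "bilinear (A c l p)"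
proof -
  interpret M: metric_form "gM (i, j) p" by (rule metric_form_gM[OF p])
  have "gM (i, j) p [A c l p v w, u] = H0 c l c p v w u" for u v w
    unfolding sharp_H0[OF p, symmetric] by (rule M.sharp_works[OF H0_linear(1)[OF p]])
  note 1 = this
  show ?thesis
    unfolding bilinear_def
    by (intro conjI allI linearI M.eqI) (simp_all add: M.g_lin 1 linear_add[OF H0_linear(2)[OF p]] linear_add[OF H0_linear(3)[OF p]]
        linear_scale[OF H0_linear(2)[OF p]] linear_scale[OF H0_linear(3)[OF p]])
qed

lemma A_skew: "p \<in> S \<times> T \<Longrightarrow> A c l p v w = - A c l p w v"
proof -
  assume p: "p \<in> S \<times> T"
  then have x: "fst p \<in> S" "snd p \<in> T" by auto
  show ?thesis
    unfolding A_def N.tor_def X.tor_def N.F_skew[OF x(1), of "fst w" "fst v"] X.F_skew[OF x(2), of "snd w" "snd v"]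
      oriented_form3.P_skew[OF N.form3[OF x(1)], of "fst w" "fst v"]
      oriented_form3.P_skew[OF X.form3[OF x(2)], of "snd w" "snd v"]
    by simp
qed

lemma smooth_A: "smooth_on (S \<times> T) (\<lambda>p. A c l p v w)"
  unfolding A_def N.tor_def X.tor_def
  by (intro smooth_on_Pair smooth_on_add smooth_on_diff smooth_on_scaleR smooth_on_mult smooth_on_const open_ST
      smooth_fst[of "\<lambda>x. N.cross x (N.a x) _"] smooth_snd[of "\<lambda>x. X.cross x (X.a x) _"]
      smooth_fst[of "\<lambda>x. N.cross x _ _"] smooth_snd[of "\<lambda>x. X.cross x _ _"] smooth_fst[of N.a] smooth_snd[of X.a]
      smooth_fst[of "\<lambda>x. N.F x _ _"] smooth_snd[of "\<lambda>x. X.F x _ _"]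
      smooth_fst[of "\<lambda>x. \<alpha> i x _"] smooth_snd[of "\<lambda>x. \<beta> j x _"]
      N.smooth_P X.smooth_P N.smooth_Pa X.smooth_Pa N.smooth_a X.smooth_a N.smooth_F X.smooth_F
      N.smooth_alpha X.smooth_alpha)

text \<open>On a vector tangent to one factor the forms of the other factor vanish, which leaves
  \<open>tor\<close> in the shapes required by \<open>tr_tor\<close>, \<open>div_tor\<close> and
  \<open>tr_tor_tor\<close>.\<close>

lemma A_N:
  assumes p: "p \<in> S \<times> T"
  shows "A c l p w (u, 0) = (N.tor c (fst p) (fst w) u (l * \<beta> j (snd p) [snd w]) 0 0,
    X.tor c (snd p) (snd w) 0 0 (l * \<alpha> i (fst p) [u]) (l * N.F (fst p) (fst w) u))"
    "A c l p (u, 0) w = (N.tor c (fst p) u (fst w) 0 (l * \<beta> j (snd p) [snd w]) 0,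
    X.tor c (snd p) 0 (snd w) (l * \<alpha> i (fst p) [u]) 0 (l * N.F (fst p) u (fst w)))"
  and A_X: "A c l p w (0, q) = (N.tor c (fst p) (fst w) 0 0 (l * \<beta> j (snd p) [q]) (l * X.F (snd p) (snd w) q),
    X.tor c (snd p) (snd w) q (l * \<alpha> i (fst p) [fst w]) 0 0)"
    "A c l p (0, q) w = (N.tor c (fst p) 0 (fst w) (l * \<beta> j (snd p) [q]) 0 (l * X.F (snd p) q (snd w)),
    X.tor c (snd p) q (snd w) 0 (l * \<alpha> i (fst p) [fst w]) 0)"
proof -
  have x: "fst p \<in> S" "snd p \<in> T" using p by auto
  interpret a: oriented_form3 "g i (fst p)" "\<nu> i (fst p)" "- 1" by (rule N.form3[OF x(1)])
  interpret b: oriented_form3 "h j (snd p)" "\<mu> j (snd p)" 1 by (rule X.form3[OF x(2)])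
  have z: "\<alpha> i (fst p) [0] = 0" "\<beta> j (snd p) [0] = 0"
    using linear_0[OF N.linear_alpha[OF x(1)]] linear_0[OF X.linear_alpha[OF x(2)]] by auto
  have "N.F (fst p) v 0 = 0" "X.F (snd p) v' 0 = 0" "N.F (fst p) 0 v = 0" "X.F (snd p) 0 v' = 0" for v v'
    by (simp_all add: N.F_def X.F_def a.nu_lin b.nu_lin)
  note z = z this
  show "A c l p w (u, 0) = (N.tor c (fst p) (fst w) u (l * \<beta> j (snd p) [snd w]) 0 0,
    X.tor c (snd p) (snd w) 0 0 (l * \<alpha> i (fst p) [u]) (l * N.F (fst p) (fst w) u))"
    "A c l p (u, 0) w = (N.tor c (fst p) u (fst w) 0 (l * \<beta> j (snd p) [snd w]) 0,
    X.tor c (snd p) 0 (snd w) (l * \<alpha> i (fst p) [u]) 0 (l * N.F (fst p) u (fst w)))"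
    "A c l p w (0, q) = (N.tor c (fst p) (fst w) 0 0 (l * \<beta> j (snd p) [q]) (l * X.F (snd p) (snd w) q),
    X.tor c (snd p) (snd w) q (l * \<alpha> i (fst p) [fst w]) 0 0)"
    "A c l p (0, q) w = (N.tor c (fst p) 0 (fst w) (l * \<beta> j (snd p) [q]) 0 (l * X.F (snd p) q (snd w)),
    X.tor c (snd p) q (snd w) 0 (l * \<alpha> i (fst p) [fst w]) 0)"
    by (simp_all add: A_def z N.tor_def X.tor_def a.P_lin b.P_lin)
qed

lemma tr_A: "p \<in> S \<times> T \<Longrightarrow> tr (\<lambda>u. A c l p u w) = 0"
  unfolding tr_prod by (subst A_N(2), simp, subst A_X(2), simp) (auto simp: N.tr_tor X.tr_tor)

lemma \<Gamma>_zero: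
  "x \<in> S \<Longrightarrow> N.\<Gamma> x 0 v = 0" "y \<in> T \<Longrightarrow> X.\<Gamma> y 0 w = 0"
  using bilinear_lzero[OF N.bilinear_\<Gamma>] bilinear_lzero[OF X.bilinear_\<Gamma>] by auto

lemma fst_snd_DD:
  assumes "f differentiable (at x)"
  shows "fst (DD f x v) = DD (\<lambda>y. fst (f y)) x v" "snd (DD f x v) = DD (\<lambda>y. snd (f y)) x v"
  using DD_linear_comp[OF linear_fst assms] DD_linear_comp[OF linear_snd assms] by simp_all

text \<open>The N part of the trace is l (\<beta>(v) \<alpha>(w) - \<beta>(w) \<alpha>(v)) by
  \<open>div_tor\<close>; the X part is the same with \<alpha> and \<beta> exchanged, hence its
  negative.\<close>

lemma div_A:
  assumes p: "p \<in> S \<times> T"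
  shows "tr (\<lambda>u. DD (\<lambda>q. A c l q v w) p u + M.\<Gamma> p u (A c l p v w) - A c l p (M.\<Gamma> p u v) w - A c l p v (M.\<Gamma> p u w)) = 0"
    (is "tr ?L = 0")
proof -
  obtain x y where xy: "p = (x, y)" by fastforce
  have x: "x \<in> S" and y: "y \<in> T" using p xy by auto
  note d = smooth_on_differentiable[OF smooth_A p, unfolded xy]
  have "fst (?L (u, 0)) = DD (\<lambda>z. N.tor c z (fst v) (fst w) (l * \<beta> j y [snd v]) (l * \<beta> j y [snd w]) (l * X.F y (snd v) (snd w))) x u
      + N.\<Gamma> x u (N.tor c x (fst v) (fst w) (l * \<beta> j y [snd v]) (l * \<beta> j y [snd w]) (l * X.F y (snd v) (snd w)))
      - N.tor c x (N.\<Gamma> x u (fst v)) (fst w) 0 (l * \<beta> j y [snd w]) 0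
      - N.tor c x (fst v) (N.\<Gamma> x u (fst w)) (l * \<beta> j y [snd v]) 0 0" for u
  proof -
    have "fst (DD (\<lambda>q. A c l q v w) p (u, 0)) =
        DD (\<lambda>z. N.tor c z (fst v) (fst w) (l * \<beta> j y [snd v]) (l * \<beta> j y [snd w]) (l * X.F y (snd v) (snd w))) x u"
      unfolding xy fst_snd_DD(1)[OF d] by (subst DD_partial(1)[OF differentiable_linear_comp[OF linear_fst d]]) (simp add: A_def)
    then show ?thesis
      unfolding fst_add fst_diff levi_civita_gM[OF p]
      by (simp add: xy \<Gamma>_zero(2)[OF y] A_N[OF p, unfolded xy] A_def[of c l "(x, y)" v w])
  qed
  then have 1: "tr (\<lambda>u. fst (?L (u, 0))) = l * \<beta> j y [snd v] * \<alpha> i x [fst w] - l * \<beta> j y [snd w] * \<alpha> i x [fst v]"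
    by (simp only: N.div_tor[OF x])
  have "snd (?L (0, u)) = DD (\<lambda>z. X.tor c z (snd v) (snd w) (l * \<alpha> i x [fst v]) (l * \<alpha> i x [fst w]) (l * N.F x (fst v) (fst w))) y u
      + X.\<Gamma> y u (X.tor c y (snd v) (snd w) (l * \<alpha> i x [fst v]) (l * \<alpha> i x [fst w]) (l * N.F x (fst v) (fst w)))
      - X.tor c y (X.\<Gamma> y u (snd v)) (snd w) 0 (l * \<alpha> i x [fst w]) 0
      - X.tor c y (snd v) (X.\<Gamma> y u (snd w)) (l * \<alpha> i x [fst v]) 0 0" for u
  proof -
    have "snd (DD (\<lambda>q. A c l q v w) p (0, u)) =
        DD (\<lambda>z. X.tor c z (snd v) (snd w) (l * \<alpha> i x [fst v]) (l * \<alpha> i x [fst w]) (l * N.F x (fst v) (fst w))) y u"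
      unfolding xy fst_snd_DD(2)[OF d] by (subst DD_partial(2)[OF differentiable_linear_comp[OF linear_snd d]]) (simp add: A_def)
    then show ?thesis
      unfolding snd_add snd_diff levi_civita_gM[OF p]
      by (simp add: xy \<Gamma>_zero(1)[OF x] A_X[OF p, unfolded xy] A_def[of c l "(x, y)" v w])
  qed
  then have 2: "tr (\<lambda>u. snd (?L (0, u))) = l * \<alpha> i x [fst v] * \<beta> j y [snd w] - l * \<alpha> i x [fst w] * \<beta> j y [snd v]"
    by (simp only: X.div_tor[OF y])
  show ?thesis unfolding tr_prod[of ?L] 1 2 by simp
qed

text \<open>The trace is taken factor by factor; a vector returns to its factor directly or by way
  of the other one. The terms with the product c l carry the coefficient -2s of
  \<open>tr_PP\<close>, and cancel because s is -1 on N and 1 on X.\<close>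

lemma tr_AA:
  assumes p: "p \<in> S \<times> T"
  defines "x \<equiv> fst p" and "y \<equiv> snd p"
  defines "e \<equiv> g i x [N.a x, N.a x]"
  assumes b: "h j y [X.a y, X.a y] = 1"
  shows "tr (\<lambda>u. A c l p v (A c l p w u)) =
    (2 * c\<^sup>2 + 2 * l\<^sup>2 * e) * g i x [fst v, fst w] - 4 * l\<^sup>2 * (\<alpha> i x [fst v] * \<alpha> i x [fst w])
    - (2 * c\<^sup>2 + 2 * l\<^sup>2 * e) * h j y [snd v, snd w] + 4 * l\<^sup>2 * e * (\<beta> j y [snd v] * \<beta> j y [snd w])"
proof -
  have x: "x \<in> S" and y: "y \<in> T" using p by (auto simp: x_def y_def)
  interpret a: oriented_form3 "g i x" "\<nu> i x" "- 1" by (rule N.form3[OF x])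
  interpret b: oriented_form3 "h j y" "\<mu> j y" 1 by (rule X.form3[OF y])
  note la = linear_add[OF N.linear_alpha[OF x]] linear_scale[OF N.linear_alpha[OF x]] linear_diff[OF N.linear_alpha[OF x]] linear_0[OF N.linear_alpha[OF x]]
  note lb = linear_add[OF X.linear_alpha[OF y]] linear_scale[OF X.linear_alpha[OF y]] linear_diff[OF X.linear_alpha[OF y]] linear_0[OF X.linear_alpha[OF y]]
  note lF = linear_add[OF N.linear_F(1)[OF x]] linear_scale[OF N.linear_F(1)[OF x]] linear_diff[OF N.linear_F(1)[OF x]] linear_0[OF N.linear_F(1)[OF x]]
  note lG = linear_add[OF X.linear_F(1)[OF y]] linear_scale[OF X.linear_F(1)[OF y]] linear_diff[OF X.linear_F(1)[OF y]] linear_0[OF X.linear_F(1)[OF y]]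
  have aa: "\<alpha> i x [N.a x] = e" "\<beta> j y [X.a y] = 1"
    using N.g_a[OF x, of "N.a x"] X.g_a[OF y, of "X.a y"] b by (auto simp: e_def)
  \<comment> \<open>The way through X supplies the parameters of \<open>tr_tor_tor\<close>:
    \<open>m\<close> is l^2 because |\<beta>|^2 = 1, and \<open>k\<close> is - l^2 (h(v, w) -
    \<beta>(v) \<beta>(w)) by \<open>F_cross\<close>.\<close>
  have "fst (A c l p v (A c l p w (u, 0))) =
      N.tor c x (fst v) (N.tor c x (fst w) u (l * \<beta> j y [snd w]) 0 0) (l * \<beta> j y [snd v]) (l\<^sup>2 * N.F x (fst w) u)
        (- l\<^sup>2 * (h j y [snd v, snd w] - \<beta> j y [snd v] * \<beta> j y [snd w]) * \<alpha> i x [u])" for u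
  proof -
    have 1: "\<beta> j y [X.tor c y (snd w) 0 0 (l * \<alpha> i x [u]) (l * N.F x (fst w) u)] = l * N.F x (fst w) u"
      by (simp add: X.tor_def lb X.alpha_cross_a[OF y] aa b.P_lin)
    have 2: "X.F y (snd v) (X.tor c y (snd w) 0 0 (l * \<alpha> i x [u]) (l * N.F x (fst w) u)) =
        - (l * \<alpha> i x [u] * (h j y [snd v, snd w] - \<beta> j y [snd v] * \<beta> j y [snd w]))"
      by (simp add: X.tor_def lG X.F_a[OF y] X.F_cross[OF y] b b.P_lin b.sym[of "snd w"] mult.commute)
    show ?thesis
      unfolding A_N(1)[OF p] by (simp add: A_def x_def[symmetric] y_def[symmetric] 1 2 power2_eq_square mult_ac)
  qed
  then have I: "tr (\<lambda>u. fst (A c l p v (A c l p w (u, 0)))) =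
      2 * (c * c * g i x [fst v, fst w] + c * (l * \<beta> j y [snd w]) * \<alpha> i x [fst v]
        + c * (l * \<beta> j y [snd v]) * \<alpha> i x [fst w] + (l * \<beta> j y [snd v]) * (l * \<beta> j y [snd w]) * e)
      + l\<^sup>2 * (e * g i x [fst v, fst w] - \<alpha> i x [fst v] * \<alpha> i x [fst w])
      + - l\<^sup>2 * (h j y [snd v, snd w] - \<beta> j y [snd v] * \<beta> j y [snd w]) * e"
    by (simp only: N.tr_tor_tor[OF x] e_def)
  \<comment> \<open>The way through N gives \<open>m\<close> as l^2 e because |\<alpha>|^2 = e;
    \<open>k\<close> has the opposite sign compared with the other factor because
    \<open>F_cross\<close> carries the sign -1 of N.\<close>
  have "snd (A c l p v (A c l p w (0, u))) =
      X.tor c y (snd v) (X.tor c y (snd w) u (l * \<alpha> i x [fst w]) 0 0) (l * \<alpha> i x [fst v]) (l\<^sup>2 * e * X.F y (snd w) u)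
        (l\<^sup>2 * (e * g i x [fst v, fst w] - \<alpha> i x [fst v] * \<alpha> i x [fst w]) * \<beta> j y [u])" for u
  proof -
    have 1: "\<alpha> i x [N.tor c x (fst w) 0 0 (l * \<beta> j y [u]) (l * X.F y (snd w) u)] = l * e * X.F y (snd w) u"
      by (simp add: N.tor_def la N.alpha_cross_a[OF x] aa a.P_lin)
    have 2: "N.F x (fst v) (N.tor c x (fst w) 0 0 (l * \<beta> j y [u]) (l * X.F y (snd w) u)) =
        l * \<beta> j y [u] * (e * g i x [fst v, fst w] - \<alpha> i x [fst v] * \<alpha> i x [fst w])"
      by (simp add: N.tor_def lF N.F_a[OF x] N.F_cross[OF x] e_def[symmetric] a.P_lin a.sym[of "fst w"] algebra_simps)
    show ?thesis
      unfolding A_X(1)[OF p] by (simp add: A_def x_def[symmetric] y_def[symmetric] 1 2 power2_eq_square mult_ac)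
  qed
  then have J: "tr (\<lambda>u. snd (A c l p v (A c l p w (0, u)))) =
      - 2 * (c * c * h j y [snd v, snd w] + c * (l * \<alpha> i x [fst w]) * \<beta> j y [snd v]
        + c * (l * \<alpha> i x [fst v]) * \<beta> j y [snd w] + (l * \<alpha> i x [fst v]) * (l * \<alpha> i x [fst w]))
      - l\<^sup>2 * e * (h j y [snd v, snd w] - \<beta> j y [snd v] * \<beta> j y [snd w])
      + l\<^sup>2 * (e * g i x [fst v, fst w] - \<alpha> i x [fst v] * \<alpha> i x [fst w])"
    by (simp only: X.tr_tor_tor[OF y] b, simp)
  show ?thesis
    unfolding tr_prod[of "\<lambda>u. A c l p v (A c l p w u)"] I J by (simp add: power2_eq_square algebra_simps)
qed

lemma nabla_H_eq:
  assumes "\<And>q u v w. q \<in> S \<times> T \<Longrightarrow> H (i, j) q [u, v, w] = H0 c l c q u v w" "p \<in> S \<times> T"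
  shows "nabla_H gM H (i, j) p u v = M.\<Gamma> p u v + (1 / 2) *\<^sub>R A c l p u v"
proof -
  have "(\<lambda>w. H (i, j) p [u, v, w]) = H0 c l c p u v" using assms by auto
  then show ?thesis by (simp add: nabla_H_def sharp_H0[OF assms(2)])
qed

lemma smooth_\<Gamma>M: "smooth_on (S \<times> T) (\<lambda>q. M.\<Gamma> q u v)"
proof -
  have "smooth_on (S \<times> T) (\<lambda>q. (N.\<Gamma> (fst q) (fst u) (fst v), X.\<Gamma> (snd q) (snd u) (snd v)))"
    by (intro smooth_on_Pair open_ST smooth_fst[of "\<lambda>x. N.\<Gamma> x _ _"] smooth_snd[of "\<lambda>x. X.\<Gamma> x _ _"] N.smooth_\<Gamma> X.smooth_\<Gamma>)
  then show ?thesis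
    by (rule smooth_on_transform[OF open_ST]) (simp add: levi_civita_gM)
qed

text \<open>\<open>RN\<close> and \<open>RX\<close> are the Einstein conditions with the metric
  signs -1 and 1 inserted. Together they are the negative of a quarter of
  \<open>tr_AA\<close>.\<close>

lemma ricci_nabla:
  assumes p: "p \<in> S \<times> T"
    and H: "\<And>q u v w. q \<in> S \<times> T \<Longrightarrow> H (i, j) q [u, v, w] = H0 c l c q u v w"
    and e: "g i (fst p) [N.a (fst p), N.a (fst p)] = e" and b: "h j (snd p) [X.a (snd p), X.a (snd p)] = 1"
    and RN: "ricci (levi_civita g) i (fst p) [fst v, fst w] =
      - (1 / 2) * (c\<^sup>2 + l\<^sup>2 * e) * g i (fst p) [fst v, fst w] + l\<^sup>2 * (\<alpha> i (fst p) [fst v] * \<alpha> i (fst p) [fst w])"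
    and RX: "ricci (levi_civita h) j (snd p) [snd v, snd w] =
      (1 / 2) * (c\<^sup>2 + e * l\<^sup>2) * h j (snd p) [snd v, snd w] - e * l\<^sup>2 * (\<beta> j (snd p) [snd v] * \<beta> j (snd p) [snd w])"
  shows "ricci (nabla_H gM H) (i, j) p [v, w] = 0"
proof -
  have C: "nabla_H gM H (i, j) q u v = M.\<Gamma> q u v + (1 / 2) *\<^sub>R A c l q u v" if "q \<in> S \<times> T" for q u v
    by (rule nabla_H_eq) (use H that in auto)
  note dG = smooth_on_differentiable[OF smooth_\<Gamma>M p]
  have "ricci (nabla_H gM H) (i, j) p [v, w] = ricci (levi_civita gM) (i, j) p [v, w]
    + (1 / 2) * tr (\<lambda>u. DD (\<lambda>q. A c l q v w) p u + M.\<Gamma> p u (A c l p v w) - A c l p (M.\<Gamma> p u v) w - A c l p v (M.\<Gamma> p u w))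
    + (1 / 4) * tr (\<lambda>u. A c l p v (A c l p w u))"
    by (rule ricci_skew_torsion[where C = "nabla_H gM H" and G = "levi_civita gM" and A = "A c l" and i = "(i, j)"
          and x = p and S = "S \<times> T", OF open_ST p C dG smooth_on_differentiable[OF smooth_A p] M.bilinear_\<Gamma>[OF p]
          M.\<Gamma>_sym[OF p] A_lin[OF p] A_skew[OF p] tr_A])
  also have "\<dots> = 0"
    unfolding div_A[OF p] tr_AA[OF p b] ricci_gM[OF p] RN RX e by (simp add: algebra_simps)
  finally show ?thesis .
qed

end

section \<open>Closedness and isotropy of the flux\<close>

text \<open>Triples are sorted by the number of slots lying in the second factor; by symmetry the 1,
  3, 3, 1 arrangements in each class contribute equally. It is applied to products of two
  alternating forms, which are symmetric.\<close>

lemma sum_symmetric_prod: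
  fixes t :: "'e::euclidean_space \<times> 'f::euclidean_space \<Rightarrow> 'e \<times> 'f \<Rightarrow> 'e \<times> 'f \<Rightarrow> real"
  assumes s12: "\<And>a b d. t b a d = t a b d" and s23: "\<And>a b d. t a d b = t a b d"
  shows "(\<Sum>a\<in>Basis. \<Sum>b\<in>Basis. \<Sum>d\<in>Basis. t a b d) =
    (\<Sum>a\<in>Basis. \<Sum>b\<in>Basis. \<Sum>d\<in>Basis. t (a, 0) (b, 0) (d, 0))
    + 3 * (\<Sum>a\<in>Basis. \<Sum>b\<in>Basis. \<Sum>d\<in>Basis. t (a, 0) (b, 0) (0, d))
    + 3 * (\<Sum>a\<in>Basis. \<Sum>b\<in>Basis. \<Sum>d\<in>Basis. t (a, 0) (0, b) (0, d))
    + (\<Sum>a\<in>Basis. \<Sum>b\<in>Basis. \<Sum>d\<in>Basis. t (0, a) (0, b) (0, d))"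
proof -
  have 1: "(\<Sum>a\<in>Basis. \<Sum>d\<in>Basis. \<Sum>b\<in>Basis. t (a, 0) (0, d) (b, 0)) =
      (\<Sum>a\<in>Basis. \<Sum>b\<in>Basis. \<Sum>d\<in>Basis. t (a, 0) (b, 0) (0, d))"
    unfolding s23[of "(_, 0)" "(0, _)" "(_, 0)"] by (rule sum.cong[OF refl], rule sum.swap)
  have 2: "(\<Sum>d\<in>Basis. \<Sum>a\<in>Basis. \<Sum>b\<in>Basis. t (0, d) (a, 0) (b, 0)) =
      (\<Sum>a\<in>Basis. \<Sum>b\<in>Basis. \<Sum>d\<in>Basis. t (a, 0) (b, 0) (0, d))"
    unfolding s12[of "(0, _)" "(_, 0)"] 1[symmetric] by (rule sum.swap)
  have 3: "(\<Sum>b\<in>Basis. \<Sum>a\<in>Basis. \<Sum>d\<in>Basis. t (0, b) (a, 0) (0, d)) =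
      (\<Sum>a\<in>Basis. \<Sum>b\<in>Basis. \<Sum>d\<in>Basis. t (a, 0) (0, b) (0, d))"
    unfolding s12[of "(0, _)" "(_, 0)"] by (rule sum.swap)
  have 4: "(\<Sum>b\<in>Basis. \<Sum>d\<in>Basis. \<Sum>a\<in>Basis. t (0, b) (0, d) (a, 0)) =
      (\<Sum>a\<in>Basis. \<Sum>b\<in>Basis. \<Sum>d\<in>Basis. t (a, 0) (0, b) (0, d))"
    unfolding s23[of "(0, _)" "(0, _)" "(_, 0)"] 3[symmetric] by (rule sum.cong[OF refl], rule sum.swap)
  show ?thesis
    unfolding sum_Basis_prod sum.distrib 1 2 3 4 by simp
qed

lemma sum_factor:
  fixes q :: "'c \<Rightarrow> real"
  shows "(\<Sum>a\<in>I. \<Sum>b\<in>J. \<Sum>d\<in>K. (P a b * q d) * (N a b * m d)) =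
    (\<Sum>a\<in>I. \<Sum>b\<in>J. P a b * N a b) * (\<Sum>d\<in>K. q d * m d)"
  by (simp add: sum_distrib_left sum_distrib_right mult_ac)

lemma sum_factor':
  fixes q :: "'a \<Rightarrow> real"
  shows "(\<Sum>a\<in>I. \<Sum>b\<in>J. \<Sum>d\<in>K. (q a * P b d) * (m a * N b d)) =
    (\<Sum>a\<in>I. q a * m a) * (\<Sum>b\<in>J. \<Sum>d\<in>K. P b d * N b d)"
  unfolding sum_distrib_right unfolding sum_distrib_left by (simp only: mult_ac)

context chart3
begin

lemma DD_F_skew: "x \<in> S \<Longrightarrow> DD (\<lambda>y. F y v u) x z = - DD (\<lambda>y. F y u v) x z"
proof -
  assume x: "x \<in> S"
  have "DD (\<lambda>y. F y v u) x = DD (\<lambda>y. - F y u v) x"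
    by (rule DD_cong[OF open_S x]) (rule F_skew)
  moreover have "linear (\<lambda>r :: real. - r)" by (auto intro: linearI)
  ultimately show ?thesis using DD_linear_comp[OF _ diff_F[OF x], of "\<lambda>r. - r"] by simp
qed

end

context chart_pair
begin

lemma has_derivative_fst_comp:
  "f differentiable (at (fst p)) \<Longrightarrow> ((\<lambda>q. f (fst q)) has_derivative (\<lambda>z. DD f (fst p) (fst z))) (at p)"
  using diff_chain_at[OF has_derivative_fst[OF has_derivative_ident] DD_works] by (simp add: o_def)

lemma has_derivative_snd_comp:
  "f differentiable (at (snd p)) \<Longrightarrow> ((\<lambda>q. f (snd q)) has_derivative (\<lambda>z. DD f (snd p) (snd z))) (at p)"
  using diff_chain_at[OF has_derivative_snd[OF has_derivative_ident] DD_works] by (simp add: o_def)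

lemma DD_H0:
  assumes p: "p \<in> S \<times> T"
  defines "x \<equiv> fst p" and "y \<equiv> snd p"
  shows "DD (\<lambda>q. H0 c l d q u v w) p z = c * DD (\<lambda>x. \<nu> i x [fst u, fst v, fst w]) x (fst z)
    + l * (DD (\<lambda>x. N.F x (fst u) (fst v)) x (fst z) * \<beta> j y [snd w] + N.F x (fst u) (fst v) * DD (\<lambda>y. \<beta> j y [snd w]) y (snd z)
      + (DD (\<lambda>x. N.F x (fst v) (fst w)) x (fst z) * \<beta> j y [snd u] + N.F x (fst v) (fst w) * DD (\<lambda>y. \<beta> j y [snd u]) y (snd z))
      + (DD (\<lambda>x. N.F x (fst w) (fst u)) x (fst z) * \<beta> j y [snd v] + N.F x (fst w) (fst u) * DD (\<lambda>y. \<beta> j y [snd v]) y (snd z)))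
    + l * (DD (\<lambda>y. X.F y (snd v) (snd w)) y (snd z) * \<alpha> i x [fst u] + X.F y (snd v) (snd w) * DD (\<lambda>x. \<alpha> i x [fst u]) x (fst z)
      + (DD (\<lambda>y. X.F y (snd w) (snd u)) y (snd z) * \<alpha> i x [fst v] + X.F y (snd w) (snd u) * DD (\<lambda>x. \<alpha> i x [fst v]) x (fst z))
      + (DD (\<lambda>y. X.F y (snd u) (snd v)) y (snd z) * \<alpha> i x [fst w] + X.F y (snd u) (snd v) * DD (\<lambda>x. \<alpha> i x [fst w]) x (fst z)))
    + d * DD (\<lambda>y. \<mu> j y [snd u, snd v, snd w]) y (snd z)"
proof -
  have x: "fst p \<in> S" and y: "snd p \<in> T" using p by auto
  note hd = has_derivative_fst_comp[OF N.diff_nu[OF x]] has_derivative_fst_comp[OF N.diff_F[OF x]]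
    has_derivative_fst_comp[OF N.diff_alpha[OF x]] has_derivative_snd_comp[OF X.diff_nu[OF y]]
    has_derivative_snd_comp[OF X.diff_F[OF y]] has_derivative_snd_comp[OF X.diff_alpha[OF y]]
  show ?thesis
    unfolding H0_def x_def y_def
    by (subst DD_eq, (rule derivative_eq_intros hd refl)+) (simp add: algebra_simps)
qed

text \<open>Stated for any \<open>H\<close> that agrees with some \<open>H0\<close> on the chart, so
  that it covers both the flux and its Hodge dual. Writing G for the form \<ast>\<beta>, the mixed
  terms give d\<alpha> \<and> G + F \<and> d\<beta> with d\<alpha> = -F and d\<beta> = G.\<close>

lemma closed_H0:
  assumes p: "p \<in> S \<times> T"
    and H: "\<And>q u v w. q \<in> S \<times> T \<Longrightarrow> H (i, j) q [u, v, w] = H0 c l d q u v w"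
  shows "ext_d H (i, j) p [u0, u1, u2, u3] = 0"
proof -
  define x where "x = fst p"
  define y where "y = snd p"
  have x: "x \<in> S" and y: "y \<in> T" using p by (auto simp: x_def y_def)
  \<comment> \<open>Opaque names for the values and derivatives in the chart make the final
    cancellation an identity of polynomials in them.\<close>
  define n where "n z u v w = DD (\<lambda>x. \<nu> i x [fst u, fst v, fst w]) x (fst z)" for z u v w :: "'e \<times> 'f"
  define m where "m z u v w = DD (\<lambda>y. \<mu> j y [snd u, snd v, snd w]) y (snd z)" for z u v w :: "'e \<times> 'f"
  define f' where "f' z u v = DD (\<lambda>x. N.F x (fst u) (fst v)) x (fst z)" for z u v :: "'e \<times> 'f"
  define g' where "g' z u v = DD (\<lambda>y. X.F y (snd u) (snd v)) y (snd z)" for z u v :: "'e \<times> 'f"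
  define a' where "a' z u = DD (\<lambda>x. \<alpha> i x [fst u]) x (fst z)" for z u :: "'e \<times> 'f"
  define b' where "b' z u = DD (\<lambda>y. \<beta> j y [snd u]) y (snd z)" for z u :: "'e \<times> 'f"
  define f where "f u v = N.F x (fst u) (fst v)" for u v :: "'e \<times> 'f"
  define g where "g u v = X.F y (snd u) (snd v)" for u v :: "'e \<times> 'f"
  define a where "a u = \<alpha> i x [fst u]" for u :: "'e \<times> 'f"
  define b where "b u = \<beta> j y [snd u]" for u :: "'e \<times> 'f"
  have D: "DD (\<lambda>q. H (i, j) q [u, v, w]) p z = c * n z u v w
    + l * (f' z u v * b w + f u v * b' z w + (f' z v w * b u + f v w * b' z u) + (f' z w u * b v + f w u * b' z v))
    + l * (g' z v w * a u + g v w * a' z u + (g' z w u * a v + g w u * a' z v) + (g' z u v * a w + g u v * a' z w))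
    + d * m z u v w" for z u v w
  proof -
    have "DD (\<lambda>q. H (i, j) q [u, v, w]) p = DD (\<lambda>q. H0 c l d q u v w) p"
      by (rule DD_cong[OF open_ST p H])
    then show ?thesis
      by (simp only: DD_H0[OF p] n_def m_def f'_def g'_def a'_def b'_def f_def g_def a_def b_def x_def y_def)
  qed
  have nm: "n z u v w = n u z v w - n v z u w + n w z u v" "m z u v w = m u z v w - m v z u w + m w z u v" for z u v w
    using N.d_nu[OF x, of "fst v" "fst w" "fst u" "fst z"] N.d_nu[OF x, of "fst u" "fst v" "fst w" "fst z"]
      X.d_nu[OF y, of "snd u" "snd v" "snd w" "snd z"]
    unfolding n_def m_def by linarith+
  have sk: "f v u = - f u v" "g v u = - g u v" "f' z v u = - f' z u v" "g' z v u = - g' z u v" for z u v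
    unfolding f_def g_def f'_def g'_def by (rule N.F_skew[OF x] X.F_skew[OF y] N.DD_F_skew[OF x] X.DD_F_skew[OF y])+
  have fg: "f' w u v = f' v u w - f' u v w" "g' w u v = g' v u w - g' u v w" for u v w
    using N.d_F[OF x, of "fst v" "fst w" "fst u"] X.d_F[OF y, of "snd v" "snd w" "snd u"]
    unfolding f'_def g'_def by linarith+
  have ab: "a' v u = a' u v + f u v" "b' v u = b' u v - g u v" for u v
    using N.d_alpha[OF x, of "fst v" "fst u"] X.d_alpha[OF y, of "snd v" "snd u"]
    unfolding a'_def b'_def f_def g_def by linarith+
  have "ext_d H (i, j) p [u0, u1, u2, u3] =
      DD (\<lambda>q. H (i, j) q [u1, u2, u3]) p u0 - DD (\<lambda>q. H (i, j) q [u0, u2, u3]) p u1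
      + DD (\<lambda>q. H (i, j) q [u0, u1, u3]) p u2 - DD (\<lambda>q. H (i, j) q [u0, u1, u2]) p u3"
    by (simp add: ext_d_def numeral_eq_Suc)
  also have "\<dots> = 0"
    \<comment> \<open>The instances bring skew arguments and derivative directions into one fixed
      order; the remaining terms cancel as polynomials.\<close>
    unfolding D nm[of u0 u1 u2 u3] sk(1,2)[of u3 u1] sk(1,2)[of u3 u0] sk(1,2)[of u2 u0]
      sk(3,4)[of _ u3 u1] sk(3,4)[of _ u3 u0] sk(3,4)[of _ u2 u0]
      ab[of u1 u0] ab[of u2 u0] ab[of u3 u0] ab[of u2 u1] ab[of u3 u1] ab[of u3 u2]
      fg[of u2 u0 u1] fg[of u3 u0 u1] fg[of u3 u0 u2] fg[of u3 u1 u2]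
    by (simp add: algebra_simps)
  finally show ?thesis .
qed

lemma H0_skew:
  assumes "p \<in> S \<times> T"
  shows "H0 c l d p v u w = - H0 c l d p u v w" "H0 c l d p u w v = - H0 c l d p u v w"
proof -
  have x: "fst p \<in> S" "snd p \<in> T" using assms by auto
  show "H0 c l d p v u w = - H0 c l d p u v w"
    using N.F_skew[OF x(1), of "fst v" "fst u"] N.F_skew[OF x(1), of "fst w" "fst u"] N.F_skew[OF x(1), of "fst w" "fst v"]
      X.F_skew[OF x(2), of "snd v" "snd u"] X.F_skew[OF x(2), of "snd w" "snd u"] X.F_skew[OF x(2), of "snd w" "snd v"]
      oriented_form3.nu_swap12[OF N.form3[OF x(1)], of "fst v" "fst u" "fst w"]
      oriented_form3.nu_swap12[OF X.form3[OF x(2)], of "snd v" "snd u" "snd w"]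
    by (simp add: H0_def algebra_simps)
  show "H0 c l d p u w v = - H0 c l d p u v w"
    using N.F_skew[OF x(1), of "fst v" "fst u"] N.F_skew[OF x(1), of "fst w" "fst u"] N.F_skew[OF x(1), of "fst w" "fst v"]
      X.F_skew[OF x(2), of "snd v" "snd u"] X.F_skew[OF x(2), of "snd w" "snd u"] X.F_skew[OF x(2), of "snd w" "snd v"]
      oriented_form3.nu_swap23[OF N.form3[OF x(1)], of "fst u" "fst w" "fst v"]
      oriented_form3.nu_swap23[OF X.form3[OF x(2)], of "snd u" "snd w" "snd v"]
    by (simp add: H0_def algebra_simps)
qed

lemma raise_gM:
  assumes p: "p \<in> S \<times> T"
  shows "raise (gM (i, j) p) (e, 0) = (raise (g i (fst p)) e, 0)"
    and "raise (gM (i, j) p) (0, f) = (0, raise (h j (snd p)) f)"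
proof -
  interpret a: metric_form "g i (fst p)" using N.metric p by auto
  interpret b: metric_form "h j (snd p)" using X.metric p by auto
  have z: "sharp (g i (fst p)) (\<lambda>v. 0) = 0" "sharp (h j (snd p)) (\<lambda>v. 0) = 0"
    by (rule a.sharp_unique b.sharp_unique, simp add: a.g_lin b.g_lin)+
  have l: "linear (\<lambda>v :: 'e \<times> 'f. v \<bullet> q)" for q
    by (rule bounded_linear.linear[OF bounded_linear_inner_left])
  show "raise (gM (i, j) p) (e, 0) = (raise (g i (fst p)) e, 0)"
    and "raise (gM (i, j) p) (0, f) = (0, raise (h j (snd p)) f)"
    unfolding raise_def sharp_gM[OF p l] by (simp_all add: inner_prod_def z)
qed

lemma H0_pure:
  assumes p: "p \<in> S \<times> T"
  shows "H0 c l d p (u, 0) (v, 0) (w, 0) = c * \<nu> i (fst p) [u, v, w]"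
    and "H0 c l d p (u, 0) (v, 0) (0, q) = l * N.F (fst p) u v * \<beta> j (snd p) [q]"
    and "H0 c l d p (u, 0) (0, r) (0, q) = l * \<alpha> i (fst p) [u] * X.F (snd p) r q"
    and "H0 c l d p (0, k) (0, r) (0, q) = d * \<mu> j (snd p) [k, r, q]"
proof -
  have x: "fst p \<in> S" "snd p \<in> T" using p by auto
  interpret a: oriented_form3 "g i (fst p)" "\<nu> i (fst p)" "- 1" by (rule N.form3[OF x(1)])
  interpret b: oriented_form3 "h j (snd p)" "\<mu> j (snd p)" 1 by (rule X.form3[OF x(2)])
  have z: "\<alpha> i (fst p) [0] = 0" "\<beta> j (snd p) [0] = 0"
    using linear_0[OF N.linear_alpha[OF x(1)]] linear_0[OF X.linear_alpha[OF x(2)]] by auto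
  show "H0 c l d p (u, 0) (v, 0) (w, 0) = c * \<nu> i (fst p) [u, v, w]"
    and "H0 c l d p (u, 0) (v, 0) (0, q) = l * N.F (fst p) u v * \<beta> j (snd p) [q]"
    and "H0 c l d p (u, 0) (0, r) (0, q) = l * \<alpha> i (fst p) [u] * X.F (snd p) r q"
    and "H0 c l d p (0, k) (0, r) (0, q) = d * \<mu> j (snd p) [k, r, q]"
    by (simp_all add: H0_def N.F_def X.F_def a.nu_lin b.nu_lin z)
qed

text \<open>The sign of each block is that of the factor whose volume form or two-form is squared.
  The pure blocks give -6 c^2 and 6 c^2; the mixed blocks give -2 and 2 times l^2 |\<alpha>|^2
  |\<beta>|^2, each with multiplicity 3.\<close>

lemma isotropic_H0:
  assumes p: "p \<in> S \<times> T"
  shows "(\<Sum>a\<in>Basis. \<Sum>b\<in>Basis. \<Sum>d\<in>Basis. H0 c l c p a b d *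
    H0 c l c p (raise (gM (i, j) p) a) (raise (gM (i, j) p) b) (raise (gM (i, j) p) d)) = 0"
proof -
  let ?r = "raise (gM (i, j) p)" and ?x = "fst p" and ?y = "snd p"
  let ?t = "\<lambda>a b d. H0 c l c p a b d * H0 c l c p (?r a) (?r b) (?r d)"
  have x: "?x \<in> S" "?y \<in> T" using p by auto
  interpret a: oriented_form3 "g i ?x" "\<nu> i ?x" "- 1" by (rule N.form3[OF x(1)])
  interpret b: oriented_form3 "h j ?y" "\<mu> j ?y" 1 by (rule X.form3[OF x(2)])
  have s1: "?t b a d = ?t a b d" for a b d
    using H0_skew(1)[OF p, of c l c b a d] H0_skew(1)[OF p, of c l c "?r b" "?r a" "?r d"] by simp
  have s2: "?t a d b = ?t a b d" for a b d
    using H0_skew(2)[OF p, of c l c a d b] H0_skew(2)[OF p, of c l c "?r a" "?r d" "?r b"] by simp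
  have eN: "g i ?x [e, N.a ?x] = \<alpha> i ?x [e]" for e
    using N.g_a[OF x(1), of e] a.sym[of e "N.a ?x"] by simp
  have eX: "h j ?y [e, X.a ?y] = \<beta> j ?y [e]" for e
    using X.g_a[OF x(2), of e] b.sym[of e "X.a ?y"] by simp
  have q1: "(\<Sum>e\<in>Basis. \<alpha> i ?x [e] * \<alpha> i ?x [raise (g i ?x) e]) = g i ?x [N.a ?x, N.a ?x]"
    using a.contract_raise(1)[OF a.lin_right[of "N.a ?x"], of "N.a ?x"] by (simp add: eN N.g_a[OF x(1)])
  have q2: "(\<Sum>e\<in>Basis. \<beta> j ?y [e] * \<beta> j ?y [raise (h j ?y) e]) = h j ?y [X.a ?y, X.a ?y]"
    using b.contract_raise(1)[OF b.lin_right[of "X.a ?y"], of "X.a ?y"] by (simp add: eX X.g_a[OF x(2)])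
  have 1: "(\<Sum>a\<in>Basis. \<Sum>b\<in>Basis. \<Sum>d\<in>Basis. ?t (a, 0) (b, 0) (d, 0)) = - 6 * c * c"
  proof -
    have "(\<Sum>a\<in>Basis. \<Sum>b\<in>Basis. \<Sum>d\<in>Basis. ?t (a, 0) (b, 0) (d, 0)) = (c * c) *
      (\<Sum>a\<in>Basis. \<Sum>b\<in>Basis. \<Sum>d\<in>Basis. \<nu> i ?x [a, b, d] * \<nu> i ?x [raise (g i ?x) a, raise (g i ?x) b, raise (g i ?x) d])"
      by (simp add: H0_pure[OF p] raise_gM[OF p] sum_distrib_left mult_ac)
    then show ?thesis by (simp add: a.contract_nu_3)
  qed
  have 4: "(\<Sum>a\<in>Basis. \<Sum>b\<in>Basis. \<Sum>d\<in>Basis. ?t (0, a) (0, b) (0, d)) = 6 * c * c"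
  proof -
    have "(\<Sum>a\<in>Basis. \<Sum>b\<in>Basis. \<Sum>d\<in>Basis. ?t (0, a) (0, b) (0, d)) = (c * c) *
      (\<Sum>a\<in>Basis. \<Sum>b\<in>Basis. \<Sum>d\<in>Basis. \<mu> j ?y [a, b, d] * \<mu> j ?y [raise (h j ?y) a, raise (h j ?y) b, raise (h j ?y) d])"
      by (simp add: H0_pure[OF p] raise_gM[OF p] sum_distrib_left mult_ac)
    then show ?thesis by (simp add: b.contract_nu_3)
  qed
  have 2: "(\<Sum>a\<in>Basis. \<Sum>b\<in>Basis. \<Sum>d\<in>Basis. ?t (a, 0) (b, 0) (0, d)) =
      - 2 * l * l * g i ?x [N.a ?x, N.a ?x] * h j ?y [X.a ?y, X.a ?y]"
  proof -
    have "(\<Sum>a\<in>Basis. \<Sum>b\<in>Basis. \<Sum>d\<in>Basis. ?t (a, 0) (b, 0) (0, d)) =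
      (\<Sum>a\<in>Basis. \<Sum>b\<in>Basis. \<Sum>d\<in>Basis. (l * N.F ?x a b * \<beta> j ?y [d]) *
        (l * N.F ?x (raise (g i ?x) a) (raise (g i ?x) b) * \<beta> j ?y [raise (h j ?y) d]))"
      by (simp add: H0_pure[OF p] raise_gM[OF p])
    also have "\<dots> = (\<Sum>a\<in>Basis. \<Sum>b\<in>Basis. (l * N.F ?x a b) * (l * N.F ?x (raise (g i ?x) a) (raise (g i ?x) b)))
        * h j ?y [X.a ?y, X.a ?y]"
      unfolding sum_factor q2 ..
    also have "(\<Sum>a\<in>Basis. \<Sum>b\<in>Basis. (l * N.F ?x a b) * (l * N.F ?x (raise (g i ?x) a) (raise (g i ?x) b))) =
        (l * l) * (\<Sum>a\<in>Basis. \<Sum>b\<in>Basis. N.F ?x a b * N.F ?x (raise (g i ?x) a) (raise (g i ?x) b))"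
      by (simp add: sum_distrib_left mult_ac)
    finally show ?thesis by (simp add: N.F_def a.contract_nu_2)
  qed
  have 3: "(\<Sum>a\<in>Basis. \<Sum>b\<in>Basis. \<Sum>d\<in>Basis. ?t (a, 0) (0, b) (0, d)) =
      2 * l * l * g i ?x [N.a ?x, N.a ?x] * h j ?y [X.a ?y, X.a ?y]"
  proof -
    have "(\<Sum>a\<in>Basis. \<Sum>b\<in>Basis. \<Sum>d\<in>Basis. ?t (a, 0) (0, b) (0, d)) =
      (\<Sum>a\<in>Basis. \<Sum>b\<in>Basis. \<Sum>d\<in>Basis. (\<alpha> i ?x [a] * (l * X.F ?y b d)) *
        (\<alpha> i ?x [raise (g i ?x) a] * (l * X.F ?y (raise (h j ?y) b) (raise (h j ?y) d))))"
      by (simp add: H0_pure[OF p] raise_gM[OF p] mult_ac)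
    also have "\<dots> = g i ?x [N.a ?x, N.a ?x] *
        (\<Sum>a\<in>Basis. \<Sum>b\<in>Basis. (l * X.F ?y a b) * (l * X.F ?y (raise (h j ?y) a) (raise (h j ?y) b)))"
      unfolding sum_factor' q1 ..
    also have "(\<Sum>a\<in>Basis. \<Sum>b\<in>Basis. (l * X.F ?y a b) * (l * X.F ?y (raise (h j ?y) a) (raise (h j ?y) b))) =
        (l * l) * (\<Sum>a\<in>Basis. \<Sum>b\<in>Basis. X.F ?y a b * X.F ?y (raise (h j ?y) a) (raise (h j ?y) b))"
      by (simp add: sum_distrib_left mult_ac)
    finally show ?thesis by (simp add: X.F_def b.contract_nu_2)
  qed
  show ?thesis
    by (rule trans[OF sum_symmetric_prod[of ?t]]) (fact s1, fact s2, simp add: 1 2 3 4)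
qed

end

section \<open>The Hodge dual of the flux\<close>

text \<open>An abstract six-dimensional volume form: any value is computed by splitting the
  arguments into their components in the factors and sorting these until one of the two block
  formulas applies.\<close>

locale chart_pair_volume = chart_pair +
  fixes p and nuM :: "('b \<times> 'd) list \<Rightarrow> real"
  assumes p: "p \<in> S \<times> T"
    and ml: "multilinear 6 nuM" and alt: "alternating 6 nuM"
    and block1: "nuM [(a, 0), (b, 0), (d, 0), u, v, w] = \<nu> i (fst p) [a, b, d] * \<mu> j (snd p) [snd u, snd v, snd w]"
    and block2: "nuM [u, v, w, (0, a'), (0, b'), (0, d')] = \<nu> i (fst p) [fst u, fst v, fst w] * \<mu> j (snd p) [a', b', d']"
begin

lemma swaps:
  "nuM [y1, y0, y2, y3, y4, y5] = - nuM [y0, y1, y2, y3, y4, y5]"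
  "nuM [y0, y2, y1, y3, y4, y5] = - nuM [y0, y1, y2, y3, y4, y5]"
  "nuM [y0, y1, y3, y2, y4, y5] = - nuM [y0, y1, y2, y3, y4, y5]"
  "nuM [y0, y1, y4, y3, y2, y5] = - nuM [y0, y1, y2, y3, y4, y5]"
  "nuM [y0, y1, y5, y3, y4, y2] = - nuM [y0, y1, y2, y3, y4, y5]"
  "nuM [y0, y3, y2, y1, y4, y5] = - nuM [y0, y1, y2, y3, y4, y5]"
  "nuM [y0, y4, y2, y3, y1, y5] = - nuM [y0, y1, y2, y3, y4, y5]"
  "nuM [y3, y1, y2, y0, y4, y5] = - nuM [y0, y1, y2, y3, y4, y5]"
  using alternating_swap[OF ml alt, of "[y0, y1, y2, y3, y4, y5]" 0 1]
    alternating_swap[OF ml alt, of "[y0, y1, y2, y3, y4, y5]" 1 2]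
    alternating_swap[OF ml alt, of "[y0, y1, y2, y3, y4, y5]" 2 3]
    alternating_swap[OF ml alt, of "[y0, y1, y2, y3, y4, y5]" 2 4]
    alternating_swap[OF ml alt, of "[y0, y1, y2, y3, y4, y5]" 2 5]
    alternating_swap[OF ml alt, of "[y0, y1, y2, y3, y4, y5]" 1 3]
    alternating_swap[OF ml alt, of "[y0, y1, y2, y3, y4, y5]" 1 4]
    alternating_swap[OF ml alt, of "[y0, y1, y2, y3, y4, y5]" 0 3]
  by (simp_all add: numeral_eq_Suc)

lemma split3:
  "nuM [y0, y1, y2, u, y4, y5] = nuM [y0, y1, y2, (fst u, 0), y4, y5] + nuM [y0, y1, y2, (0, snd u), y4, y5]"
  "nuM [y0, y1, y2, y3, u, y5] = nuM [y0, y1, y2, y3, (fst u, 0), y5] + nuM [y0, y1, y2, y3, (0, snd u), y5]"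
  "nuM [y0, y1, y2, y3, y4, u] = nuM [y0, y1, y2, y3, y4, (fst u, 0)] + nuM [y0, y1, y2, y3, y4, (0, snd u)]"
proof -
  have l: "linear (\<lambda>v. nuM ([y0, y1, y2, y3, y4, y5][k := v]))" if "k < 6" for k y0 y1 y2 y3 y4 y5
  proof -
    have "length [y0, y1, y2, y3, y4, y5] = 6" by simp
    then show ?thesis using ml that unfolding multilinear_def by blast
  qed
  have e: "(fst u, 0) + (0, snd u) = u" by simp
  show "nuM [y0, y1, y2, u, y4, y5] = nuM [y0, y1, y2, (fst u, 0), y4, y5] + nuM [y0, y1, y2, (0, snd u), y4, y5]"
    using linear_add[OF l[of 3 y0 y1 y2 u y4 y5], of "(fst u, 0)" "(0, snd u)"] e by (simp add: numeral_eq_Suc)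
  show "nuM [y0, y1, y2, y3, u, y5] = nuM [y0, y1, y2, y3, (fst u, 0), y5] + nuM [y0, y1, y2, y3, (0, snd u), y5]"
    using linear_add[OF l[of 4 y0 y1 y2 y3 u y5], of "(fst u, 0)" "(0, snd u)"] e by (simp add: numeral_eq_Suc)
  show "nuM [y0, y1, y2, y3, y4, u] = nuM [y0, y1, y2, y3, y4, (fst u, 0)] + nuM [y0, y1, y2, y3, y4, (0, snd u)]"
    using linear_add[OF l[of 5 y0 y1 y2 y3 y4 u], of "(fst u, 0)" "(0, snd u)"] e by (simp add: numeral_eq_Suc)
qed

text \<open>Components in N of the last three arguments are exchanged with the X vectors among the
  first three. This takes one, two or three transpositions, hence the signs -, +, -; the cyclic sums
  run over the choice of the arguments that are exchanged.\<close>

lemma nuM_mixed: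
  shows "nuM [(a, 0), (b, 0), (0, d'), u, v, w] =
      - (\<nu> i (fst p) [a, b, fst u] * \<mu> j (snd p) [d', snd v, snd w]
        + \<nu> i (fst p) [a, b, fst v] * \<mu> j (snd p) [d', snd w, snd u]
        + \<nu> i (fst p) [a, b, fst w] * \<mu> j (snd p) [d', snd u, snd v])" (is ?A)
    and "nuM [(a, 0), (0, b'), (0, d'), u, v, w] =
      \<nu> i (fst p) [a, fst v, fst w] * \<mu> j (snd p) [b', d', snd u]
        + \<nu> i (fst p) [a, fst w, fst u] * \<mu> j (snd p) [b', d', snd v]
        + \<nu> i (fst p) [a, fst u, fst v] * \<mu> j (snd p) [b', d', snd w]" (is ?B)
    and "nuM [(0, a'), (0, b'), (0, d'), u, v, w] =
      - (\<nu> i (fst p) [fst u, fst v, fst w] * \<mu> j (snd p) [a', b', d'])" (is ?C)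
proof -
  have x: "fst p \<in> S" "snd p \<in> T" using p by auto
  interpret a: oriented_form3 "g i (fst p)" "\<nu> i (fst p)" "- 1" by (rule N.form3[OF x(1)])
  interpret b: oriented_form3 "h j (snd p)" "\<mu> j (snd p)" 1 by (rule X.form3[OF x(2)])
  have "nuM [(a, 0), (b, 0), (0, d'), (fst u, 0), v, w] = - (\<nu> i (fst p) [a, b, fst u] * \<mu> j (snd p) [d', snd v, snd w])"
    using swaps(3)[of "(a, 0)" "(b, 0)" "(0, d')" "(fst u, 0)" v w] by (simp add: block1)
  moreover have "nuM [(a, 0), (b, 0), (0, d'), (0, snd u), (fst v, 0), w] = - (\<nu> i (fst p) [a, b, fst v] * \<mu> j (snd p) [d', snd w, snd u])"
    using swaps(4)[of "(a, 0)" "(b, 0)" "(0, d')" "(0, snd u)" "(fst v, 0)" w]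
      b.nu_cyc[of d' "snd w" "snd u"] by (simp add: block1)
  moreover have "nuM [(a, 0), (b, 0), (0, d'), (0, snd u), (0, snd v), w] = - (\<nu> i (fst p) [a, b, fst w] * \<mu> j (snd p) [d', snd u, snd v])"
  proof -
    have "nuM [(a, 0), (b, 0), (0, d'), (0, snd u), (0, snd v), (fst w, 0)] = - (\<nu> i (fst p) [a, b, fst w] * \<mu> j (snd p) [d', snd u, snd v])"
      using swaps(5)[of "(a, 0)" "(b, 0)" "(0, d')" "(0, snd u)" "(0, snd v)" "(fst w, 0)"]
        b.nu_cyc[of "snd u" "snd v" d'] by (simp add: block1)
    \<comment> \<open>Four of the vectors are tangent to the three-dimensional X.\<close>
    moreover have "nuM [(a, 0), (b, 0), (0, d'), (0, snd u), (0, snd v), (0, snd w)] = 0"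
      unfolding block2 by (simp add: a.nu_lin)
    ultimately show ?thesis using split3(3)[of _ _ _ _ _ w] by simp
  qed
  ultimately show ?A
    using split3(1)[of "(a, 0)" "(b, 0)" "(0, d')" u v w] split3(2)[of "(a, 0)" "(b, 0)" "(0, d')" "(0, snd u)" v w]
      by linarith
  have "nuM [(a, 0), (0, b'), (0, d'), (0, snd u), v, w] = \<nu> i (fst p) [a, fst v, fst w] * \<mu> j (snd p) [b', d', snd u]"
    using swaps(7)[of "(a, 0)" "(0, b')" "(0, d')" "(0, snd u)" v w] swaps(5)[of "(a, 0)" v "(0, d')" "(0, snd u)" "(0, b')" w]
      b.nu_cyc[of b' d' "snd u"] by (simp add: block2)
  moreover have "nuM [(a, 0), (0, b'), (0, d'), (fst u, 0), (0, snd v), w] =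
      \<nu> i (fst p) [a, fst w, fst u] * \<mu> j (snd p) [b', d', snd v]"
    using swaps(6)[of "(a, 0)" "(0, b')" "(0, d')" "(fst u, 0)" "(0, snd v)" w]
      swaps(5)[of "(a, 0)" "(fst u, 0)" "(0, d')" "(0, b')" "(0, snd v)" w]
      a.nu_swap23[of a "fst w" "fst u"] b.nu_swap23[of b' d' "snd v"] by (simp add: block2)
  moreover have "nuM [(a, 0), (0, b'), (0, d'), (fst u, 0), (fst v, 0), w] =
      \<nu> i (fst p) [a, fst u, fst v] * \<mu> j (snd p) [b', d', snd w]"
    using swaps(6)[of "(a, 0)" "(0, b')" "(0, d')" "(fst u, 0)" "(fst v, 0)" w]
      swaps(4)[of "(a, 0)" "(fst u, 0)" "(0, d')" "(0, b')" "(fst v, 0)" w] by (simp add: block1)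
  ultimately show ?B
    using split3(1)[of "(a, 0)" "(0, b')" "(0, d')" u v w] split3(2)[of "(a, 0)" "(0, b')" "(0, d')" "(fst u, 0)" v w]
    by linarith
  show ?C
    using swaps(8)[of "(0, a')" "(0, b')" "(0, d')" u v w] swaps(7)[of u "(0, b')" "(0, d')" "(0, a')" v w]
      swaps(5)[of u v "(0, d')" "(0, a')" "(0, b')" w] by (simp add: block2)
qed

text \<open>The pure blocks exchange the two volume forms: one picks up the sign s = -1 of N, the
  other the sign of three transpositions, so \<open>c\<close> changes sign. The mixed blocks
  exchange the two mixed terms: in one, the sign of a transposition cancels against \<ast>F =
  -\<alpha> on N, and the other has no sign, so \<open>l\<close> is preserved. The factor 6 cancels
  the 3! in \<open>hodge\<close>; it is 6 for the pure blocks and multiplicity 3 times the 2 of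
  \<open>hodge_two\<close> for the mixed ones.\<close>

lemma hodge_H0:
  "(\<Sum>a\<in>Basis. \<Sum>b\<in>Basis. \<Sum>d\<in>Basis. H0 c l c p (raise (gM (i, j) p) a) (raise (gM (i, j) p) b) (raise (gM (i, j) p) d)
    * nuM [a, b, d, u, v, w]) = 6 * H0 (- c) l (- c) p u v w"
proof -
  let ?r = "raise (gM (i, j) p)" and ?x = "fst p" and ?y = "snd p"
  let ?t = "\<lambda>a b d. H0 c l c p (?r a) (?r b) (?r d) * nuM [a, b, d, u, v, w]"
  have x: "?x \<in> S" "?y \<in> T" using p by auto
  interpret a: oriented_form3 "g i ?x" "\<nu> i ?x" "- 1" by (rule N.form3[OF x(1)])
  interpret b: oriented_form3 "h j ?y" "\<mu> j ?y" 1 by (rule X.form3[OF x(2)])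
  have s1: "?t b a d = ?t a b d" for a b d
    using H0_skew(1)[OF p, of c l c "?r b" "?r a" "?r d"] swaps(1)[of b a d u v w] by simp
  have s2: "?t a d b = ?t a b d" for a b d
    using H0_skew(2)[OF p, of c l c "?r a" "?r d" "?r b"] swaps(2)[of a d b u v w] by simp
  have 1: "(\<Sum>a\<in>Basis. \<Sum>b\<in>Basis. \<Sum>d\<in>Basis. ?t (a, 0) (b, 0) (d, 0)) =
      - 6 * c * \<mu> j ?y [snd u, snd v, snd w]"
  proof -
    have "(\<Sum>a\<in>Basis. \<Sum>b\<in>Basis. \<Sum>d\<in>Basis. ?t (a, 0) (b, 0) (d, 0)) = (c * \<mu> j ?y [snd u, snd v, snd w]) *
      (\<Sum>a\<in>Basis. \<Sum>b\<in>Basis. \<Sum>d\<in>Basis. \<nu> i ?x [a, b, d] * \<nu> i ?x [raise (g i ?x) a, raise (g i ?x) b, raise (g i ?x) d])"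
      by (simp add: H0_pure[OF p] raise_gM[OF p] block1 sum_distrib_left mult_ac)
    then show ?thesis by (simp add: a.contract_nu_3)
  qed
  have 4: "(\<Sum>a\<in>Basis. \<Sum>b\<in>Basis. \<Sum>d\<in>Basis. ?t (0, a) (0, b) (0, d)) =
      - 6 * c * \<nu> i ?x [fst u, fst v, fst w]"
  proof -
    have "(\<Sum>a\<in>Basis. \<Sum>b\<in>Basis. \<Sum>d\<in>Basis. ?t (0, a) (0, b) (0, d)) = - (c * \<nu> i ?x [fst u, fst v, fst w]) *
      (\<Sum>a\<in>Basis. \<Sum>b\<in>Basis. \<Sum>d\<in>Basis. \<mu> j ?y [a, b, d] * \<mu> j ?y [raise (h j ?y) a, raise (h j ?y) b, raise (h j ?y) d])"
      by (simp add: H0_pure[OF p] raise_gM[OF p] nuM_mixed(3) sum_distrib_left sum_negf mult_ac)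
    then show ?thesis by (simp add: b.contract_nu_3)
  qed
  have hX: "(\<Sum>d\<in>Basis. \<beta> j ?y [raise (h j ?y) d] * \<mu> j ?y [d, q, q']) = X.F ?y q q'" for q q'
    unfolding X.F_def X.a_def by (rule b.hodge_one[OF X.linear_alpha[OF x(2)]])
  have hN: "(\<Sum>d\<in>Basis. \<alpha> i ?x [raise (g i ?x) d] * \<nu> i ?x [d, q, q']) = N.F ?x q q'" for q q'
    unfolding N.F_def N.a_def by (rule a.hodge_one[OF N.linear_alpha[OF x(1)]])
  have kX: "(\<Sum>e\<in>Basis. \<Sum>f\<in>Basis. X.F ?y (raise (h j ?y) e) (raise (h j ?y) f) * \<mu> j ?y [e, f, q]) = 2 * \<beta> j ?y [q]" for q
    unfolding X.F_def b.hodge_two X.g_a[OF x(2)] by simp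
  have kN: "(\<Sum>e\<in>Basis. \<Sum>f\<in>Basis. N.F ?x (raise (g i ?x) e) (raise (g i ?x) f) * \<nu> i ?x [e, f, q]) = - 2 * \<alpha> i ?x [q]" for q
    unfolding N.F_def a.hodge_two N.g_a[OF x(1)] by simp
  have 2: "(\<Sum>a\<in>Basis. \<Sum>b\<in>Basis. \<Sum>d\<in>Basis. ?t (a, 0) (b, 0) (0, d)) = 2 * l *
      (\<alpha> i ?x [fst u] * X.F ?y (snd v) (snd w) + \<alpha> i ?x [fst v] * X.F ?y (snd w) (snd u)
        + \<alpha> i ?x [fst w] * X.F ?y (snd u) (snd v))"
  proof -
    let ?m = "\<lambda>u v w. \<Sum>a\<in>Basis. \<Sum>b\<in>Basis. \<Sum>d\<in>Basis.
      (N.F ?x (raise (g i ?x) a) (raise (g i ?x) b) * \<beta> j ?y [raise (h j ?y) d]) * (\<nu> i ?x [a, b, fst u] * \<mu> j ?y [d, snd v, snd w])"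
    have "(\<Sum>a\<in>Basis. \<Sum>b\<in>Basis. \<Sum>d\<in>Basis. ?t (a, 0) (b, 0) (0, d)) = - l * (?m u v w + ?m v w u + ?m w u v)"
      by (simp add: H0_pure[OF p] raise_gM[OF p] nuM_mixed(1) sum_distrib_left sum_subtractf sum_negf
          sum.distrib[symmetric] algebra_simps)
    then show ?thesis unfolding sum_factor kN hX by (simp add: algebra_simps)
  qed
  have 3: "(\<Sum>a\<in>Basis. \<Sum>b\<in>Basis. \<Sum>d\<in>Basis. ?t (a, 0) (0, b) (0, d)) = 2 * l *
      (N.F ?x (fst v) (fst w) * \<beta> j ?y [snd u] + N.F ?x (fst w) (fst u) * \<beta> j ?y [snd v]
        + N.F ?x (fst u) (fst v) * \<beta> j ?y [snd w])"
  proof -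
    let ?m = "\<lambda>u v w. \<Sum>a\<in>Basis. \<Sum>b\<in>Basis. \<Sum>d\<in>Basis.
      (\<alpha> i ?x [raise (g i ?x) a] * X.F ?y (raise (h j ?y) b) (raise (h j ?y) d)) * (\<nu> i ?x [a, fst v, fst w] * \<mu> j ?y [b, d, snd u])"
    have "(\<Sum>a\<in>Basis. \<Sum>b\<in>Basis. \<Sum>d\<in>Basis. ?t (a, 0) (0, b) (0, d)) = l * (?m u v w + ?m v w u + ?m w u v)"
      by (simp add: H0_pure[OF p] raise_gM[OF p] nuM_mixed(2) sum_distrib_left
          sum.distrib[symmetric] algebra_simps)
    then show ?thesis unfolding sum_factor' hN kX by (simp add: algebra_simps)
  qed
  have "(\<Sum>a\<in>Basis. \<Sum>b\<in>Basis. \<Sum>d\<in>Basis. ?t a b d) =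
    - 6 * c * \<mu> j ?y [snd u, snd v, snd w]
    + 3 * (2 * l * (\<alpha> i ?x [fst u] * X.F ?y (snd v) (snd w) + \<alpha> i ?x [fst v] * X.F ?y (snd w) (snd u)
        + \<alpha> i ?x [fst w] * X.F ?y (snd u) (snd v)))
    + 3 * (2 * l * (N.F ?x (fst v) (fst w) * \<beta> j ?y [snd u] + N.F ?x (fst w) (fst u) * \<beta> j ?y [snd v]
        + N.F ?x (fst u) (fst v) * \<beta> j ?y [snd w]))
    + - 6 * c * \<nu> i ?x [fst u, fst v, fst w]"
    unfolding 1[symmetric] 2[symmetric] 3[symmetric] 4[symmetric]
    by (rule sum_symmetric_prod) (fact s1, fact s2)
  also have "\<dots> = 6 * H0 (- c) l (- c) p u v w"
    by (simp add: H0_def algebra_simps)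
  finally show ?thesis .
qed

end

section \<open>From manifolds to charts\<close>

lemma length_2_conv: "length vs = 2 \<longleftrightarrow> (\<exists>u v. vs = [u, v])"
  and length_3_conv: "length vs = 3 \<longleftrightarrow> (\<exists>u v w. vs = [u, v, w])"
  by (auto simp: numeral_eq_Suc length_Suc_conv)

lemma multilinear_1: "multilinear 1 t \<Longrightarrow> linear (\<lambda>v. t [v])"
  unfolding multilinear_def by (drule spec[of _ "[0]"]) simp

lemma multilinear_2:
  assumes "multilinear 2 t"
  shows "bilinear (\<lambda>u v. t [u, v])"
proof -
  have "linear (\<lambda>v. t ([u, w][k := v]))" if "k < 2" for k u w
  proof -
    have "length [u, w] = 2" by simp
    then show ?thesis using assms that unfolding multilinear_def by blast
  qed
  from this[of 0] this[of 1] show ?thesis by (auto simp: bilinear_def)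
qed

lemma multilinear_bilinear:
  assumes "bilinear (\<lambda>u v. t [u, v])"
  shows "multilinear 2 t"
  unfolding multilinear_def length_2_conv
  using assms by (auto simp: bilinear_def less_2_cases_iff)

lemma multilinear_3I:
  assumes "\<And>v w. linear (\<lambda>u. t [u, v, w])" "\<And>u w. linear (\<lambda>v. t [u, v, w])" "\<And>u v. linear (\<lambda>w. t [u, v, w])"
  shows "multilinear 3 t"
  unfolding multilinear_def length_3_conv
  using assms by (auto simp: numeral_eq_Suc less_Suc_eq)

lemma alternating_3I:
  assumes "\<And>u v w. t [v, u, w] = - t [u, v, w]" "\<And>u v w. t [u, w, v] = - t [u, v, w :: 'e::euclidean_space]"
  shows "alternating 3 t"
proof -
  have 1: "t [u, u, w] = 0" "t [w, u, u] = 0" for u w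
    using assms(1)[of u u w] assms(2)[of w u u] by auto
  have "t [u, w, u] = 0" for u w
    using assms(1)[of u w u] 1(2)[of w u] by simp
  with 1 show ?thesis
    unfolding alternating_def length_3_conv
    by (auto simp: numeral_eq_Suc less_Suc_eq)
qed

lemma riemannian_metric_form:
  assumes "riemannian_metric M g" "x \<in> chart_img M i"
  shows "metric_form (g i x)"
proof
  show "bilinear (\<lambda>u v. g i x [u, v])"
    using assms by (intro multilinear_2) (auto simp: riemannian_metric_def symmetric_2tensor_def tensor_field_def)
  show "g i x [u, v] = g i x [v, u]" for u v
    using assms by (auto simp: riemannian_metric_def symmetric_2tensor_def)
  show "w = 0" if "\<And>v. g i x [w, v] = 0" for w
    using assms that[of w] unfolding riemannian_metric_def by (metis less_irrefl)
qed

text \<open>Pairing a vanishing combination with one frame vector isolates its coefficient. The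
  squares \<open>c j\<close> may have any sign, as needed for Lorentzian frames.\<close>

lemma orthonormal_independent:
  fixes b :: "'e::euclidean_space \<Rightarrow> 'e \<Rightarrow> real"
  assumes b: "bilinear b" and len: "length es = DIM('e)"
    and o: "\<And>j k. j < DIM('e) \<Longrightarrow> k < DIM('e) \<Longrightarrow> b (es ! j) (es ! k) = (if j = k then c j else 0)"
    and c: "\<And>j. j < DIM('e) \<Longrightarrow> c j \<noteq> 0"
  shows "span (set es) = UNIV"
proof -
  let ?n = "DIM('e)"
  have inj: "inj_on (\<lambda>j. es ! j) {..<?n}"
    using o c by (intro inj_onI) (metis lessThan_iff)
  have set: "set es = (\<lambda>j. es ! j) ` {..<?n}"
    using len by (auto simp: set_conv_nth)
  have "independent (set es)"
  proof (subst independent_explicit_finite_subsets, intro allI impI ballI)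
    fix A u v assume A: "A \<subseteq> set es" "finite A" and s: "(\<Sum>v\<in>A. u v *\<^sub>R v) = 0" and v: "v \<in> A"
    obtain k where k: "k < ?n" "v = es ! k" using v A set by auto
    have bv: "b w v = 0" if "w \<in> A - {v}" for w
      using that A set o k by (metis (no_types, lifting) DiffE imageE insertI1 lessThan_iff subsetD)
    have "0 = b (\<Sum>v\<in>A. u v *\<^sub>R v) v"
      using s bilinear_lzero[OF b] by simp
    also have "\<dots> = (\<Sum>w\<in>A. u w * b w v)"
      using linear_sum[of "\<lambda>w. b w v" "\<lambda>w. u w *\<^sub>R w" A] b by (simp add: bilinear_def bilinear_lmul[OF b])
    also have "\<dots> = u v * b v v"
      using A(2) v bv by (subst sum.remove[of _ v]) auto
    finally show "u v = 0" using o[of k k] c[of k] k by simp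
  qed
  moreover have "card (set es) = ?n"
    unfolding set using inj by (simp add: card_image)
  ultimately show ?thesis
    using card_eq_dim[of "set es" UNIV] by auto
qed

text \<open>Nondegeneracy is contained in the definition only through the orthonormal frame. The
  frame spans, and a vector orthogonal to everything has all its coefficients in it equal to
  zero.\<close>

lemma lorentzian_metric_form:
  fixes M :: "('i, 'a, 'e::euclidean_space) atlas"
  assumes "lorentzian_metric M g" "x \<in> chart_img M i"
  shows "metric_form (g i x)"
proof
  show bil: "bilinear (\<lambda>u v. g i x [u, v])"
    using assms by (intro multilinear_2) (auto simp: lorentzian_metric_def symmetric_2tensor_def tensor_field_def)
  show "g i x [u, v] = g i x [v, u]" for u v
    using assms by (auto simp: lorentzian_metric_def symmetric_2tensor_def)
  fix w assume w: "\<And>v. g i x [w, v] = 0"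
  obtain es where es: "length es = DIM('e)" "\<And>j k. j < DIM('e) \<Longrightarrow> k < DIM('e) \<Longrightarrow>
      g i x [es ! j, es ! k] = (if j = k then (if j = 0 then - 1 else 1) else 0)"
    using assms unfolding lorentzian_metric_def by meson
  have sp: "span (set es) = UNIV"
    by (rule orthonormal_independent[OF bil es(1), of "\<lambda>j. if j = 0 then - 1 else 1"]) (auto simp: es(2))
  have fin: "finite (set es)" by simp
  have "w \<in> range (\<lambda>u. \<Sum>v\<in>set es. u v *\<^sub>R v)"
    using sp span_finite[OF fin] by simp
  then obtain u where u: "w = (\<Sum>v\<in>set es. u v *\<^sub>R v)" by blast
  have "u (es ! k) = 0" if k: "k < DIM('e)" for k
  proof -
    have "0 = g i x [w, es ! k]" using w by simp
    also have "\<dots> = (\<Sum>v\<in>set es. u v * g i x [v, es ! k])"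
      unfolding u using linear_sum[of "\<lambda>w. g i x [w, es ! k]" "\<lambda>w. u w *\<^sub>R w" "set es"] bil
      by (simp add: bilinear_def bilinear_lmul[OF bil])
    also have "\<dots> = u (es ! k) * g i x [es ! k, es ! k]"
    proof -
      have "g i x [v, es ! k] = 0" if "v \<in> set es - {es ! k}" for v
        using that k es by (metis (no_types, lifting) DiffE in_set_conv_nth insertI1)
      then show ?thesis using es(1) k by (subst sum.remove[of _ "es ! k"]) auto
    qed
    finally show ?thesis using es(2)[OF k k] by (auto split: if_splits)
  qed
  then have "u v = 0" if "v \<in> set es" for v
    using that es(1) by (metis in_set_conv_nth)
  then show "w = 0" unfolding u by simp
qed

text \<open>The 3 x 3 case of the fact that a positive definite form has positive Gram determinant,
  by two orthogonalisation steps without division: the 2 x 2 minor \<open>c\<close> is obtained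
  first, then the full determinant.\<close>

lemma positive_det_3:
  assumes "metric_form b" "\<And>v. v \<noteq> 0 \<Longrightarrow> b [v, v] > 0"
    and "x \<noteq> 0" "\<And>r. x \<noteq> r *\<^sub>R y" "y \<noteq> 0" "\<And>r q. z \<noteq> r *\<^sub>R x + q *\<^sub>R y"
  shows "b [x, x] * (b [y, y] * b [z, z] - b [y, z] * b [y, z]) - b [x, y] * (b [x, y] * b [z, z] - b [y, z] * b [x, z])
    + b [x, z] * (b [x, y] * b [y, z] - b [y, y] * b [x, z]) > 0" (is "?D > 0")
proof -
  interpret metric_form b by fact
  define c where "c = b [x, x] * b [y, y] - b [x, y] * b [x, y]"
  have c: "c > 0"
  proof -
    have "b [y, y] *\<^sub>R x - b [x, y] *\<^sub>R y \<noteq> 0"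
    proof
      assume "b [y, y] *\<^sub>R x - b [x, y] *\<^sub>R y = 0"
      then have "b [y, y] *\<^sub>R x = b [x, y] *\<^sub>R y" by simp
      from arg_cong[OF this, of "\<lambda>t. inverse (b [y, y]) *\<^sub>R t"]
      have "x = (inverse (b [y, y]) * b [x, y]) *\<^sub>R y"
        using assms(2)[OF assms(5)] by simp
      then show False using assms(4) by blast
    qed
    from assms(2)[OF this] have "b [y, y] * c > 0"
      unfolding g_lin sym[of y x] c_def by (simp add: algebra_simps)
    then show ?thesis using assms(2)[OF assms(5)] by (simp add: zero_less_mult_iff)
  qed
  \<comment> \<open>This is \<open>c\<close> times the component of \<open>z\<close> orthogonal to
    \<open>x\<close> and \<open>y\<close>, with denominators cleared; its square is \<open>c\<close>
    times the determinant.\<close>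
  define w where "w = c *\<^sub>R z + (b [x, y] * b [x, z] - b [x, x] * b [y, z]) *\<^sub>R y + (b [x, y] * b [y, z] - b [y, y] * b [x, z]) *\<^sub>R x"
  have "w \<noteq> 0"
  proof
    assume "w = 0"
    then have "c *\<^sub>R z = (b [y, y] * b [x, z] - b [x, y] * b [y, z]) *\<^sub>R x + (b [x, x] * b [y, z] - b [x, y] * b [x, z]) *\<^sub>R y"
      unfolding w_def by (simp add: algebra_simps)
    from arg_cong[OF this, of "\<lambda>t. inverse c *\<^sub>R t"] have "z = (inverse c * (b [y, y] * b [x, z] - b [x, y] * b [y, z])) *\<^sub>R x
       + (inverse c * (b [x, x] * b [y, z] - b [x, y] * b [x, z])) *\<^sub>R y"
      using c by (simp add: scaleR_add_right)
    then show False using assms(6) by blast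
  qed
  from assms(2)[OF this] have "c * ?D > 0"
    unfolding w_def g_lin sym[of y x] sym[of z x] sym[of z y] c_def by (simp add: algebra_simps)
  then show ?thesis using c by (simp add: zero_less_mult_iff)
qed

lemma model_basis_3:
  fixes M :: "('i, 'a::{t2_space, second_countable_topology}, 'e::euclidean_space) atlas"
  assumes "oriented_manifold M" "DIM('e) = 3"
  obtains b0 b1 b2 where "model_basis M = [b0, b1, b2]" "distinct [b0, b1, b2]" "Basis = {b0, b1, b2}"
proof -
  have m: "distinct (model_basis M)" "set (model_basis M) = Basis"
    using assms(1) by (auto simp: oriented_manifold_def)
  have "length (model_basis M) = 3" using basis_list_length[OF m] assms(2) by simp
  then obtain b0 b1 b2 where b: "model_basis M = [b0, b1, b2]"
    by (auto simp: length_3_conv)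
  then show ?thesis using that[OF b] m by auto
qed

definition gram_mat :: "('i, 'a, 'e::euclidean_space) atlas \<Rightarrow> ('i, 'e) tensor \<Rightarrow> 'i \<Rightarrow> 'e \<Rightarrow> real" where
  "gram_mat M g i x = det_nat DIM('e) (\<lambda>k l. g i x [model_basis M ! k, model_basis M ! l])"

lemma volume_form_gram: "volume_form M g i x vs = sqrt \<bar>gram_mat M g i x\<bar> * det_vectors (model_basis M) vs"
  by (simp add: volume_form_def gram_mat_def)

text \<open>Evaluated on an orthonormal frame, \<open>gram_det\<close> says that the Gram
  determinant times a square is -1.\<close>

lemma gram_mat_lorentzian:
  fixes M :: "('i, 'a::{t2_space, second_countable_topology}, 'e::euclidean_space) atlas"
  assumes M: "oriented_manifold M" "DIM('e) = 3" and g: "lorentzian_metric M g" and x: "x \<in> chart_img M i"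
  shows "gram_mat M g i x < 0"
proof -
  have m: "distinct (model_basis M)" "set (model_basis M) = Basis"
    using M(1) by (auto simp: oriented_manifold_def)
  note len = basis_list_length[OF m]
  interpret metric_form "g i x" by (rule lorentzian_metric_form[OF g x])
  obtain es where es: "length es = DIM('e)" "\<And>j k. j < DIM('e) \<Longrightarrow> k < DIM('e) \<Longrightarrow>
      g i x [es ! j, es ! k] = (if j = k then (if j = 0 then - 1 else 1) else 0)"
    using g x unfolding lorentzian_metric_def by meson
  have "det_nat 3 (\<lambda>j k. g i x [es ! j, es ! k]) = - 1"
    unfolding det_nat_3 using es(2) by (simp add: M(2))
  moreover have "det_nat 3 (\<lambda>j k. g i x [es ! j, es ! k]) =
      det_vectors (model_basis M) es * gram_mat M g i x * det_vectors (model_basis M) es"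
    using gram_det[OF m bil, of es es] es(1) len M(2) by (simp add: gram_mat_def)
  ultimately have "(det_vectors (model_basis M) es)\<^sup>2 * gram_mat M g i x = - 1"
    by (simp add: power2_eq_square mult_ac)
  then show ?thesis
    by (metis less_minus_one_simps(1) mult_nonneg_nonneg not_less zero_le_power2)
qed

lemma gram_mat_riemannian:
  fixes M :: "('i, 'a::{t2_space, second_countable_topology}, 'e::euclidean_space) atlas"
  assumes M: "oriented_manifold M" "DIM('e) = 3" and g: "riemannian_metric M g" and x: "x \<in> chart_img M i"
  shows "gram_mat M g i x > 0"
proof -
  interpret metric_form "g i x" by (rule riemannian_metric_form[OF g x])
  obtain b0 b1 b2 where b: "model_basis M = [b0, b1, b2]" "distinct [b0, b1, b2]" "Basis = {b0, b1, b2}"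
    using model_basis_3[OF M] .
  have ib: "b0 \<in> Basis" "b1 \<in> Basis" "b2 \<in> Basis" "b0 \<noteq> b1" "b0 \<noteq> b2" "b1 \<noteq> b2"
    using b by auto
  have i0: "b0 \<bullet> b0 = 1" "b1 \<bullet> b1 = 1" "b2 \<bullet> b2 = 1" "b1 \<bullet> b0 = 0" "b0 \<bullet> b2 = 0" "b1 \<bullet> b2 = 0"
    using ib by (simp_all add: inner_Basis)
  have n1: "b0 \<noteq> r *\<^sub>R b1" for r using i0 by (metis inner_scaleR_left mult_zero_right zero_neq_one)
  have n2: "b2 \<noteq> r *\<^sub>R b0 + q *\<^sub>R b1" for r q
    using i0 by (metis add.left_neutral inner_add_left inner_scaleR_left mult_zero_right zero_neq_one)
  have "0 < g i x [b0, b0] * (g i x [b1, b1] * g i x [b2, b2] - g i x [b1, b2] * g i x [b1, b2])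
    - g i x [b0, b1] * (g i x [b0, b1] * g i x [b2, b2] - g i x [b1, b2] * g i x [b0, b2])
    + g i x [b0, b2] * (g i x [b0, b1] * g i x [b1, b2] - g i x [b1, b1] * g i x [b0, b2])"
    by (rule positive_det_3[OF metric_form_axioms _ _ n1 _ n2])
      (use g x ib nonzero_Basis in \<open>auto simp: riemannian_metric_def\<close>)
  then show ?thesis
    using sym[of b1 b0] sym[of b2 b0] sym[of b2 b1]
    by (simp add: gram_mat_def M(2) det_nat_3 b(1) numeral_2_eq_2 algebra_simps)
qed

text \<open>The Gram identity comes from \<open>gram_det\<close>: the two square roots in the
  product of volume forms multiply to the absolute value of the Gram determinant, which is
  \<open>s\<close> times that determinant.\<close>

lemma chart3_contact:
  fixes M :: "('i, 'a::{t2_space, second_countable_topology}, 'e::euclidean_space) atlas"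
  assumes M: "eps_contact_metric M g \<alpha> \<epsilon>"
    and s: "riemannian_metric M g \<and> s = 1 \<or> lorentzian_metric M g \<and> s = - 1"
  shows "chart3 g i (chart_img M i) (volume_form M g) s \<alpha>"
proof -
  let ?S = "chart_img M i" and ?bs = "model_basis M"
  have or: "oriented_manifold M" and d: "DIM('e) = 3" and \<alpha>: "form_field M 1 \<alpha>"
    and h: "tensor_eq M 1 \<alpha> (hodge M g 2 (ext_d \<alpha>))"
    using M by (auto simp: eps_contact_metric_def)
  have m: "distinct ?bs" "set ?bs = Basis" using or by (auto simp: oriented_manifold_def)
  have len: "length ?bs = 3" using basis_list_length[OF m] d by simp
  have op: "open ?S" using or by (auto simp: oriented_manifold_def)
  have mf: "metric_form (g i y)" if "y \<in> ?S" for y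
    using s riemannian_metric_form[OF _ that] lorentzian_metric_form[OF _ that] by blast
  have tg: "tensor_field M 2 g"
    using s by (auto simp: riemannian_metric_def lorentzian_metric_def symmetric_2tensor_def)
  have sg: "smooth_on ?S (\<lambda>y. g i y [u, v])" for u v
    using tg by (simp add: tensor_field_def)
  \<comment> \<open>The sign of the Gram determinant is the same everywhere, so the absolute value
    under the root in \<open>volume_form\<close> can be replaced by a smooth positive
    function.\<close>
  have sD: "s * gram_mat M g i y > 0" if "y \<in> ?S" for y
    using s gram_mat_lorentzian[OF or d _ that] gram_mat_riemannian[OF or d _ that] by fastforce
  have ss: "s * s = 1" "\<bar>s\<bar> = 1" using s by auto
  have ab: "\<bar>gram_mat M g i y\<bar> = s * gram_mat M g i y" if "y \<in> ?S" for y
    using sD[OF that] ss by (metis abs_mult abs_of_pos mult_1)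
  have 1: "metric_chart g i ?S"
    by (rule metric_chart.intro) (use op mf sg in auto)
  have gram: "volume_form M g i y [u, v, w] * volume_form M g i y [x, z, t] =
      s * (g i y [u, x] * g i y [v, z] * g i y [w, t] + g i y [u, z] * g i y [v, t] * g i y [w, x]
        + g i y [u, t] * g i y [v, x] * g i y [w, z] - g i y [u, x] * g i y [v, t] * g i y [w, z]
        - g i y [u, z] * g i y [v, x] * g i y [w, t] - g i y [u, t] * g i y [v, z] * g i y [w, x])"
    if y: "y \<in> ?S" for y u v w x z t
  proof -
    interpret metric_form "g i y" by (rule mf[OF y])
    have "volume_form M g i y [u, v, w] * volume_form M g i y [x, z, t] =
        \<bar>gram_mat M g i y\<bar> * (det_vectors ?bs [u, v, w] * det_vectors ?bs [x, z, t])"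
      by (simp add: volume_form_gram)
    also have "\<dots> = s * (det_vectors ?bs [u, v, w] * gram_mat M g i y * det_vectors ?bs [x, z, t])"
      by (simp add: ab[OF y])
    also have "det_vectors ?bs [u, v, w] * gram_mat M g i y * det_vectors ?bs [x, z, t] =
        det_nat 3 (\<lambda>j k. g i y [[u, v, w] ! j, [x, z, t] ! k])"
      using gram_det[OF m bil, of "[u, v, w]" "[x, z, t]"] by (simp add: len gram_mat_def d)
    finally show ?thesis by (simp add: det_nat_3 numeral_2_eq_2)
  qed
  have f3: "oriented_form3 (g i y) (volume_form M g i y) s" if y: "y \<in> ?S" for y
  proof (rule oriented_form3.intro[OF mf[OF y]], unfold_locales)
    obtain b0 b1 b2 where b: "?bs = [b0, b1, b2]" using len by (auto simp: length_3_conv)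
    have "volume_form M g i y ?bs \<noteq> 0"
      using sD[OF y] by (auto simp: volume_form_gram det_vectors_basis[OF m])
    then show "\<exists>u v w. volume_form M g i y [u, v, w] \<noteq> 0" unfolding b by blast
  qed (use d ss gram[OF y] in auto)
  show ?thesis
  proof (intro chart3.intro[OF 1] chart3_axioms.intro)
    show "oriented_form3 (g i y) (volume_form M g i y) s" if "y \<in> ?S" for y by (rule f3[OF that])
    show "smooth_on ?S (\<lambda>y. volume_form M g i y [u, v, w])" for u v w
    proof (rule smooth_on_transform[OF op])
      have "smooth_on ?S (\<lambda>y. gram_mat M g i y)"
        unfolding gram_mat_def d det_nat_3
        by (intro smooth_on_add smooth_on_diff smooth_on_mult op sg)
      then show "smooth_on ?S (\<lambda>y. sqrt (s * gram_mat M g i y) * det_vectors ?bs [u, v, w])"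
        using sD by (intro smooth_on_mult smooth_on_sqrt op smooth_on_const) auto
    qed (simp add: volume_form_gram ab)
    show "linear (\<lambda>v. \<alpha> i y [v])" if "y \<in> ?S" for y
      using \<alpha> that by (intro multilinear_1) (auto simp: form_field_def tensor_field_def)
    show "smooth_on ?S (\<lambda>y. \<alpha> i y [v])" for v
      using \<alpha> by (auto simp: form_field_def tensor_field_def)
    fix y v assume y: "y \<in> ?S"
    have "\<alpha> i y [v] = hodge M g 2 (ext_d \<alpha>) i y [v]"
      using h y by (simp add: tensor_eq_def)
    then show "(\<Sum>e\<in>Basis. \<Sum>f\<in>Basis. (DD (\<lambda>z. \<alpha> i z [raise (g i y) f]) y (raise (g i y) e)
          - DD (\<lambda>z. \<alpha> i z [raise (g i y) e]) y (raise (g i y) f)) * volume_form M g i y [e, f, v]) / 2 = \<alpha> i y [v]"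
      unfolding hodge_def sum_lists_2[OF finite_Basis] by (simp add: ext_d_def numeral_2_eq_2)
  qed
qed

lemma contact_norm:
  fixes M :: "('i, 'a::{t2_space, second_countable_topology}, 'e::euclidean_space) atlas"
  assumes "eps_contact_metric M g \<alpha> \<epsilon>" "chart3 g i (chart_img M i) \<nu> s \<alpha>" "x \<in> chart_img M i"
  shows "g i x [chart3.a g i \<alpha> x, chart3.a g i \<alpha> x] = \<epsilon>"
proof -
  interpret chart3 g i "chart_img M i" \<nu> s \<alpha> by fact
  interpret metric_form "g i x" by (rule metric[OF assms(3)])
  have e: "g i x [e, a x] = \<alpha> i x [e]" for e
    using g_a[OF assms(3), of e] sym[of e "a x"] by simp
  have "\<epsilon> = (\<Sum>e\<in>Basis. \<alpha> i x [e] * \<alpha> i x [raise (g i x) e])"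
    using assms(1,3) unfolding eps_contact_metric_def form_inner_def sum_lists_1[OF finite_Basis] by simp
  also have "\<dots> = g i x [a x, a x]"
    using contract_raise(1)[OF lin_right[of "a x"], of "a x"] by (simp add: e g_a[OF assms(3)])
  finally show ?thesis by simp
qed

section \<open>Change of charts\<close>

text \<open>Nondegeneracy makes an isometry injective, hence surjective. For transition maps this
  replaces an argument with the inverse transition.\<close>

lemma isometry_surj:
  assumes "metric_form b" "linear L" "\<And>u v. b [u, v] = b' [L u, L v]" "bilinear (\<lambda>u v. b' [u, v])"
  shows "surj (L :: 'e::euclidean_space \<Rightarrow> 'e)"
proof -
  interpret metric_form b by fact
  have "inj L"
    unfolding linear_injective_0[OF assms(2)]
    using nondeg assms(3) bilinear_lzero[OF assms(4)] by metis
  then show ?thesis using linear_injective_imp_surjective[OF assms(2)] by blast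
qed

lemma sharp_natural:
  fixes L :: "'e::euclidean_space \<Rightarrow> 'e"
  assumes "metric_form b" "metric_form b'" "linear L" "\<And>u v. b [u, v] = b' [L u, L v]"
    and "linear \<phi>'" "\<And>v. \<phi> v = \<phi>' (L v)"
  shows "L (sharp b \<phi>) = sharp b' \<phi>'"
proof -
  interpret b: metric_form b by fact
  interpret b': metric_form b' by fact
  have sL: "surj L" by (rule isometry_surj[OF assms(1,3,4) b'.bil])
  have "\<phi> = \<phi>' \<circ> L" using assms(6) by auto
  then have "linear \<phi>"
    using linear_compose[OF assms(3,5)] by simp
  then have "b' [L (sharp b \<phi>), L v] = \<phi>' (L v)" for v
    using b.sharp_works assms(4,6) by metis
  then have "b' [L (sharp b \<phi>), v] = \<phi>' v" for v
    using sL by (metis surjD)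
  then show ?thesis by (rule b'.sharp_unique[symmetric])
qed

text \<open>Differentiating the transformed metric produces second derivatives \<open>?K\<close> of
  the transition. In the Koszul combination their symmetry cancels all but twice g(K(u, v), w),
  which is the inhomogeneous term required by \<open>connection\<close>.\<close>

lemma levi_civita_transform:
  assumes i: "metric_chart g i S" and j: "metric_chart g j T"
    and O: "open O'" "O' \<subseteq> S" "x \<in> O'" and \<tau>: "smooth_on O' \<tau>" "\<tau> ` O' \<subseteq> T"
    and g: "\<And>y u v. y \<in> O' \<Longrightarrow> g i y [u, v] = g j (\<tau> y) [DD \<tau> y u, DD \<tau> y v]"
  shows "DD \<tau> x (levi_civita g i x u v) =
    DD (\<lambda>y. DD \<tau> y v) x u + levi_civita g j (\<tau> x) (DD \<tau> x u) (DD \<tau> x v)"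
proof -
  interpret i: metric_chart g i S by fact
  interpret j: metric_chart g j T by fact
  have x: "x \<in> S" "\<tau> x \<in> T" using O \<tau> by auto
  interpret gi: metric_form "g i x" by (rule i.metric[OF x(1)])
  interpret gj: metric_form "g j (\<tau> x)" by (rule j.metric[OF x(2)])
  let ?L = "DD \<tau> x" and ?K = "\<lambda>u v. DD (\<lambda>y. DD \<tau> y v) x u"
  have d\<tau>: "\<tau> differentiable (at x)" and ddt: "(\<lambda>y. DD \<tau> y v) differentiable (at x)" for v
    using smooth_on_differentiable[OF \<tau>(1) O(3)] smooth_on_differentiable[OF smooth_on_DD[OF \<tau>(1)] O(3)] by auto
  have lL: "linear ?L" by (rule DD_linear[OF d\<tau>])
  have K: "?K u v = ?K v u" for u v by (rule DD_symmetric[OF O(1,3) \<tau>(1)])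
  have lj: "linear (\<lambda>p. g j (\<tau> y) [p, q])" "linear (\<lambda>p. g j (\<tau> y) [q, p])" if "y \<in> O'" for y q
  proof -
    have "\<tau> y \<in> T" using \<tau>(2) that by auto
    then show "linear (\<lambda>p. g j (\<tau> y) [p, q])" "linear (\<lambda>p. g j (\<tau> y) [q, p])"
      using metric_form.lin_left metric_form.lin_right j.metric by blast+
  qed
  have D: "DD (\<lambda>y. g i y [v, w]) x u = DD (\<lambda>z. g j z [?L v, ?L w]) (\<tau> x) (?L u)
      + g j (\<tau> x) [?L v, ?K u w] + g j (\<tau> x) [?K u v, ?L w]" for u v w
  proof -
    note 1 = DD_compose[OF j.diff_g[OF x(2)] d\<tau>]
    note 2 = DD_linear_apply[OF O(1,3) lj(2) 1(1) ddt]
    have "DD (\<lambda>y. g i y [v, w]) x = DD (\<lambda>y. g j (\<tau> y) [DD \<tau> y v, DD \<tau> y w]) x"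
      by (rule DD_cong[OF O(1,3) g])
    also have "\<dots> = (\<lambda>u. DD (\<lambda>y. g j (\<tau> y) [?L v, DD \<tau> y w]) x u + g j (\<tau> x) [?K u v, ?L w])"
      by (rule ext, rule DD_linear_apply(2)[OF O(1,3), where T = "\<lambda>y p. g j (\<tau> y) [p, DD \<tau> y w]"])
        (use lj 2 ddt in auto)
    finally show ?thesis by (simp add: 2(2) 1(2))
  qed
  have "?L (i.\<Gamma> x u v) = ?K u v + j.\<Gamma> (\<tau> x) (?L u) (?L v)"
  proof (rule gj.eqI)
    fix w'
    obtain w where w: "w' = ?L w"
      using isometry_surj[OF gi.metric_form_axioms lL g[OF O(3)] gj.bil] by (metis surjD)
    have "g j (\<tau> x) [?L (i.\<Gamma> x u v), w'] = g i x [i.\<Gamma> x u v, w]"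
      by (simp add: g[OF O(3)] w)
    also have "\<dots> = g j (\<tau> x) [?K u v, ?L w] + g j (\<tau> x) [j.\<Gamma> (\<tau> x) (?L u) (?L v), ?L w]"
      unfolding i.koszul(2)[OF x(1)] j.koszul(2)[OF x(2)] D
      using K[of v u] K[of w u] K[of w v] gj.sym[of "?L v" "?K u w"] gj.sym[of "?L u" "?K v w"]
      by (simp add: add_divide_distrib diff_divide_distrib)
    finally show "g j (\<tau> x) [?L (i.\<Gamma> x u v), w'] = g j (\<tau> x) [?K u v + j.\<Gamma> (\<tau> x) (?L u) (?L v), w']"
      by (simp add: gj.g_lin w)
  qed
  then show ?thesis .
qed

text \<open>The Gram determinant acquires the square of the Jacobian. Its root is the Jacobian
  itself rather than an absolute value because transitions preserve the orientation.\<close>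

lemma volume_form_transform:
  fixes M :: "('i, 'a::{t2_space, second_countable_topology}, 'e::euclidean_space) atlas"
  assumes M: "oriented_manifold M" and x: "x \<in> overlap M i j" and len: "length vs = DIM('e)"
    and g: "\<And>u v. g i x [u, v] = g j (transition M i j x) [DD (transition M i j) x u, DD (transition M i j) x v]"
    and bil: "bilinear (\<lambda>u v. g j (transition M i j x) [u, v])"
  shows "volume_form M g i x vs = volume_form M g j (transition M i j x) (map (DD (transition M i j) x) vs)"
proof -
  let ?\<tau> = "transition M i j" and ?bs = "model_basis M"
  let ?L = "DD ?\<tau> x"
  have m: "distinct ?bs" "set ?bs = Basis" using M by (auto simp: oriented_manifold_def)
  note l = basis_list_length[OF m]
  have "smooth_on (overlap M i j) ?\<tau>" using M by (auto simp: oriented_manifold_def)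
  then have lL: "linear ?L" by (intro DD_linear smooth_on_differentiable[OF _ x])
  have pos: "det_vectors ?bs (map ?L ?bs) > 0" (is "?d > 0") using M x by (auto simp: oriented_manifold_def)
  have "gram_mat M g i x = det_nat (length ?bs) (\<lambda>k l. g j (?\<tau> x) [map ?L ?bs ! k, map ?L ?bs ! l])"
    unfolding gram_mat_def l[symmetric] by (rule det_nat_cong) (simp add: g)
  also have "\<dots> = ?d * gram_mat M g j (?\<tau> x) * ?d"
    using gram_det[OF m bil, of "map ?L ?bs" "map ?L ?bs"] by (simp add: gram_mat_def l[symmetric])
  finally have "sqrt \<bar>gram_mat M g i x\<bar> = ?d * sqrt \<bar>gram_mat M g j (?\<tau> x)\<bar>"
    using pos by (simp add: abs_mult real_sqrt_mult)
  then show ?thesis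
    unfolding volume_form_gram using det_vectors_map[OF m lL, of vs] len l by (simp add: mult_ac)
qed

section \<open>Products of manifolds\<close>

lemma prod_atlas_simps [simp]:
  "chart_dom (prod_atlas N X) (i, j) = chart_dom N i \<times> chart_dom X j"
  "chart_map (prod_atlas N X) (i, j) = map_prod (chart_map N i) (chart_map X j)"
  "model_basis (prod_atlas N X) = map (\<lambda>e. (e, 0)) (model_basis N) @ map (\<lambda>f. (0, f)) (model_basis X)"
  by (simp_all add: prod_atlas_def)

lemma map_prod_image: "map_prod f f' ` (A \<times> B) = (f ` A) \<times> (f' ` B)"
  by force

lemma chart_img_prod: "chart_img (prod_atlas N X) (i, j) = chart_img N i \<times> chart_img X j"
  by (simp add: chart_img_def map_prod_image)

lemma overlap_prod:
  "overlap (prod_atlas N X) (i, j) (i', j') = overlap N i i' \<times> overlap X j j'"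
  by (simp add: overlap_def Times_Int_Times map_prod_image)

lemma oriented_manifold_chart:
  assumes "oriented_manifold M"
  shows "open (chart_dom M i)" "open (chart_img M i)"
    "homeomorphism (chart_dom M i) (chart_img M i) (chart_map M i) (chart_inv M i)"
  using assms by (simp_all add: oriented_manifold_def)

lemma chart_inv_map:
  "oriented_manifold M \<Longrightarrow> a \<in> chart_dom M i \<Longrightarrow> chart_inv M i (chart_map M i a) = a"
  by (rule homeomorphism_apply1[OF oriented_manifold_chart(3)])

lemma open_overlap: 
  assumes "oriented_manifold M" 
  shows "open (overlap M i j)"
proof -
  note c = oriented_manifold_chart[OF assms]
  have "openin (top_of_set (chart_img M i)) (chart_map M i ` (chart_dom M i \<inter> chart_dom M j))"
    by (rule homeomorphism_imp_open_map[OF c(3)]) (simp add: c(1) openin_open_Int)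
  then show ?thesis unfolding overlap_def using c(2) openin_open_trans by blast
qed

lemma overlap_img: "overlap M i j \<subseteq> chart_img M i"
  by (auto simp: overlap_def chart_img_def)

lemma transition_img:
  assumes "oriented_manifold M"
  shows "transition M i j ` overlap M i j \<subseteq> chart_img M j"
  using chart_inv_map[OF assms] by (auto simp: overlap_def transition_def chart_img_def)

lemma chart_inv_prod:
  assumes "oriented_manifold N" "oriented_manifold X" "p \<in> chart_img N i \<times> chart_img X j"
  shows "chart_inv (prod_atlas N X) (i, j) p = (chart_inv N i (fst p), chart_inv X j (snd p))"
proof -
  have "inj_on (map_prod (chart_map N i) (chart_map X j)) (chart_dom N i \<times> chart_dom X j)"
    using inj_on_inverseI[of "chart_dom N i" "chart_inv N i" "chart_map N i"] chart_inv_map[OF assms(1)]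
      inj_on_inverseI[of "chart_dom X j" "chart_inv X j" "chart_map X j"] chart_inv_map[OF assms(2)]
    by (intro map_prod_inj_on) auto
  moreover obtain a b where "a \<in> chart_dom N i" "b \<in> chart_dom X j" "p = (chart_map N i a, chart_map X j b)"
    using assms(3) by (auto simp: chart_img_def)
  ultimately show ?thesis
    using inv_into_f_f[of "map_prod (chart_map N i) (chart_map X j)" "chart_dom N i \<times> chart_dom X j" "(a, b)"]
      chart_inv_map[OF assms(1)] chart_inv_map[OF assms(2)]
    by (simp add: chart_inv_def)
qed

lemma transition_prod:
  assumes "oriented_manifold N" "oriented_manifold X" "p \<in> overlap N i i' \<times> overlap X j j'"
  shows "transition (prod_atlas N X) (i, j) (i', j') p =
    (transition N i i' (fst p), transition X j j' (snd p))"
proof -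
  have "p \<in> chart_img N i \<times> chart_img X j" using assms(3) overlap_img[of N i i'] overlap_img[of X j j'] by auto
  from chart_inv_prod[OF assms(1,2) this] show ?thesis by (simp add: transition_def)
qed

lemma smooth_on_map_prod:
  assumes "open S" "open T" "smooth_on S f" "smooth_on T f'"
  shows "smooth_on (S \<times> T) (\<lambda>p. (f (fst p), f' (snd p)))"
  by (intro smooth_on_Pair open_Times assms(1,2)
      smooth_on_comp_linear[OF open_Times[OF assms(1,2)] assms(1) linear_fst _ assms(3)]
      smooth_on_comp_linear[OF open_Times[OF assms(1,2)] assms(2) linear_snd _ assms(4)]) auto

lemma smooth_transition: "oriented_manifold M \<Longrightarrow> smooth_on (overlap M i j) (transition M i j)"
  by (simp add: oriented_manifold_def)

lemma DD_transition_prod: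
  assumes N: "oriented_manifold N" and X: "oriented_manifold X" and p: "p \<in> overlap N i i' \<times> overlap X j j'"
  shows "DD (transition (prod_atlas N X) (i, j) (i', j')) p =
    (\<lambda>v. (DD (transition N i i') (fst p) (fst v), DD (transition X j j') (snd p) (snd v)))"
proof -
  have "DD (transition (prod_atlas N X) (i, j) (i', j')) p =
      DD (\<lambda>p. (transition N i i' (fst p), transition X j j' (snd p))) p"
    by (rule DD_cong[OF open_Times[OF open_overlap[OF N] open_overlap[OF X]] p transition_prod[OF N X]])
  then show ?thesis
    using p smooth_on_differentiable[OF smooth_transition[OF N]] smooth_on_differentiable[OF smooth_transition[OF X]]
    by (subst (asm) DD_map_prod) auto
qed

lemma DD_transition_linear: 
  "oriented_manifold M \<Longrightarrow> x \<in> overlap M i j \<Longrightarrow> linear (DD (transition M i j) x)"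
  by (intro DD_linear smooth_on_differentiable[OF smooth_transition])

text \<open>Charts, inverses and transitions act componentwise, so the Jacobian matrix of a
  transition is block diagonal and its determinant a product of two positive ones.\<close>

lemma oriented_manifold_prod:
  fixes N :: "('i, 'a::{t2_space, second_countable_topology}, 'e::euclidean_space) atlas"
    and X :: "('j, 'b::{t2_space, second_countable_topology}, 'f::euclidean_space) atlas"
  assumes N: "oriented_manifold N" and X: "oriented_manifold X"
  shows "oriented_manifold (prod_atlas N X)"
  unfolding oriented_manifold_def
proof (intro conjI allI ballI)
  let ?M = "prod_atlas N X"
  have mN: "distinct (model_basis N)" "set (model_basis N) = Basis"
    and mX: "distinct (model_basis X)" "set (model_basis X) = Basis"
    using N X by (auto simp: oriented_manifold_def)
  show "distinct (model_basis ?M)" using mN mX nonzero_Basis by (auto simp: distinct_map inj_on_def)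
  show "set (model_basis ?M) = Basis" using mN mX by (auto simp: Basis_prod_def)
  show "(\<Union>k. chart_dom ?M k) = UNIV"
  proof -
    have "\<exists>k. (a, b) \<in> chart_dom ?M k" for a b
    proof -
      have "a \<in> (\<Union>i. chart_dom N i)" "b \<in> (\<Union>j. chart_dom X j)"
        using N X by (auto simp: oriented_manifold_def)
      then obtain i j where "a \<in> chart_dom N i" "b \<in> chart_dom X j" by blast
      then have "(a, b) \<in> chart_dom ?M (i, j)" by simp
      then show ?thesis by blast
    qed
    then show ?thesis by auto
  qed
  fix k :: "'i \<times> 'j"
  obtain i j where k: "k = (i, j)" by fastforce
  note cN = oriented_manifold_chart[OF N, of i] and cX = oriented_manifold_chart[OF X, of j]
  show "open (chart_dom ?M k)" using cN cX by (simp add: k open_Times)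
  show "open (chart_img ?M k)" using cN cX by (simp add: k chart_img_prod open_Times)
  show "homeomorphism (chart_dom ?M k) (chart_img ?M k) (chart_map ?M k) (chart_inv ?M k)"
  proof -
    have 1: "homeomorphism (chart_dom N i \<times> chart_dom X j) (chart_img N i \<times> chart_img X j)
        (\<lambda>p. (chart_map N i (fst p), chart_map X j (snd p))) (\<lambda>p. (chart_inv N i (fst p), chart_inv X j (snd p)))"
    proof (rule homeomorphismI)
      have c: "continuous_on (A \<times> B) (\<lambda>p. (f (fst p), f' (snd p)))"
        if "continuous_on A f" "continuous_on B f'"
        for A B and f :: "'u::topological_space \<Rightarrow> 'v::topological_space" and f' :: "'w::topological_space \<Rightarrow> 'z::topological_space"
        by (intro continuous_on_Pair continuous_on_compose2[OF that(1)] continuous_on_compose2[OF that(2)]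
            continuous_on_fst continuous_on_snd continuous_on_id) auto
      show "continuous_on (chart_dom N i \<times> chart_dom X j) (\<lambda>p. (chart_map N i (fst p), chart_map X j (snd p)))"
        by (rule c[OF homeomorphism_cont1[OF cN(3)] homeomorphism_cont1[OF cX(3)]])
      show "continuous_on (chart_img N i \<times> chart_img X j) (\<lambda>p. (chart_inv N i (fst p), chart_inv X j (snd p)))"
        by (rule c[OF homeomorphism_cont2[OF cN(3)] homeomorphism_cont2[OF cX(3)]])
      show "(\<lambda>p. (chart_map N i (fst p), chart_map X j (snd p))) ` (chart_dom N i \<times> chart_dom X j)
          \<subseteq> chart_img N i \<times> chart_img X j"
        by (auto simp: chart_img_def)
      show "(\<lambda>p. (chart_inv N i (fst p), chart_inv X j (snd p))) ` (chart_img N i \<times> chart_img X j)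
          \<subseteq> chart_dom N i \<times> chart_dom X j"
        using homeomorphism_image2[OF cN(3)] homeomorphism_image2[OF cX(3)] by auto
    qed (auto simp: homeomorphism_apply1[OF cN(3)] homeomorphism_apply1[OF cX(3)]
        homeomorphism_apply2[OF cN(3)] homeomorphism_apply2[OF cX(3)])
    show ?thesis
      unfolding k chart_img_prod prod_atlas_simps
      by (rule homeomorphism_cong[OF 1]) (auto simp: chart_inv_prod[OF N X])
  qed
  fix k' :: "'i \<times> 'j"
  obtain i' j' where k': "k' = (i', j')" by fastforce
  have op: "open (overlap N i i' \<times> overlap X j j')"
    by (intro open_Times open_overlap N X)
  show "smooth_on (overlap ?M k k') (transition ?M k k')"
    unfolding k k' overlap_prod
    by (rule smooth_on_transform[OF op smooth_on_map_prod[OF open_overlap[OF N] open_overlap[OF X]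
            smooth_transition[OF N] smooth_transition[OF X]]])
      (simp add: transition_prod[OF N X])
  fix p assume "p \<in> overlap ?M k k'"
  then have p: "p \<in> overlap N i i' \<times> overlap X j j'" by (simp add: k k' overlap_prod)
  have "det_vectors (model_basis N) (map (DD (transition N i i') (fst p)) (model_basis N)) > 0"
    "det_vectors (model_basis X) (map (DD (transition X j j') (snd p)) (model_basis X)) > 0"
    using N X p by (auto simp: oriented_manifold_def)
  moreover have "DD (transition N i i') (fst p) 0 = 0" "DD (transition X j j') (snd p) 0 = 0"
    using p by (auto intro!: linear_0 DD_transition_linear N X)
  ultimately show "det_vectors (model_basis ?M) (map (DD (transition ?M k k') p) (model_basis ?M)) > 0"
    unfolding k k' DD_transition_prod[OF N X p] prod_atlas_simps map_append map_map
    by (subst det_vectors_block) (auto simp: o_def)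
qed

text \<open>Two Gram-Schmidt steps, begun with a triple on which \<nu> is nonzero so that no vector
  degenerates; the cross product is the third vector, of unit length by \<open>g_PP\<close>.\<close>

lemma (in oriented_form3) positive_orthonormal:
  assumes pos: "\<And>v. v \<noteq> 0 \<Longrightarrow> g [v, v] > 0" and s: "s = 1"
  obtains e0 e1 e2 where "g [e0, e0] = 1" "g [e1, e1] = 1" "g [e2, e2] = 1"
    "g [e0, e1] = 0" "g [e0, e2] = 0" "g [e1, e2] = 0"
proof -
  obtain u v w where n: "\<nu> [u, v, w] \<noteq> 0" using nu_nonzero by blast
  define nrm where "nrm v = inverse (sqrt (g [v, v])) *\<^sub>R v" for v
  have nrm: "g [nrm v, nrm v] = 1" if "v \<noteq> 0" for v
  proof -
    have "sqrt (g [v, v]) > 0" "g [v, v] = sqrt (g [v, v]) * sqrt (g [v, v])" using pos[OF that] by auto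
    then show ?thesis by (simp add: nrm_def g_lin field_simps)
  qed
  have "u \<noteq> 0" using n nu_lin by auto
  define v' where "v' = v - g [nrm u, v] *\<^sub>R nrm u"
  have "\<nu> [u, v', w] = \<nu> [u, v, w]" by (simp add: v'_def nrm_def nu_lin nu_same)
  then have "v' \<noteq> 0" using n nu_lin by auto
  have o: "g [nrm u, v'] = 0" using nrm[OF \<open>u \<noteq> 0\<close>] by (simp add: v'_def g_lin)
  then have o': "g [nrm u, nrm v'] = 0" by (simp add: nrm_def[of v'] g_lin)
  show ?thesis
  proof (rule that[of "nrm u" "nrm v'" "P (nrm u) (nrm v')"])
    show "g [P (nrm u) (nrm v'), P (nrm u) (nrm v')] = 1"
      using o' nrm \<open>u \<noteq> 0\<close> \<open>v' \<noteq> 0\<close> s unfolding g_PP by simp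
  qed (use o' nrm \<open>u \<noteq> 0\<close> \<open>v' \<noteq> 0\<close> in \<open>simp_all add: g_P nu_same\<close>)
qed

text \<open>F is built from the volume form and the vector dual to \<alpha>; the former transforms
  by orientability, the latter by naturality of \<open>sharp\<close>.\<close>

lemma F_transform:
  fixes M :: "('i, 'a::{t2_space, second_countable_topology}, 'e::euclidean_space) atlas"
  assumes M: "oriented_manifold M" "DIM('e) = 3" and g: "tensor_field M 2 g" and \<alpha>: "tensor_field M 1 \<alpha>"
    and i: "chart3 g i (chart_img M i) (volume_form M g) s \<alpha>"
    and j: "chart3 g j (chart_img M j) (volume_form M g) s \<alpha>"
    and x: "x \<in> overlap M i j"
  defines "y \<equiv> transition M i j x" and "L \<equiv> DD (transition M i j) x"
  shows "\<alpha> i x [v] = \<alpha> j y [L v]"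
    and "volume_form M g i x [u, v, w] = volume_form M g j y [L u, L v, L w]"
    and "chart3.F g i (volume_form M g) \<alpha> x u v = chart3.F g j (volume_form M g) \<alpha> y (L u) (L v)"
proof -
  interpret i: chart3 g i "chart_img M i" "volume_form M g" s \<alpha> by fact
  interpret j: chart3 g j "chart_img M j" "volume_form M g" s \<alpha> by fact
  have xi: "x \<in> chart_img M i" and yj: "y \<in> chart_img M j"
    using x overlap_img[of M i j] transition_img[OF M(1), of i j] by (auto simp: y_def)
  interpret gi: metric_form "g i x" by (rule i.metric[OF xi])
  interpret gj: metric_form "g j y" by (rule j.metric[OF yj])
  have g': "g i x [u, v] = g j y [L u, L v]" for u v
    using g x by (simp add: tensor_field_def y_def L_def)
  show \<alpha>': "\<alpha> i x [v] = \<alpha> j y [L v]" for v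
    using \<alpha> x by (simp add: tensor_field_def y_def L_def)
  show \<nu>': "volume_form M g i x [u, v, w] = volume_form M g j y [L u, L v, L w]" for u v w
    using volume_form_transform[OF M(1) x, of "[u, v, w]" g] g' gj.bil M(2) by (simp add: y_def L_def)
  have lL: "linear L" unfolding L_def by (rule DD_transition_linear[OF M(1) x])
  have "L (i.a x) = j.a y"
    unfolding i.a_def j.a_def
    by (rule sharp_natural[OF gi.metric_form_axioms gj.metric_form_axioms lL g' j.linear_alpha[OF yj] \<alpha>'])
  then show "i.F x u v = j.F y (L u) (L v)" by (simp add: i.F_def j.F_def \<nu>')
qed

lemma length_4_conv: "length vs = 4 \<longleftrightarrow> (\<exists>u v w z. vs = [u, v, w, z])"
  by (auto simp: numeral_eq_Suc length_Suc_conv)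

lemma multilinear_scale: "multilinear k t \<Longrightarrow> multilinear k (\<lambda>vs. c * t vs)"
  unfolding multilinear_def
proof (intro allI impI)
  fix vs :: "'a list" and j
  assume "\<forall>vs j. length vs = k \<longrightarrow> j < k \<longrightarrow> linear (\<lambda>v. t (vs[j := v]))" "length vs = k" "j < k"
  then have l: "linear (\<lambda>v. t (vs[j := v]))" by blast
  show "linear (\<lambda>v. c * t (vs[j := v]))"
    by (rule linearI) (simp_all add: linear_add[OF l] linear_scale[OF l] algebra_simps)
qed

lemma alternating_scale: "alternating k t \<Longrightarrow> alternating k (\<lambda>vs. c * t vs)"
  unfolding alternating_def by auto

text \<open>The factor 3/2 is the binomial coefficient 3 of this wedge convention over 2! 1!. For
  alternating \<omega> the six terms pair up to three times the cyclic sum, so the coefficient l/3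
  of the flux becomes l in \<open>H0\<close>.\<close>

lemma wedge_2_1: "wedge 2 1 \<omega> \<eta> k p [u, v, w] = 3 / 2 *
  (\<omega> k p [u, v] * \<eta> k p [w] + \<omega> k p [v, w] * \<eta> k p [u] + \<omega> k p [w, u] * \<eta> k p [v]
    - \<omega> k p [u, w] * \<eta> k p [v] - \<omega> k p [v, u] * \<eta> k p [w] - \<omega> k p [w, v] * \<eta> k p [u])"
proof -
  have m: "map (\<lambda>k. [u, v, w] ! \<sigma> k) [0..<2] = [[u, v, w] ! \<sigma> 0, [u, v, w] ! \<sigma> 1]"
    "map (\<lambda>k. [u, v, w] ! \<sigma> k) [2..<2 + 1] = [[u, v, w] ! \<sigma> 2]" for \<sigma>
    by (simp_all add: upt_rec numeral_2_eq_2)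
  have "wedge 2 1 \<omega> \<eta> k p [u, v, w] = 3 / 2 * (\<Sum>\<sigma> | \<sigma> permutes {..<3::nat}. of_int (sign \<sigma>) *
      (\<omega> k p [[u, v, w] ! \<sigma> 0, [u, v, w] ! \<sigma> 1] * \<eta> k p [[u, v, w] ! \<sigma> 2]))"
    unfolding wedge_def m by (simp add: binomial_eq_0 numeral_3_eq_3 numeral_2_eq_2 mult.assoc)
  then show ?thesis
    by (simp only: sum_permutes_3[of "\<lambda>a b c. \<omega> k p [[u, v, w] ! a, [u, v, w] ! b] * \<eta> k p [[u, v, w] ! c]"])
      (simp add: numeral_2_eq_2)
qed

lemma wedge_1_2: "wedge 1 2 \<omega> \<eta> k p [u, v, w] = 3 / 2 *
  (\<omega> k p [u] * \<eta> k p [v, w] + \<omega> k p [v] * \<eta> k p [w, u] + \<omega> k p [w] * \<eta> k p [u, v]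
    - \<omega> k p [u] * \<eta> k p [w, v] - \<omega> k p [v] * \<eta> k p [u, w] - \<omega> k p [w] * \<eta> k p [v, u])"
proof -
  have m: "map (\<lambda>k. [u, v, w] ! \<sigma> k) [0..<1] = [[u, v, w] ! \<sigma> 0]"
    "map (\<lambda>k. [u, v, w] ! \<sigma> k) [1..<1 + 2] = [[u, v, w] ! \<sigma> 1, [u, v, w] ! \<sigma> 2]" for \<sigma>
    by (simp_all add: upt_rec numeral_2_eq_2)
  have "wedge 1 2 \<omega> \<eta> k p [u, v, w] = 3 / 2 * (\<Sum>\<sigma> | \<sigma> permutes {..<3::nat}. of_int (sign \<sigma>) *
      (\<omega> k p [[u, v, w] ! \<sigma> 0] * \<eta> k p [[u, v, w] ! \<sigma> 1, [u, v, w] ! \<sigma> 2]))"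
    unfolding wedge_def m by (simp add: numeral_3_eq_3 numeral_2_eq_2 mult.assoc)
  then show ?thesis
    by (simp only: sum_permutes_3[of "\<lambda>a b c. \<omega> k p [[u, v, w] ! a] * \<eta> k p [[u, v, w] ! b, [u, v, w] ! c]"])
      (simp add: numeral_2_eq_2)
qed

context chart3
begin

lemma hodge_alpha:
  assumes "x \<in> S" "\<nu> = volume_form M g"
  shows "hodge M g 1 \<alpha> i x [u, v] = F x u v"
  unfolding hodge_def sum_lists_1[OF finite_Basis] F_def a_def
  using oriented_form3.hodge_one[OF form3 linear_alpha, OF assms(1) assms(1)] by (simp add: assms(2)[symmetric])

end

context chart_pair
begin

lemma smooth_H0: "smooth_on (S \<times> T) (\<lambda>p. H0 c l d p u v w)"
  unfolding H0_def
  by (intro smooth_on_add smooth_on_mult smooth_on_const open_ST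
      smooth_fst[of "\<lambda>x. N.F x _ _"] smooth_snd[of "\<lambda>x. X.F x _ _"]
      smooth_fst[of "\<lambda>x. \<alpha> i x _"] smooth_snd[of "\<lambda>x. \<beta> j x _"]
      smooth_fst[of "\<lambda>x. \<nu> i x _"] smooth_snd[of "\<lambda>x. \<mu> j x _"]
      N.smooth_F X.smooth_F N.smooth_alpha X.smooth_alpha N.smooth_nu X.smooth_nu)

text \<open>Skewness of \<open>H0\<close> in the last two slots cancels the torsion terms in the
  derivative of the metric; skewness in the first two doubles the 1/2, so that the torsion is
  exactly \<open>H\<close>.\<close>

lemma nabla_H_chart:
  assumes H: "\<And>q u v w. q \<in> S \<times> T \<Longrightarrow> H (i, j) q [u, v, w] = H0 c l c q u v w"
  shows "p \<in> S \<times> T \<Longrightarrow> bilinear (nabla_H gM H (i, j) p)"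
    and "smooth_on (S \<times> T) (\<lambda>p. nabla_H gM H (i, j) p u v)"
    and "p \<in> S \<times> T \<Longrightarrow> DD (\<lambda>y. gM (i, j) y [v, w]) p u =
      gM (i, j) p [nabla_H gM H (i, j) p u v, w] + gM (i, j) p [v, nabla_H gM H (i, j) p u w]"
    and "p \<in> S \<times> T \<Longrightarrow> gM (i, j) p [nabla_H gM H (i, j) p u v - nabla_H gM H (i, j) p v u, w] = H (i, j) p [u, v, w]"
proof -
  have e: "nabla_H gM H (i, j) p u v = M.\<Gamma> p u v + (1 / 2) *\<^sub>R A c l p u v" if "p \<in> S \<times> T" for p u v
    by (rule nabla_H_eq) (use H that in auto)
  have "smooth_on (S \<times> T) (\<lambda>p. M.\<Gamma> p u v + (1 / 2) *\<^sub>R A c l p u v)"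
    by (intro smooth_on_add smooth_on_scaleR smooth_on_const open_ST smooth_\<Gamma>M smooth_A)
  then show "smooth_on (S \<times> T) (\<lambda>p. nabla_H gM H (i, j) p u v)"
    by (rule smooth_on_transform[OF open_ST]) (simp add: e)
  assume p: "p \<in> S \<times> T"
  interpret m: metric_form "gM (i, j) p" by (rule metric_form_gM[OF p])
  have A: "gM (i, j) p [A c l p v w, u] = H0 c l c p v w u" for u v w
    unfolding sharp_H0[OF p, symmetric] by (rule m.sharp_works[OF H0_linear(1)[OF p]])
  note G = M.bilinear_\<Gamma>[OF p] and bA = A_lin[OF p, of c l]
  note bl = bilinear_ladd[OF G] bilinear_radd[OF G] bilinear_lmul[OF G] bilinear_rmul[OF G]
    bilinear_ladd[OF bA] bilinear_radd[OF bA] bilinear_lmul[OF bA] bilinear_rmul[OF bA]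
  show "bilinear (nabla_H gM H (i, j) p)"
    unfolding bilinear_def e[OF p]
    by (intro conjI allI linearI) (simp_all add: bl algebra_simps)
  show "DD (\<lambda>y. gM (i, j) y [v, w]) p u =
      gM (i, j) p [nabla_H gM H (i, j) p u v, w] + gM (i, j) p [v, nabla_H gM H (i, j) p u w]"
    unfolding M.DD_g[OF p] e[OF p] m.g_lin m.sym[of v "A c l p u w"] A
    using H0_skew(2)[OF p, of c l c u v w] by simp
  show "gM (i, j) p [nabla_H gM H (i, j) p u v - nabla_H gM H (i, j) p v u, w] = H (i, j) p [u, v, w]"
    unfolding e[OF p] m.g_lin A H[OF p] M.\<Gamma>_sym[OF p, of v u]
    using H0_skew(1)[OF p, of c l c v u w] by simp
qed

end

section \<open>The flux of two manifolds on a pair of charts\<close>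

text \<open>The chart labels \<open>i\<close> and \<open>j\<close> do not occur in the assumptions,
  so the locale predicate is independent of them and one proof of it permits interpretation at every
  pair of charts.\<close>

locale flux_chart =
  fixes N :: "('i, 'a::{t2_space, second_countable_topology}, 'e::euclidean_space) atlas"
    and X :: "('j, 'b::{t2_space, second_countable_topology}, 'f::euclidean_space) atlas"
    and \<gamma> \<alpha> :: "('i, 'e) tensor" and h \<beta> :: "('j, 'f) tensor" and lam l \<epsilon> :: real
    and i :: 'i and j :: 'j
  assumes lorN: "lorentzian_metric N \<gamma>" and einN: "eps_eta_einstein N \<gamma> \<alpha> \<epsilon> (lam\<^sup>2) (l\<^sup>2)"
    and riemX: "riemannian_metric X h" and einX: "eps_eta_einstein X h \<beta> 1 (lam\<^sup>2) (\<epsilon> * l\<^sup>2)"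
begin

lemma contactN: "eps_contact_metric N \<gamma> \<alpha> \<epsilon>" and contactX: "eps_contact_metric X h \<beta> 1"
  using einN einX by (auto simp: eps_eta_einstein_def)

lemma mfdN: "oriented_manifold N" and mfdX: "oriented_manifold X"
  and dimN: "DIM('e) = 3" and dimX: "DIM('f) = 3"
  using contactN contactX by (auto simp: eps_contact_metric_def)

lemma tensorN: "tensor_field N 2 \<gamma>" "tensor_field N 1 \<alpha>"
  and tensorX: "tensor_field X 2 h" "tensor_field X 1 \<beta>"
  using lorN riemX contactN contactX
  by (auto simp: lorentzian_metric_def riemannian_metric_def symmetric_2tensor_def eps_contact_metric_def form_field_def)

sublocale chart_pair \<gamma> i "chart_img N i" "volume_form N \<gamma>" \<alpha> h j "chart_img X j" "volume_form X h" \<beta>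
  by (intro chart_pair.intro chart3_contact[OF contactN] chart3_contact[OF contactX]) (use lorN riemX in auto)

abbreviation H where "H \<equiv> flux N \<gamma> \<alpha> X h \<beta> lam l"

lemma H_eq:
  assumes p: "p \<in> chart_img N i \<times> chart_img X j"
  shows "H (i, j) p [u, v, w] = H0 lam l lam p u v w"
proof -
  have x: "fst p \<in> chart_img N i" "snd p \<in> chart_img X j" using p by auto
  show ?thesis
    using N.F_skew[OF x(1), of "fst v" "fst u"] N.F_skew[OF x(1), of "fst w" "fst u"] N.F_skew[OF x(1), of "fst w" "fst v"]
      X.F_skew[OF x(2), of "snd v" "snd u"] X.F_skew[OF x(2), of "snd w" "snd u"] X.F_skew[OF x(2), of "snd w" "snd v"]
    unfolding flux_def wedge_2_1 wedge_1_2
    by (simp add: pull_fst_def pull_snd_def H0_def N.hodge_alpha[OF x(1) refl, unfolded One_nat_def]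
        X.hodge_alpha[OF x(2) refl, unfolded One_nat_def] algebra_simps)
qed

text \<open>\<open>metric_sign\<close> tests only whether the metric is Riemannian, so this must be
  refuted for a Lorentzian one: at a point, the two Gram determinants would have opposite
  signs.\<close>

lemma metric_sign_N: "x \<in> chart_img N i \<Longrightarrow> metric_sign N \<gamma> = - 1"
proof -
  assume x: "x \<in> chart_img N i"
  have "gram_mat N \<gamma> i x < 0" by (rule gram_mat_lorentzian[OF mfdN dimN lorN x])
  then have "\<not> riemannian_metric N \<gamma>"
    using gram_mat_riemannian[OF mfdN dimN _ x] by force
  then show ?thesis by (simp add: metric_sign_def)
qed

lemma ricci_H:
  assumes p: "p \<in> chart_img N i \<times> chart_img X j"
  shows "ricci (nabla_H gM H) (i, j) p [v, w] = 0"
proof -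
  have x: "fst p \<in> chart_img N i" "snd p \<in> chart_img X j" using p by auto
  have sX: "metric_sign X h = 1" by (simp add: metric_sign_def riemX)
  show ?thesis
  proof (rule ricci_nabla[where c = lam and l = l and e = \<epsilon>, OF p _ contact_norm[OF contactN N.chart3_axioms x(1)]
        contact_norm[OF contactX X.chart3_axioms x(2)]])
    show "H (i, j) q [u, v, w] = H0 lam l lam q u v w" if "q \<in> chart_img N i \<times> chart_img X j" for q u v w
      by (rule H_eq[OF that])
    show "ricci (levi_civita \<gamma>) i (fst p) [fst v, fst w] =
      - (1 / 2) * (lam\<^sup>2 + l\<^sup>2 * \<epsilon>) * \<gamma> i (fst p) [fst v, fst w] + l\<^sup>2 * (\<alpha> i (fst p) [fst v] * \<alpha> i (fst p) [fst w])"
      using einN x by (simp add: eps_eta_einstein_def tensor_eq_def metric_sign_N[OF x(1)])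
    show "ricci (levi_civita h) j (snd p) [snd v, snd w] =
      (1 / 2) * (lam\<^sup>2 + \<epsilon> * l\<^sup>2) * h j (snd p) [snd v, snd w] - \<epsilon> * l\<^sup>2 * (\<beta> j (snd p) [snd v] * \<beta> j (snd p) [snd w])"
      using einX x by (simp add: eps_eta_einstein_def tensor_eq_def sX)
  qed
qed

lemma lN: "length (model_basis N) = 3" and lX: "length (model_basis X) = 3"
  using basis_list_length[of "model_basis N"] basis_list_length[of "model_basis X"] mfdN mfdX dimN dimX
  by (auto simp: oriented_manifold_def)

text \<open>The Gram matrix in the product basis is block diagonal, so its determinant, and with it
  the root of the absolute value, factorises.\<close>

lemma volume_gM:
  assumes p: "p \<in> chart_img N i \<times> chart_img X j"
  shows "volume_form (prod_atlas N X) gM (i, j) p vs =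
    sqrt \<bar>gram_mat N \<gamma> i (fst p)\<bar> * sqrt \<bar>gram_mat X h j (snd p)\<bar> * det_vectors (model_basis (prod_atlas N X)) vs"
proof -
  have x: "fst p \<in> chart_img N i" "snd p \<in> chart_img X j" using p by auto
  interpret a: metric_form "\<gamma> i (fst p)" by (rule N.metric[OF x(1)])
  interpret b: metric_form "h j (snd p)" by (rule X.metric[OF x(2)])
  let ?bs = "model_basis (prod_atlas N X)"
  let ?A = "\<lambda>k l. gM (i, j) p [?bs ! k, ?bs ! l]"
  have "gram_mat (prod_atlas N X) gM (i, j) p = det_nat (3 + 3) ?A"
    by (simp add: gram_mat_def dimN dimX)
  also have "\<dots> = det_nat 3 ?A * det_nat 3 (\<lambda>k l. ?A (3 + k) (3 + l))"
    by (rule det_nat_lower_left_zero) (simp add: gM_eq nth_append lN lX a.g_lin b.g_lin)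
  also have "det_nat 3 ?A = gram_mat N \<gamma> i (fst p)"
    unfolding gram_mat_def dimN by (rule det_nat_cong) (simp add: gM_eq nth_append lN b.g_lin)
  also have "det_nat 3 (\<lambda>k l. ?A (3 + k) (3 + l)) = gram_mat X h j (snd p)"
    unfolding gram_mat_def dimX by (rule det_nat_cong) (simp add: gM_eq nth_append lN lX a.g_lin)
  finally show ?thesis
    by (simp add: volume_form_gram abs_mult real_sqrt_mult)
qed

lemma pair_volume:
  assumes p: "p \<in> chart_img N i \<times> chart_img X j"
  shows "chart_pair_volume \<gamma> i (chart_img N i) (volume_form N \<gamma>) \<alpha> h j (chart_img X j) (volume_form X h) \<beta> p
    (volume_form (prod_atlas N X) gM (i, j) p)"
proof (intro chart_pair_volume.intro chart_pair_axioms chart_pair_volume_axioms.intro p)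
  let ?bs = "model_basis (prod_atlas N X)"
  have l6: "length ?bs = 6" by (simp add: lN lX)
  have eq: "volume_form (prod_atlas N X) gM (i, j) p =
      (\<lambda>vs. sqrt \<bar>gram_mat N \<gamma> i (fst p)\<bar> * sqrt \<bar>gram_mat X h j (snd p)\<bar> * det_vectors ?bs vs)"
    using volume_gM[OF p] by blast
  show "multilinear 6 (volume_form (prod_atlas N X) gM (i, j) p)"
    unfolding eq by (intro multilinear_scale multilinear_det_vectors l6)
  show "alternating 6 (volume_form (prod_atlas N X) gM (i, j) p)"
    unfolding eq by (intro alternating_scale alternating_det_vectors l6)
  fix a b d u v w
  show "volume_form (prod_atlas N X) gM (i, j) p [(a, 0), (b, 0), (d, 0), u, v, w] =
      volume_form N \<gamma> i (fst p) [a, b, d] * volume_form X h j (snd p) [snd u, snd v, snd w]"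
    using det_vectors_block[of "[(a, 0), (b, 0), (d, 0)]" "model_basis N" "[u, v, w]" "model_basis X"]
    by (simp add: eq lN lX volume_form_gram)
next
  fix u v w a' b' d'
  show "volume_form (prod_atlas N X) gM (i, j) p [u, v, w, (0, a'), (0, b'), (0, d')] =
      volume_form N \<gamma> i (fst p) [fst u, fst v, fst w] * volume_form X h j (snd p) [a', b', d']"
    using det_vectors_block[of "[u, v, w]" "model_basis N" "[(0, a'), (0, b'), (0, d')]" "model_basis X"]
    unfolding volume_gM[OF p] by (simp add: lN lX volume_form_gram)
qed

lemma hodge_H:
  assumes p: "p \<in> chart_img N i \<times> chart_img X j"
  shows "hodge (prod_atlas N X) gM 3 H (i, j) p [u, v, w] = H0 (- lam) l (- lam) p u v w"
proof -
  interpret v: chart_pair_volume \<gamma> i "chart_img N i" "volume_form N \<gamma>" \<alpha> h j "chart_img X j" "volume_form X h" \<beta> p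
    "volume_form (prod_atlas N X) gM (i, j) p" by (rule pair_volume[OF p])
  have "hodge (prod_atlas N X) gM 3 H (i, j) p [u, v, w] =
      (\<Sum>a\<in>Basis. \<Sum>b\<in>Basis. \<Sum>d\<in>Basis. H0 lam l lam p (raise (gM (i, j) p) a) (raise (gM (i, j) p) b) (raise (gM (i, j) p) d)
        * volume_form (prod_atlas N X) gM (i, j) p [a, b, d, u, v, w]) / 6"
    unfolding hodge_def sum_lists_3[OF finite_Basis] by (simp add: H_eq[OF p] fact_numeral)
  then show ?thesis by (simp add: v.hodge_H0)
qed

lemma isotropic_H:
  assumes p: "p \<in> chart_img N i \<times> chart_img X j"
  shows "form_inner 3 gM H H (i, j) p = 0"
  unfolding form_inner_def sum_lists_3[OF finite_Basis] using isotropic_H0[OF p, of lam l] by (simp add: H_eq[OF p])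

text \<open>The definition puts the timelike vector at index 0, so the frame of N precedes the
  orthonormal frame of X.\<close>

lemma lorentzian_frame:
  assumes p: "p \<in> chart_img N i \<times> chart_img X j"
  shows "\<exists>es. length es = DIM('e \<times> 'f) \<and> (\<forall>k<DIM('e \<times> 'f). \<forall>l<DIM('e \<times> 'f).
    gM (i, j) p [es ! k, es ! l] = (if k = l then (if k = 0 then - 1 else 1) else 0))"
proof -
  have x: "fst p \<in> chart_img N i" "snd p \<in> chart_img X j" using p by auto
  interpret a: metric_form "\<gamma> i (fst p)" by (rule N.metric[OF x(1)])
  interpret b: oriented_form3 "h j (snd p)" "volume_form X h j (snd p)" 1 by (rule X.form3[OF x(2)])
  obtain es where es: "length es = 3" "\<And>k l. k < 3 \<Longrightarrow> l < 3 \<Longrightarrow>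
      \<gamma> i (fst p) [es ! k, es ! l] = (if k = l then (if k = 0 then - 1 else 1) else 0)"
    using lorN x(1) unfolding lorentzian_metric_def dimN by meson
  obtain a0 a1 a2 where a: "es = [a0, a1, a2]" using es(1) by (auto simp: length_3_conv)
  obtain f0 f1 f2 where f: "h j (snd p) [f0, f0] = 1" "h j (snd p) [f1, f1] = 1" "h j (snd p) [f2, f2] = 1"
    "h j (snd p) [f0, f1] = 0" "h j (snd p) [f0, f2] = 0" "h j (snd p) [f1, f2] = 0"
    using b.positive_orthonormal riemX x(2) unfolding riemannian_metric_def by metis
  have f': "h j (snd p) [f1, f0] = 0" "h j (snd p) [f2, f0] = 0" "h j (snd p) [f2, f1] = 0"
    using f b.sym by metis+
  have a': "\<gamma> i (fst p) [a0, a0] = - 1" "\<gamma> i (fst p) [a1, a1] = 1" "\<gamma> i (fst p) [a2, a2] = 1"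
    "\<gamma> i (fst p) [a0, a1] = 0" "\<gamma> i (fst p) [a0, a2] = 0" "\<gamma> i (fst p) [a1, a2] = 0"
    "\<gamma> i (fst p) [a1, a0] = 0" "\<gamma> i (fst p) [a2, a0] = 0" "\<gamma> i (fst p) [a2, a1] = 0"
    using es(2)[of 0 0] es(2)[of 1 1] es(2)[of 2 2] es(2)[of 0 1] es(2)[of 0 2] es(2)[of 1 2]
      es(2)[of 1 0] es(2)[of 2 0] es(2)[of 2 1] by (simp_all add: a numeral_2_eq_2)
  have d: "DIM('e \<times> 'f) = Suc (Suc (Suc (Suc (Suc (Suc 0)))))" by (simp add: dimN dimX)
  show ?thesis
    unfolding d
    by (rule exI[of _ "[(a0, 0), (a1, 0), (a2, 0), (0, f0), (0, f1), (0, f2)]"])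
      (simp add: All_less_Suc gM_eq a' f f' a.g_lin b.g_lin)
qed

end

section \<open>Assembly over all pairs of product charts\<close>

theorem theorem1p1:
  fixes N :: "('i, 'a::{t2_space, second_countable_topology}, 'e::euclidean_space) atlas"
    and X :: "('j, 'b::{t2_space, second_countable_topology}, 'f::euclidean_space) atlas"
    and \<chi>\<^sub>N \<alpha>\<^sub>N :: "('i, 'e) tensor"
    and h \<alpha>\<^sub>X :: "('j, 'f) tensor"
    and lam l \<epsilon>\<^sub>N :: real
  assumes "\<epsilon>\<^sub>N \<in> {- 1, 0, 1}"
    and "lorentzian_metric N \<chi>\<^sub>N"
    and "eps_eta_einstein N \<chi>\<^sub>N \<alpha>\<^sub>N \<epsilon>\<^sub>N (lam\<^sup>2) (l\<^sup>2)"
    and "riemannian_metric X h"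
    and "eps_eta_einstein X h \<alpha>\<^sub>X 1 (lam\<^sup>2) (\<epsilon>\<^sub>N * l\<^sup>2)"
  shows "let M = prod_atlas N X;
             g = metric_sum \<chi>\<^sub>N h;
             H = flux N \<chi>\<^sub>N \<alpha>\<^sub>N X h \<alpha>\<^sub>X lam l
         in sugra_solution M g H \<and>
            connection M (nabla_H g H) \<and> metric_compatible M g (nabla_H g H) \<and>
            tensor_eq M 3 (torsion g (nabla_H g H)) H"
proof -
  let ?M = "prod_atlas N X" and ?g = "metric_sum \<chi>\<^sub>N h" and ?H = "flux N \<chi>\<^sub>N \<alpha>\<^sub>N X h \<alpha>\<^sub>X lam l"
  have fc: "flux_chart N X \<chi>\<^sub>N \<alpha>\<^sub>N h \<alpha>\<^sub>X lam l \<epsilon>\<^sub>N"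
    by (rule flux_chart.intro) (use assms in auto)
  note mN = flux_chart.mfdN[OF fc] and mX = flux_chart.mfdX[OF fc]
  note dN = flux_chart.dimN[OF fc] and dX = flux_chart.dimX[OF fc]
  have mM: "oriented_manifold ?M" by (rule oriented_manifold_prod[OF mN mX])
  have dim: "DIM('e \<times> 'f) = 6" by (simp add: dN dX)
  \<comment> \<open>Invariance on overlaps, inherited from the factors; it makes g and H tensor
    fields and also drives the transformation law of the connection.\<close>
  have transform: "?g (i, j) p [u, v] = ?g (i', j') (transition ?M (i, j) (i', j') p)
        [DD (transition ?M (i, j) (i', j')) p u, DD (transition ?M (i, j) (i', j')) p v]"
    "?H (i, j) p [u, v, w] = ?H (i', j') (transition ?M (i, j) (i', j') p)
        [DD (transition ?M (i, j) (i', j')) p u, DD (transition ?M (i, j) (i', j')) p v,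
          DD (transition ?M (i, j) (i', j')) p w]"
    if p: "p \<in> overlap ?M (i, j) (i', j')" for i j i' j' p u v w
  proof -
    interpret c: flux_chart N X \<chi>\<^sub>N \<alpha>\<^sub>N h \<alpha>\<^sub>X lam l \<epsilon>\<^sub>N i j by (rule fc)
    interpret c': flux_chart N X \<chi>\<^sub>N \<alpha>\<^sub>N h \<alpha>\<^sub>X lam l \<epsilon>\<^sub>N i' j' by (rule fc)
    have p': "p \<in> overlap N i i' \<times> overlap X j j'" using p by (simp add: overlap_prod)
    then have x: "fst p \<in> overlap N i i'" "snd p \<in> overlap X j j'" by auto
    have ci: "p \<in> chart_img N i \<times> chart_img X j"
      using p overlap_img[of ?M "(i, j)" "(i', j')"] by (auto simp: chart_img_prod)
    have ci': "(transition N i i' (fst p), transition X j j' (snd p)) \<in> chart_img N i' \<times> chart_img X j'"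
      using x transition_img[OF mN, of i i'] transition_img[OF mX, of j j'] by auto
    note t = DD_transition_prod[OF mN mX p'] transition_prod[OF mN mX p']
    show "?g (i, j) p [u, v] = ?g (i', j') (transition ?M (i, j) (i', j') p)
        [DD (transition ?M (i, j) (i', j')) p u, DD (transition ?M (i, j) (i', j')) p v]"
      unfolding t c.gM_eq c'.gM_eq using c.tensorN(1) c.tensorX(1) x by (simp add: tensor_field_def)
    show "?H (i, j) p [u, v, w] = ?H (i', j') (transition ?M (i, j) (i', j') p)
        [DD (transition ?M (i, j) (i', j')) p u, DD (transition ?M (i, j) (i', j')) p v,
          DD (transition ?M (i, j) (i', j')) p w]"
      unfolding t c.H_eq[OF ci] c'.H_eq[OF ci'] c.H0_def c'.H0_def
      by (simp add: F_transform[OF mN dN c.tensorN c.N.chart3_axioms c'.N.chart3_axioms x(1)]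
          F_transform[OF mX dX c.tensorX c.X.chart3_axioms c'.X.chart3_axioms x(2)])
  qed
  have sym: "symmetric_2tensor ?M ?g"
    unfolding symmetric_2tensor_def tensor_field_def
  proof (intro conjI allI ballI impI)
    fix k :: "'i \<times> 'j"
    obtain i j where k: "k = (i, j)" by fastforce
    interpret c: flux_chart N X \<chi>\<^sub>N \<alpha>\<^sub>N h \<alpha>\<^sub>X lam l \<epsilon>\<^sub>N i j by (rule fc)
    show "multilinear 2 (?g k p)" "?g k p [u, v] = ?g k p [v, u]" if "p \<in> chart_img ?M k" for p u v
    proof -
      interpret m: metric_form "?g k p"
        using that c.metric_form_gM by (simp add: k chart_img_prod)
      show "multilinear 2 (?g k p)" by (rule multilinear_bilinear[OF m.bil])
      show "?g k p [u, v] = ?g k p [v, u]" by (rule m.sym)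
    qed
    show "smooth_on (chart_img ?M k) (\<lambda>p. ?g k p vs)" if "length vs = 2" for vs
      using that c.M.smooth_g by (auto simp: length_2_conv k chart_img_prod)
    fix k' :: "'i \<times> 'j" and p and vs :: "('e \<times> 'f) list"
    obtain i' j' where k': "k' = (i', j')" by fastforce
    assume p: "p \<in> overlap ?M k k'" and "length vs = 2"
    then obtain u v where "vs = [u, v]" using length_2_conv[of vs] by blast
    then show "?g k p vs = ?g k' (transition ?M k k' p) (map (DD (transition ?M k k') p) vs)"
      using transform(1)[OF p[unfolded k k']] by (simp add: k k')
  qed
  have lor: "lorentzian_metric ?M ?g"
    unfolding lorentzian_metric_def
  proof (intro conjI sym allI ballI)
    fix k :: "'i \<times> 'j" and p assume p: "p \<in> chart_img ?M k"
    obtain i j where k: "k = (i, j)" by fastforce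
    interpret c: flux_chart N X \<chi>\<^sub>N \<alpha>\<^sub>N h \<alpha>\<^sub>X lam l \<epsilon>\<^sub>N i j by (rule fc)
    show "\<exists>es. length es = DIM('e \<times> 'f) \<and> (\<forall>j<DIM('e \<times> 'f). \<forall>l<DIM('e \<times> 'f).
        ?g k p [es ! j, es ! l] = (if j = l then if j = 0 then - 1 else 1 else 0))"
      using c.lorentzian_frame p by (simp add: k chart_img_prod)
  qed
  have form: "form_field ?M 3 ?H"
    unfolding form_field_def tensor_field_def
  proof (intro conjI allI ballI impI)
    fix k :: "'i \<times> 'j"
    obtain i j where k: "k = (i, j)" by fastforce
    interpret c: flux_chart N X \<chi>\<^sub>N \<alpha>\<^sub>N h \<alpha>\<^sub>X lam l \<epsilon>\<^sub>N i j by (rule fc)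
    show "multilinear 3 (?H k p)" "alternating 3 (?H k p)" if "p \<in> chart_img ?M k" for p
    proof -
      have p: "p \<in> chart_img N i \<times> chart_img X j" using that by (simp add: k chart_img_prod)
      show "multilinear 3 (?H k p)"
        unfolding k by (rule multilinear_3I; unfold c.H_eq[OF p]; rule c.H0_linear[OF p])
      show "alternating 3 (?H k p)"
        unfolding k by (rule alternating_3I; unfold c.H_eq[OF p]; rule c.H0_skew[OF p])
    qed
    show "smooth_on (chart_img ?M k) (\<lambda>p. ?H k p vs)" if len: "length vs = 3" for vs
    proof -
      obtain u v w where vs: "vs = [u, v, w]" using len length_3_conv[of vs] by blast
      show ?thesis
        unfolding k chart_img_prod vs
        by (rule smooth_on_transform[OF c.open_ST c.smooth_H0]) (rule c.H_eq[symmetric])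
    qed
    fix k' :: "'i \<times> 'j" and p and vs :: "('e \<times> 'f) list"
    obtain i' j' where k': "k' = (i', j')" by fastforce
    assume p: "p \<in> overlap ?M k k'" and "length vs = 3"
    then obtain u v w where "vs = [u, v, w]" using length_3_conv[of vs] by blast
    then show "?H k p vs = ?H k' (transition ?M k k' p) (map (DD (transition ?M k k') p) vs)"
      using transform(2)[OF p[unfolded k k']] by (simp add: k k')
  qed
  have flat: "ricci_flat ?M (nabla_H ?g ?H)"
    unfolding ricci_flat_def tensor_eq_def
  proof (intro allI ballI impI)
    fix k :: "'i \<times> 'j" and p and vs :: "('e \<times> 'f) list"
    assume p: "p \<in> chart_img ?M k" and "length vs = 2"
    then obtain v w where vs: "vs = [v, w]" using length_2_conv[of vs] by blast
    obtain i j where k: "k = (i, j)" by fastforce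
    interpret c: flux_chart N X \<chi>\<^sub>N \<alpha>\<^sub>N h \<alpha>\<^sub>X lam l \<epsilon>\<^sub>N i j by (rule fc)
    show "ricci (nabla_H ?g ?H) k p vs = 0"
      using c.ricci_H p by (simp add: k vs chart_img_prod)
  qed
  have closed: "closed_form ?M 3 ?H"
    unfolding closed_form_def tensor_eq_def
  proof (intro allI ballI impI)
    fix k :: "'i \<times> 'j" and p and vs :: "('e \<times> 'f) list"
    assume p: "p \<in> chart_img ?M k" and "length vs = Suc 3"
    then obtain u v w z where vs: "vs = [u, v, w, z]" using length_4_conv[of vs] by (auto simp del: split_paired_All split_paired_Ex)
    obtain i j where k: "k = (i, j)" by fastforce
    interpret c: flux_chart N X \<chi>\<^sub>N \<alpha>\<^sub>N h \<alpha>\<^sub>X lam l \<epsilon>\<^sub>N i j by (rule fc)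
    show "ext_d ?H k p vs = 0"
      unfolding k vs
    proof (rule c.closed_H0)
      show "p \<in> chart_img N i \<times> chart_img X j" using p by (simp add: k chart_img_prod)
    qed (rule c.H_eq)
  qed
  have coclosed: "coclosed_form ?M ?g 3 ?H"
    unfolding coclosed_form_def closed_form_def tensor_eq_def
  proof (intro allI ballI impI)
    fix k :: "'i \<times> 'j" and p and vs :: "('e \<times> 'f) list"
    assume p: "p \<in> chart_img ?M k" and "length vs = Suc (DIM('e \<times> 'f) - 3)"
    then obtain u v w z where vs: "vs = [u, v, w, z]" using length_4_conv[of vs] dim by (auto simp del: split_paired_All split_paired_Ex)
    obtain i j where k: "k = (i, j)" by fastforce
    interpret c: flux_chart N X \<chi>\<^sub>N \<alpha>\<^sub>N h \<alpha>\<^sub>X lam l \<epsilon>\<^sub>N i j by (rule fc)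
    \<comment> \<open>The Hodge dual is again of the form \<open>H0\<close>, with both volume
      coefficients negated, so the closedness lemma applies to it directly.\<close>
    show "ext_d (hodge ?M ?g 3 ?H) k p vs = 0"
      unfolding k vs
    proof (rule c.closed_H0)
      show "p \<in> chart_img N i \<times> chart_img X j" using p by (simp add: k chart_img_prod)
    qed (rule c.hodge_H)
  qed
  have iso: "isotropic ?M ?g 3 ?H"
    unfolding isotropic_def
  proof (intro allI ballI)
    fix k :: "'i \<times> 'j" and p assume p: "p \<in> chart_img ?M k"
    obtain i j where k: "k = (i, j)" by fastforce
    interpret c: flux_chart N X \<chi>\<^sub>N \<alpha>\<^sub>N h \<alpha>\<^sub>X lam l \<epsilon>\<^sub>N i j by (rule fc)
    show "form_inner 3 ?g ?H ?H k p = 0"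
      using c.isotropic_H p by (simp add: k chart_img_prod)
  qed
  have nabla: "bilinear (nabla_H ?g ?H (i, j) p)"
    "DD (\<lambda>y. ?g (i, j) y [v, w]) p u = ?g (i, j) p [nabla_H ?g ?H (i, j) p u v, w] + ?g (i, j) p [v, nabla_H ?g ?H (i, j) p u w]"
    "?g (i, j) p [nabla_H ?g ?H (i, j) p u v - nabla_H ?g ?H (i, j) p v u, w] = ?H (i, j) p [u, v, w]"
    if "p \<in> chart_img ?M (i, j)" for i j p u v w
  proof -
    interpret c: flux_chart N X \<chi>\<^sub>N \<alpha>\<^sub>N h \<alpha>\<^sub>X lam l \<epsilon>\<^sub>N i j by (rule fc)
    have p: "p \<in> chart_img N i \<times> chart_img X j" using that by (simp add: chart_img_prod)
    show "bilinear (nabla_H ?g ?H (i, j) p)"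
      "DD (\<lambda>y. ?g (i, j) y [v, w]) p u = ?g (i, j) p [nabla_H ?g ?H (i, j) p u v, w] + ?g (i, j) p [v, nabla_H ?g ?H (i, j) p u w]"
      "?g (i, j) p [nabla_H ?g ?H (i, j) p u v - nabla_H ?g ?H (i, j) p v u, w] = ?H (i, j) p [u, v, w]"
      using c.nabla_H_chart[where H = ?H and c = lam and l = l] c.H_eq p by blast+
  qed
  have con: "connection ?M (nabla_H ?g ?H)"
    unfolding connection_def Let_def
  proof (intro conjI allI ballI)
    fix k :: "'i \<times> 'j"
    obtain i j where k: "k = (i, j)" by fastforce
    interpret c: flux_chart N X \<chi>\<^sub>N \<alpha>\<^sub>N h \<alpha>\<^sub>X lam l \<epsilon>\<^sub>N i j by (rule fc)
    show "bilinear (nabla_H ?g ?H k p)" if "p \<in> chart_img ?M k" for p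
      using nabla(1) that by (simp add: k)
    show "smooth_on (chart_img ?M k) (\<lambda>p. nabla_H ?g ?H k p u v)" for u v
      using c.nabla_H_chart(2)[where H = ?H and c = lam and l = l] c.H_eq by (simp add: k chart_img_prod)
    fix k' :: "'i \<times> 'j" and p u v
    assume p: "p \<in> overlap ?M k k'"
    obtain i' j' where k': "k' = (i', j')" by fastforce
    interpret c': flux_chart N X \<chi>\<^sub>N \<alpha>\<^sub>N h \<alpha>\<^sub>X lam l \<epsilon>\<^sub>N i' j' by (rule fc)
    let ?\<tau> = "transition ?M k k'"
    let ?L = "DD ?\<tau> p"
    have ci: "p \<in> chart_img N i \<times> chart_img X j"
      using p overlap_img[of ?M k k'] by (auto simp: chart_img_prod k)
    have ci': "?\<tau> p \<in> chart_img N i' \<times> chart_img X j'"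
      using p transition_img[OF mM, of k k'] by (auto simp: chart_img_prod k')
    have lL: "linear ?L" by (rule DD_transition_linear[OF mM p])
    \<comment> \<open>The inhomogeneous term comes from the Levi-Civita part alone; the torsion part
      \<open>sh\<close> transforms as a tensor.\<close>
    have lc: "?L (levi_civita ?g k p u v) = DD (\<lambda>y. DD ?\<tau> y v) p u + levi_civita ?g k' (?\<tau> p) (?L u) (?L v)"
    proof (rule levi_civita_transform[OF _ _ open_overlap[OF mM] _ p smooth_transition[OF mM]])
      show "metric_chart ?g k (chart_img ?M k)" "metric_chart ?g k' (chart_img ?M k')"
        using c.M.metric_chart_axioms c'.M.metric_chart_axioms by (simp_all add: k k' chart_img_prod)
      show "?g k y [u, v] = ?g k' (?\<tau> y) [DD ?\<tau> y u, DD ?\<tau> y v]" if "y \<in> overlap ?M k k'" for y u v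
        using transform(1) that unfolding k k' by blast
    qed (rule overlap_img transition_img[OF mM])+
    have sh: "?L (sharp (?g k p) (\<lambda>w. ?H k p [u, v, w])) = sharp (?g k' (?\<tau> p)) (\<lambda>w. ?H k' (?\<tau> p) [?L u, ?L v, w])"
    proof (rule sharp_natural[OF _ _ lL])
      show "metric_form (?g k p)" "metric_form (?g k' (?\<tau> p))"
        using c.metric_form_gM[OF ci] c'.metric_form_gM[OF ci'] by (simp_all add: k k')
      show "?g k p [u, v] = ?g k' (?\<tau> p) [?L u, ?L v]" for u v
        using transform(1) p unfolding k k' by blast
      show "linear (\<lambda>w. ?H k' (?\<tau> p) [?L u, ?L v, w])"
        using c'.H0_linear(1)[OF ci'] c'.H_eq[OF ci'] by (simp add: k')
      show "?H k p [u, v, w] = ?H k' (?\<tau> p) [?L u, ?L v, ?L w]" for w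
        using transform(2) p unfolding k k' by blast
    qed
    show "?L (nabla_H ?g ?H k p u v) = DD (\<lambda>y. DD ?\<tau> y v) p u + nabla_H ?g ?H k' (?\<tau> p) (?L u) (?L v)"
      unfolding nabla_H_def linear_add[OF lL] linear_scale[OF lL] lc sh by simp
  qed
  have comp: "metric_compatible ?M ?g (nabla_H ?g ?H)"
    unfolding metric_compatible_def using nabla(2) by auto
  have tor: "tensor_eq ?M 3 (torsion ?g (nabla_H ?g ?H)) ?H"
    unfolding tensor_eq_def
  proof (intro allI ballI impI)
    fix k :: "'i \<times> 'j" and p and vs :: "('e \<times> 'f) list"
    assume p: "p \<in> chart_img ?M k" and "length vs = 3"
    then obtain u v w where vs: "vs = [u, v, w]" using length_3_conv[of vs] by blast
    obtain i j where k: "k = (i, j)" by fastforce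
    show "torsion ?g (nabla_H ?g ?H) k p vs = ?H k p vs"
      using nabla(3)[OF p[unfolded k]] by (simp add: torsion_def k vs numeral_2_eq_2)
  qed
  show ?thesis
    unfolding Let_def sugra_solution_def
    by (intro conjI mM dim lor form flat closed coclosed iso con comp tor)
qed

end
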